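(* Let $D_0=\{(p_1,p_2,p_3): 1<p_1,p_2<2,\ \frac1{p_1}+\frac1{p_2}<\frac32,\ p_3\in(1,\infty)\}$ and let $(p_1,p_2,p_3)\in D_0$; set $\frac1{p'}=1-\big(\frac1{p_1}+\frac1{p_2}+\frac1{p_3}\big)$. Let $\Lambda$ be the model 4-linear form $$\Lambda(f_1,f_2,f_3,f_4)=\sum_{(k,n,l)\in\mathbb{Z}^3}\int_{\mathbb{R}}\prod_{j=1}^4(f_j)_{k,n,l_j}(x)\,dx,\qquad l_1=l,\ l_2=l,\ l_3=18,\ l_4=2l+18,$$ with the wave packets $(f)_{k,n,l}$ as described in the context. Then for any measurable sets $F_1,F_2,F_3,F\subseteq\mathbb{R}$ of finite measure there exists a measurable set $F'\subseteq F$ with $|F'|\ge\frac12|F|$ such that $$|\Lambda(f_1,f_2,f_3,f_4)|\lesssim |F_1|^{1/p_1}|F_2|^{1/p_2}|F_3|^{1/p_3}|F'|^{1/p'}$$ for all measurable $f_1,f_2,f_3,f_4$ with $|f_1|\le\chi_{F_1}$, $|f_2|\le\chi_{F_2}$, $|f_3|\le\chi_{F_3}$, $|f_4|\le\chi_{F'}$, the implicit constant being independent of the sets and functions.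
   Context: Fix $\psi\in\mathcal{S}(\mathbb{R})$ with $\operatorname{supp}\widehat\psi\subseteq[0,1]$ and $\sum_{l\in\mathbb{Z}}\widehat\psi(\xi-\frac l2)=1$ for all $\xi\in\mathbb{R}$, and define $\psi_{k,l}$ by $\widehat{\psi_{k,l}}(\xi)=\widehat\psi\big(\frac{\xi-2^{k-1}l}{2^k}\big)$ for $(k,l)\in\mathbb{Z}^2$. Fix a non-negative $\varphi\in\mathcal{S}(\mathbb{R})$ with $\operatorname{supp}\widehat\varphi\subseteq[-1,1]$, $\widehat\varphi(0)=1$, and set $\varphi_k(x)=2^k\varphi(2^kx)$. For $(k,n)\in\mathbb{Z}^2$ let $I_{k,n}=[2^{-k}n,2^{-k}(n+1))$ and $\chi^*_{I_{k,n}}=\chi_{I_{k,n}}*\varphi_k$. For a function $f$ and $(k,n,l)\in\mathbb{Z}^3$ define $f_{k,n,l}(x)=\chi^*_{I_{k,n}}(x)\,(f*\psi_{k,l})(x)$. $\chi_E$ is the indicator of $E$ and $|E|$ its Lebesgue measure. *)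

theory Defs
  imports "HOL-Analysis.Analysis"
begin

definition fourier :: "(real \<Rightarrow> complex) \<Rightarrow> real \<Rightarrow> complex" where
  "fourier f \<xi> = (LINT x|lebesgue. f x * cis (- 2 * pi * x * \<xi>))"

definition nth_deriv :: "nat \<Rightarrow> (real \<Rightarrow> complex) \<Rightarrow> real \<Rightarrow> complex" where
  "nth_deriv n f = ((\<lambda>g x. vector_derivative g (at x)) ^^ n) f"

definition schwartz :: "(real \<Rightarrow> complex) \<Rightarrow> bool" where
  "schwartz f \<longleftrightarrow>
     (\<forall>n x. nth_deriv n f differentiable (at x)) \<and>
     (\<forall>a b. bounded (range (\<lambda>x. (x ^ a) *\<^sub>R nth_deriv b f x)))"

definition conv :: "(real \<Rightarrow> 'a::{banach, real_normed_algebra, second_countable_topology})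
      \<Rightarrow> (real \<Rightarrow> 'a) \<Rightarrow> real \<Rightarrow> 'a" where
  "conv f g x = (LINT y|lebesgue. f y * g (x - y))"

text \<open>psi_{k,l}: the function whose Fourier transform is
  hat psi((xi - 2^{k-1} l)/2^k), i.e. psi_{k,l}(x) = 2^k e^{2 pi i 2^{k-1} l x} psi(2^k x).\<close>
definition psi_kl :: "(real \<Rightarrow> complex) \<Rightarrow> int \<Rightarrow> int \<Rightarrow> real \<Rightarrow> complex" where
  "psi_kl \<psi> k l x = complex_of_real (2 powr real_of_int k)
       * cis (2 * pi * (2 powr (real_of_int k - 1) * real_of_int l) * x)
       * \<psi> (2 powr real_of_int k * x)"

definition phi_k :: "(real \<Rightarrow> real) \<Rightarrow> int \<Rightarrow> real \<Rightarrow> real" where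
  "phi_k \<phi> k x = 2 powr real_of_int k * \<phi> (2 powr real_of_int k * x)"

definition dyadic_I :: "int \<Rightarrow> int \<Rightarrow> real set" where
  "dyadic_I k n = {2 powr (- real_of_int k) * real_of_int n ..< 2 powr (- real_of_int k) * (real_of_int n + 1)}"

definition chi_star :: "(real \<Rightarrow> real) \<Rightarrow> int \<Rightarrow> int \<Rightarrow> real \<Rightarrow> real" where
  "chi_star \<phi> k n = conv (indicator (dyadic_I k n)) (phi_k \<phi> k)"

definition wave_packet :: "(real \<Rightarrow> complex) \<Rightarrow> (real \<Rightarrow> real) \<Rightarrow> (real \<Rightarrow> complex)
      \<Rightarrow> int \<Rightarrow> int \<Rightarrow> int \<Rightarrow> real \<Rightarrow> complex" where
  "wave_packet \<psi> \<phi> f k n l x = complex_of_real (chi_star \<phi> k n x) * conv f (psi_kl \<psi> k l) x"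

definition Lambda_S :: "(real \<Rightarrow> complex) \<Rightarrow> (real \<Rightarrow> real) \<Rightarrow> (int \<times> int \<times> int) set
      \<Rightarrow> (real \<Rightarrow> complex) \<Rightarrow> (real \<Rightarrow> complex) \<Rightarrow> (real \<Rightarrow> complex) \<Rightarrow> (real \<Rightarrow> complex) \<Rightarrow> complex" where
  "Lambda_S \<psi> \<phi> S f1 f2 f3 f4 =
     (\<Sum>(k,n,l)\<in>S. LINT x|lebesgue.
        wave_packet \<psi> \<phi> f1 k n l x * wave_packet \<psi> \<phi> f2 k n l x *
        wave_packet \<psi> \<phi> f3 k n 18 x * wave_packet \<psi> \<phi> f4 k n (2 * l + 18) x)"

end

theory Submission
  imports Defs "HOL-Probability.Characteristic_Functions"
begin

text \<open>
  No factor of the form is conjugated, so the integral of the four wave packets vanishes unless 0 lies in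
  the sum of their frequency supports, which lies in \<open>2^k [2l + 14, 2l + 26]\<close>. Only \<open>l = -13, ..., -7\<close>
  survive, and for each of these the first two factors have mean zero: the form is a finite sum of
  paraproducts, and the sum over \<open>n\<close> is harmless since the smooth cutoffs sum to at most 1.

  Let \<open>a_j = |F_j| / |F|\<close>. The exceptional set is the union of the tripled dyadic intervals on which some
  \<open>F_j\<close> has density larger than \<open>18 a_j\<close>; put \<open>F' = F\<close> minus this set, and let \<open>w = 1 + 2^k d\<close> with \<open>d\<close> the
  distance to the complement of the exceptional set. Then at scale \<open>k\<close> the fourth factor is
  \<open>O(w^-8)\<close>, the third is \<open>O(min(1, a_3) w^2)\<close>, and the square functions of the first two, weighted by
  \<open>w^-6\<close>, have squared norm \<open>O(|F| min(a_j, a_j^2))\<close>. The bound with \<open>a_j\<close> is almost orthogonality; the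
  bound with \<open>a_j^2\<close> is a Calderon-Zygmund decomposition along a stopping scale, the weight taking care of
  the large intervals.
\<close>

section \<open>Fourier analysis of band-limited factors\<close>

text \<open>Removing the exceptional set from F constrains only the support of \<open>f4\<close>.
  The other three convolutions must still be estimated at points deep inside that set, where their
  averages may be large. The weight makes this affordable: a heavy interval is no longer than d plus
  the distance from x to any of its points, so every loss caused by long intervals is a power of w,
  and these losses are paid from the decay of the fourth factor. The budget is 8 = 2 + 3 + 3: moving
  a tail across a long stopping interval costs w^2, and the bad part of each square function costs
  w^3. The minimum of a and a^2 is at most a^(2 alpha) for every alpha in [1/2, 1], which is where 1
  < p_1, p_2 < 2 enters; the minimum of 1 and a is at most a^alpha for every alpha in [0, 1], so p_3
  has no upper limit. The total power of |F| left over is |F|^(1/p'), and |F'| lies between |F|/2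
  and |F|.\<close>

lemma integrable_pair_bounded:
  fixes u v :: "real \<Rightarrow> complex" and w :: "real \<times> real \<Rightarrow> complex"
  assumes u: "integrable lborel u" and v: "integrable lborel v"
    and w: "w \<in> borel_measurable (lborel \<Otimes>\<^sub>M lborel)" and B: "\<And>p. cmod (w p) \<le> B"
  shows "integrable (lborel \<Otimes>\<^sub>M lborel) (\<lambda>(x, y). u x * (v y * w (x, y)))"
proof (rule integrableI_bounded)
  have [measurable]: "u \<in> borel_measurable lborel" "v \<in> borel_measurable lborel"
    using u v by auto
  note w[measurable]
  show "(\<lambda>(x, y). u x * (v y * w (x, y))) \<in> borel_measurable (lborel \<Otimes>\<^sub>M lborel)"
    by measurable
  have B0: "0 \<le> B" using B[of undefined] norm_ge_zero order_trans by blast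
  have "(\<integral>\<^sup>+p. ennreal (norm (case p of (x, y) \<Rightarrow> u x * (v y * w (x, y)))) \<partial>(lborel \<Otimes>\<^sub>M lborel))
      = (\<integral>\<^sup>+x. \<integral>\<^sup>+y. ennreal (norm (u x * (v y * w (x, y)))) \<partial>lborel \<partial>lborel)"
    by (subst lborel.nn_integral_fst[symmetric]) (auto simp: case_prod_beta)
  also have "\<dots> \<le> (\<integral>\<^sup>+x. \<integral>\<^sup>+y. ennreal (B * norm (u x)) * ennreal (norm (v y)) \<partial>lborel \<partial>lborel)"
  proof (intro nn_integral_mono)
    fix x y
    have "norm (u x) * (norm (v y) * norm (w (x, y))) \<le> norm (u x) * (norm (v y) * B)"
      using B by (intro mult_left_mono) auto
    then show "ennreal (norm (u x * (v y * w (x, y)))) \<le> ennreal (B * norm (u x)) * ennreal (norm (v y))"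
      using B0 by (simp add: ennreal_mult[symmetric] norm_mult ennreal_leI mult_ac)
  qed
  also have "\<dots> = ennreal B * (\<integral>\<^sup>+x. ennreal (norm (u x)) \<partial>lborel) * (\<integral>\<^sup>+y. ennreal (norm (v y)) \<partial>lborel)"
    using B0 by (simp add: nn_integral_cmult nn_integral_multc ennreal_mult)
  also have "\<dots> < \<infinity>"
    using u v unfolding integrable_iff_bounded by (simp add: ennreal_mult_less_top)
  finally show "(\<integral>\<^sup>+p. ennreal (norm (case p of (x, y) \<Rightarrow> u x * (v y * w (x, y)))) \<partial>(lborel \<Otimes>\<^sub>M lborel)) < \<infinity>" .
qed

text \<open>Fubini for a kernel that is merely bounded, with an integrable function on each side.
  The second claim records the integrability of the outer integrand, which an equation between
  Bochner integrals does not carry.\<close>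

lemma integral_swap_bounded:
  fixes u v :: "real \<Rightarrow> complex" and w :: "real \<Rightarrow> real \<Rightarrow> complex"
  assumes "integrable lborel u" and "integrable lborel v"
    and "case_prod w \<in> borel_measurable (lborel \<Otimes>\<^sub>M lborel)" and "\<And>x y. cmod (w x y) \<le> B"
  shows "(\<integral>x. u x * (\<integral>y. v y * w x y \<partial>lborel) \<partial>lborel)
       = (\<integral>y. v y * (\<integral>x. u x * w x y \<partial>lborel) \<partial>lborel)" (is ?A)
    and "integrable lborel (\<lambda>x. u x * (\<integral>y. v y * w x y \<partial>lborel))" (is ?B)
proof -
  have I: "integrable (lborel \<Otimes>\<^sub>M lborel) (\<lambda>(x, y). u x * (v y * w x y))"
    using integrable_pair_bounded[of u v "case_prod w" B] assms by (simp add: split_def)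
  have "(\<integral>y. \<integral>x. u x * (v y * w x y) \<partial>lborel \<partial>lborel) = (\<integral>x. \<integral>y. u x * (v y * w x y) \<partial>lborel \<partial>lborel)"
    using lborel_pair.Fubini_integral[OF I] .
  moreover have "(\<integral>x. u x * (v y * w x y) \<partial>lborel) = v y * (\<integral>x. u x * w x y \<partial>lborel)" for y
    by (simp add: mult.left_commute[of _ "v y"])
  ultimately show ?A by simp
  show ?B using lborel_pair.integrable_fst'[OF I] by simp
qed

lemma lborel_integral_translate:
  fixes f :: "real \<Rightarrow> complex"
  shows "(\<integral>x. f (x - y) \<partial>lborel) = (\<integral>x. f x \<partial>lborel)"
  using lborel_integral_real_affine[of 1 f "-y"] by simp

lemma lborel_integral_reflect:
  fixes f :: "real \<Rightarrow> complex"
  shows "(\<integral>y. f (x - y) \<partial>lborel) = (\<integral>y. f y \<partial>lborel)"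
  using lborel_integral_real_affine[of "-1" f x] by simp

lemma nn_integral_lborel_reflect:
  fixes f :: "real \<Rightarrow> ennreal"
  assumes "f \<in> borel_measurable borel"
  shows "(\<integral>\<^sup>+y. f (x - y) \<partial>lborel) = (\<integral>\<^sup>+y. f y \<partial>lborel)"
  using nn_integral_real_affine[of f "-1" x] assms by simp

lemma nn_integral_lborel_translate:
  fixes f :: "real \<Rightarrow> ennreal"
  assumes "f \<in> borel_measurable borel"
  shows "(\<integral>\<^sup>+x. f (x - y) \<partial>lborel) = (\<integral>\<^sup>+x. f x \<partial>lborel)"
  using nn_integral_real_affine[of f 1 "-y"] assms by simp

lemma norm_integral_le_nn_integral:
  fixes f :: "'a \<Rightarrow> 'b::{banach, second_countable_topology}"
  shows "ennreal (norm (integral\<^sup>L M f)) \<le> (\<integral>\<^sup>+x. ennreal (norm (f x)) \<partial>M)"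
  by (cases "integrable M f") (auto intro: integral_norm_bound_ennreal simp: not_integrable_integral_eq)

lemma integrable_le_indicator:
  fixes f :: "real \<Rightarrow> complex"
  assumes f: "f \<in> borel_measurable borel" and S: "S \<in> sets borel" "emeasure lborel S < \<infinity>"
    and le: "\<And>x. cmod (f x) \<le> indicator S x"
  shows "integrable lborel f"
proof (rule Bochner_Integration.integrable_bound)
  show "integrable lborel (indicator S :: real \<Rightarrow> real)" using S by (intro integrable_real_indicator) auto
qed (use f le in auto)

lemma ennreal_mult_add:
  assumes "0 \<le> p" "0 \<le> q" "0 \<le> r" "0 \<le> s"
  shows "ennreal (p * q + r * s) = ennreal p * ennreal q + ennreal r * ennreal s"
  using assms by (simp only: ennreal_plus ennreal_mult mult_nonneg_nonneg)

text \<open>\<open>conv\<close> integrates over the completed measure. For Borel functions this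
  agrees with \<open>lborel\<close>, where Fubini and affine substitution are available; Lebesgue
  measurable data return only at the very end.\<close>

lemma conv_lborel:
  fixes f g :: "real \<Rightarrow> 'a::{banach, real_normed_algebra, second_countable_topology}"
  assumes [measurable]: "f \<in> borel_measurable borel" "g \<in> borel_measurable borel"
  shows "conv f g x = (\<integral>y. f y * g (x - y) \<partial>lborel)"
  unfolding conv_def by (rule integral_completion) measurable

lemma borel_measurable_conv [measurable (raw)]:
  fixes f g :: "real \<Rightarrow> 'a::{banach, real_normed_algebra, second_countable_topology}"
  assumes [measurable]: "f \<in> borel_measurable borel" "g \<in> borel_measurable borel"
  shows "conv f g \<in> borel_measurable borel"
proof -
  have "conv f g = (\<lambda>x. \<integral>y. f y * g (x - y) \<partial>lborel)"
    using assms by (intro ext conv_lborel)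
  then show ?thesis by simp
qed

lemma nn_integral_norm_conv_le:
  fixes f g :: "real \<Rightarrow> 'a::{banach, real_normed_algebra, second_countable_topology}"
  assumes [measurable]: "f \<in> borel_measurable borel" "g \<in> borel_measurable borel"
  shows "ennreal (norm (conv f g x)) \<le> (\<integral>\<^sup>+y. ennreal (norm (f y) * norm (g (x - y))) \<partial>lborel)"
proof -
  have "ennreal (norm (conv f g x)) \<le> (\<integral>\<^sup>+y. ennreal (norm (f y * g (x - y))) \<partial>lborel)"
    using norm_integral_le_nn_integral[of lborel "\<lambda>y. f y * g (x - y)"] conv_lborel[of f g x] assms by simp
  also have "\<dots> \<le> (\<integral>\<^sup>+y. ennreal (norm (f y) * norm (g (x - y))) \<partial>lborel)"
    by (intro nn_integral_mono ennreal_leI norm_mult_ineq)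
  finally show ?thesis .
qed

lemma integrable_conv_pair:
  fixes f g :: "real \<Rightarrow> complex"
  assumes f: "integrable lborel f" and g: "integrable lborel g"
  shows "integrable (lborel \<Otimes>\<^sub>M lborel) (\<lambda>(x, y). f y * g (x - y))"
proof (rule integrableI_bounded)
  have [measurable]: "f \<in> borel_measurable borel" "g \<in> borel_measurable borel"
    using f g by auto
  show "(\<lambda>(x, y). f y * g (x - y)) \<in> borel_measurable (lborel \<Otimes>\<^sub>M lborel)"
    by measurable
  have "(\<integral>\<^sup>+p. ennreal (norm (case p of (x, y) \<Rightarrow> f y * g (x - y))) \<partial>(lborel \<Otimes>\<^sub>M lborel))
      = (\<integral>\<^sup>+y. \<integral>\<^sup>+x. ennreal (norm (f y)) * ennreal (norm (g (x - y))) \<partial>lborel \<partial>lborel)"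
    by (subst lborel_pair.nn_integral_snd[symmetric])
       (auto simp: case_prod_beta norm_mult ennreal_mult)
  also have "\<dots> = (\<integral>\<^sup>+y. ennreal (norm (f y)) * (\<integral>\<^sup>+x. ennreal (norm (g x)) \<partial>lborel) \<partial>lborel)"
    by (simp add: nn_integral_cmult nn_integral_lborel_translate[of "\<lambda>x. ennreal (norm (g x))"])
  also have "\<dots> = (\<integral>\<^sup>+y. ennreal (norm (f y)) \<partial>lborel) * (\<integral>\<^sup>+x. ennreal (norm (g x)) \<partial>lborel)"
    by (simp add: nn_integral_multc)
  also have "\<dots> < \<infinity>"
    using f g unfolding integrable_iff_bounded by (simp add: ennreal_mult_less_top)
  finally show "(\<integral>\<^sup>+p. ennreal (norm (case p of (x, y) \<Rightarrow> f y * g (x - y))) \<partial>(lborel \<Otimes>\<^sub>M lborel)) < \<infinity>" .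
qed

lemma integrable_conv:
  fixes f g :: "real \<Rightarrow> complex"
  assumes f: "integrable lborel f" and g: "integrable lborel g"
  shows "integrable lborel (conv f g)"
proof -
  have "f \<in> borel_measurable borel" "g \<in> borel_measurable borel" using f g by auto
  then have "conv f g = (\<lambda>x. \<integral>y. f y * g (x - y) \<partial>lborel)" by (intro ext conv_lborel)
  with lborel_pair.integrable_fst'[OF integrable_conv_pair[OF f g]] show ?thesis by simp
qed

lemma fourier_lborel:
  assumes [measurable]: "f \<in> borel_measurable borel"
  shows "fourier f \<xi> = (\<integral>x. f x * cis (- 2 * pi * x * \<xi>) \<partial>lborel)"
proof -
  have "(\<lambda>x. cis (- 2 * pi * x * \<xi>)) \<in> borel_measurable borel"
    by (intro borel_measurable_continuous_onI continuous_intros)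
  then show ?thesis unfolding fourier_def by (intro integral_completion) measurable
qed

lemma cis_measurable [measurable]: "cis \<in> borel_measurable borel"
  by (intro borel_measurable_continuous_onI continuous_intros)

lemma borel_measurable_fourier:
  assumes [measurable]: "f \<in> borel_measurable borel"
  shows "fourier f \<in> borel_measurable borel"
proof -
  have "fourier f = (\<lambda>\<xi>. \<integral>x. f x * cis (- 2 * pi * x * \<xi>) \<partial>lborel)"
    using assms by (intro ext fourier_lborel)
  then show ?thesis by simp
qed

lemma norm_fourier_le:
  assumes "integrable lborel f"
  shows "cmod (fourier f \<xi>) \<le> (\<integral>x. cmod (f x) \<partial>lborel)"
proof -
  have "f \<in> borel_measurable borel" using assms by auto
  then have "cmod (fourier f \<xi>) \<le> (\<integral>x. norm (f x * cis (- 2 * pi * x * \<xi>)) \<partial>lborel)"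
    by (simp add: fourier_lborel integral_norm_bound del: norm_mult)
  then show ?thesis by (simp add: norm_mult)
qed

lemma fourier_conv:
  assumes f: "integrable lborel f" and g: "integrable lborel g"
  shows "fourier (conv f g) \<xi> = fourier f \<xi> * fourier g \<xi>"
proof -
  have [measurable]: "f \<in> borel_measurable borel" "g \<in> borel_measurable borel" using f g by auto
  have I: "integrable (lborel \<Otimes>\<^sub>M lborel) (\<lambda>(x, y). (f y * g (x - y)) * cis (- 2 * pi * x * \<xi>))"
    by (rule Bochner_Integration.integrable_bound[OF integrable_conv_pair[OF f g]])
       (auto simp: norm_mult)
  have "fourier (conv f g) \<xi> = (\<integral>x. \<integral>y. (f y * g (x - y)) * cis (- 2 * pi * x * \<xi>) \<partial>lborel \<partial>lborel)"
    by (subst fourier_lborel) (auto simp: conv_lborel)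
  also have "\<dots> = (\<integral>y. \<integral>x. (f y * g (x - y)) * cis (- 2 * pi * x * \<xi>) \<partial>lborel \<partial>lborel)"
    using lborel_pair.Fubini_integral[OF I] by simp
  also have "\<dots> = (\<integral>y. (f y * cis (- 2 * pi * y * \<xi>)) * fourier g \<xi> \<partial>lborel)"
  proof (rule Bochner_Integration.integral_cong[OF refl])
    fix y
    have "(\<integral>x. (f y * g (x - y)) * cis (- 2 * pi * x * \<xi>) \<partial>lborel)
        = (\<integral>x. (\<lambda>x. (f y * cis (- 2 * pi * y * \<xi>)) * (g x * cis (- 2 * pi * x * \<xi>))) (x - y) \<partial>lborel)"
      by (rule Bochner_Integration.integral_cong[OF refl])
         (simp add: mult_ac cis_mult algebra_simps)
    also have "\<dots> = (\<integral>x. (f y * cis (- 2 * pi * y * \<xi>)) * (g x * cis (- 2 * pi * x * \<xi>)) \<partial>lborel)"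
      by (rule lborel_integral_translate)
    also have "\<dots> = (f y * cis (- 2 * pi * y * \<xi>)) * fourier g \<xi>"
      by (simp add: fourier_lborel)
    finally show "(\<integral>x. (f y * g (x - y)) * cis (- 2 * pi * x * \<xi>) \<partial>lborel)
        = (f y * cis (- 2 * pi * y * \<xi>)) * fourier g \<xi>" .
  qed
  also have "\<dots> = fourier f \<xi> * fourier g \<xi>" by (simp add: fourier_lborel)
  finally show ?thesis .
qed

section \<open>Fourier inversion by Gaussian regularisation\<close>

lemma std_normal_fourier:
  "(\<integral>s. complex_of_real (std_normal_density s) * cis (t * s) \<partial>lborel) = complex_of_real (exp (- (t\<^sup>2) / 2))"
proof -
  have "complex_of_real (exp (- (t\<^sup>2) / 2)) = char std_normal_distribution t"
    by (simp add: char_std_normal_distribution)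
  also have "\<dots> = (\<integral>s. complex_of_real (std_normal_density s) * cis (t * s) \<partial>lborel)"
    unfolding char_def
    by (subst integral_density) (auto simp: cis_conv_exp scaleR_conv_of_real mult_ac)
  finally show ?thesis by simp
qed

lemma std_normal_fourier_scaled:
  assumes e: "0 < (e::real)"
  shows "(\<integral>\<xi>. complex_of_real (std_normal_density (e * \<xi>)) * cis (t * \<xi>) \<partial>lborel)
    = complex_of_real (exp (- ((t / e)\<^sup>2) / 2) / e)"
proof -
  have "(\<integral>s. complex_of_real (std_normal_density s) * cis ((t / e) * s) \<partial>lborel)
     = \<bar>e\<bar> *\<^sub>R (\<integral>\<xi>. complex_of_real (std_normal_density (0 + e * \<xi>)) * cis ((t / e) * (0 + e * \<xi>)) \<partial>lborel)"
    using e by (intro lborel_integral_real_affine) auto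
  then have "complex_of_real (exp (- ((t / e)\<^sup>2) / 2))
     = e *\<^sub>R (\<integral>\<xi>. complex_of_real (std_normal_density (e * \<xi>)) * cis (t * \<xi>) \<partial>lborel)"
    using e std_normal_fourier[of "t / e"] by simp
  then show ?thesis using e by (simp add: scaleR_conv_of_real field_simps)
qed

lemma integrable_std_normal_scaled:
  assumes e: "(e::real) \<noteq> 0"
  shows "integrable lborel (\<lambda>\<xi>. std_normal_density (e * \<xi>))"
  using lborel_integrable_real_affine[of "std_normal_density" e 0] e by (simp add: integrable_normal_density)

text \<open>A Gaussian factor of width \<open>1 / e n\<close> on the frequency side makes the double
  integral absolutely convergent, and Fubini turns it into an average of \<open>g\<close> around
  \<open>x\<close> at distance of order \<open>e n\<close>. Both sides then pass to the limit by
  dominated convergence: one because \<open>g\<close> is continuous and bounded, the other because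
  the transform of \<open>g\<close> has compact support.\<close>

lemma fourier_inversion:
  fixes g :: "real \<Rightarrow> complex"
  assumes g: "integrable lborel g" and cont: "continuous_on UNIV g" and B: "\<And>x. cmod (g x) \<le> B"
    and supp: "\<And>\<xi>. \<xi> \<notin> {c..d} \<Longrightarrow> fourier g \<xi> = 0"
  shows "g x = (\<integral>\<xi>. fourier g \<xi> * cis (2 * pi * x * \<xi>) \<partial>lborel)"
proof -
  have gm[measurable]: "g \<in> borel_measurable borel" using g by auto
  have fm[measurable]: "fourier g \<in> borel_measurable borel" by (rule borel_measurable_fourier) fact
  let ?N = "std_normal_density"
  \<comment> \<open>The profile of the averaging kernel after the substitution y = x + e n * s. Its
    integral equals \<open>?N 0\<close>, the limit of the Gaussian factor on the frequency side, so
    the two constants cancel at the end.\<close>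
  define E where "E s = exp (- ((2 * pi * s)\<^sup>2) / 2)" for s :: real
  have E_N: "E s = sqrt (2 * pi) * ?N (2 * pi * s)" for s
    by (simp add: E_def normal_density_def)
  have EI: "integrable lborel E" unfolding E_N
    using integrable_std_normal_scaled[of "2 * pi"] by simp
  have intE: "(\<integral>s. E s \<partial>lborel) = 1 / sqrt (2 * pi)"
  proof -
    have "1 = (\<integral>s. ?N s \<partial>lborel)" by (simp add: integral_normal_density)
    also have "\<dots> = \<bar>2 * pi\<bar> *\<^sub>R (\<integral>s. ?N (0 + 2 * pi * s) \<partial>lborel)"
      by (intro lborel_integral_real_affine) auto
    finally have "(\<integral>s. ?N (2 * pi * s) \<partial>lborel) = 1 / (2 * pi)" by (simp add: field_simps)
    then have "(\<integral>s. E s \<partial>lborel) = sqrt (2 * pi) / (2 * pi)" unfolding E_N by simp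
    also have "\<dots> = 1 / sqrt (2 * pi)"
      using real_sqrt_mult_self[of "2 * pi"] by (simp add: field_simps)
    finally show ?thesis .
  qed
  define e where "e n = 1 / real (Suc n)" for n
  have e0: "e n > 0" for n by (simp add: e_def)
  have elim: "e \<longlonglongrightarrow> 0" unfolding e_def by (rule LIMSEQ_Suc[OF lim_1_over_n])
  define L where "L n = (\<integral>\<xi>. complex_of_real (?N (e n * \<xi>)) * (fourier g \<xi> * cis (2 * pi * x * \<xi>)) \<partial>lborel)" for n
  have Leq: "L n = (\<integral>s. g (x + e n * s) * complex_of_real (E s) \<partial>lborel)" for n
  proof -
    have "L n = (\<integral>\<xi>. complex_of_real (?N (e n * \<xi>)) * (\<integral>y. g y * cis (2 * pi * (x - y) * \<xi>) \<partial>lborel) \<partial>lborel)"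
      unfolding L_def
    proof (rule Bochner_Integration.integral_cong[OF refl])
      fix \<xi>
      have "fourier g \<xi> * cis (2 * pi * x * \<xi>) = (\<integral>y. g y * cis (- 2 * pi * y * \<xi>) * cis (2 * pi * x * \<xi>) \<partial>lborel)"
        by (simp add: fourier_lborel)
      also have "\<dots> = (\<integral>y. g y * cis (2 * pi * (x - y) * \<xi>) \<partial>lborel)"
        by (rule Bochner_Integration.integral_cong[OF refl]) (simp add: mult.assoc cis_mult algebra_simps)
      finally show "complex_of_real (?N (e n * \<xi>)) * (fourier g \<xi> * cis (2 * pi * x * \<xi>))
        = complex_of_real (?N (e n * \<xi>)) * (\<integral>y. g y * cis (2 * pi * (x - y) * \<xi>) \<partial>lborel)" by simp
    qed
    also have "\<dots> = (\<integral>y. g y * (\<integral>\<xi>. complex_of_real (?N (e n * \<xi>)) * cis (2 * pi * (x - y) * \<xi>) \<partial>lborel) \<partial>lborel)"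
      using integrable_std_normal_scaled[of "e n"] e0[of n]
      by (intro integral_swap_bounded(1)[where B = 1] g) (auto intro: integrable_of_real)
    also have "\<dots> = (\<integral>y. g y * complex_of_real (E ((y - x) / e n) / e n) \<partial>lborel)"
    proof (rule Bochner_Integration.integral_cong[OF refl])
      fix y
      have "(2 * pi * (x - y) / e n)\<^sup>2 = (2 * pi * ((y - x) / e n))\<^sup>2"
        by (simp add: power2_eq_square field_simps)
      then show "g y * (\<integral>\<xi>. complex_of_real (?N (e n * \<xi>)) * cis (2 * pi * (x - y) * \<xi>) \<partial>lborel)
          = g y * complex_of_real (E ((y - x) / e n) / e n)"
        unfolding std_normal_fourier_scaled[OF e0] E_def by simp
    qed
    also have "\<dots> = \<bar>e n\<bar> *\<^sub>R (\<integral>s. g (x + e n * s) * complex_of_real (E (((x + e n * s) - x) / e n) / e n) \<partial>lborel)"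
      using e0[of n] by (intro lborel_integral_real_affine) auto
    also have "\<dots> = (\<integral>s. g (x + e n * s) * complex_of_real (E s) \<partial>lborel)"
      using e0[of n] by (simp add: scaleR_conv_of_real)
    finally show ?thesis .
  qed
  have Em[measurable]: "E \<in> borel_measurable borel" using EI by auto
  have "(\<lambda>n. L n) \<longlonglongrightarrow> (\<integral>s. g x * complex_of_real (E s) \<partial>lborel)"
    unfolding Leq
  proof (rule integral_dominated_convergence[where w = "\<lambda>s. B * E s"])
    show "integrable lborel (\<lambda>s. B * E s)" using EI by simp
    show "AE s in lborel. (\<lambda>n. g (x + e n * s) * complex_of_real (E s)) \<longlonglongrightarrow> g x * complex_of_real (E s)"
    proof (intro AE_I2 tendsto_intros)
      fix s
      have "(\<lambda>n. x + e n * s) \<longlonglongrightarrow> x + 0 * s" by (intro tendsto_intros elim)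
      then show "(\<lambda>n. g (x + e n * s)) \<longlonglongrightarrow> g x"
        using cont isCont_tendsto_compose[of x g "\<lambda>n. x + e n * s" sequentially]
        by (simp add: continuous_on_eq_continuous_at)
    qed
    show "AE s in lborel. cmod (g (x + e n * s) * complex_of_real (E s)) \<le> B * E s" for n
      using B by (auto simp: norm_mult E_def intro!: mult_mono)
  qed measurable
  then have lim1: "L \<longlonglongrightarrow> g x * complex_of_real (1 / sqrt (2 * pi))"
    using EI by (simp add: intE)
  have lim2: "L \<longlonglongrightarrow> (\<integral>\<xi>. complex_of_real (?N 0) * (fourier g \<xi> * cis (2 * pi * x * \<xi>)) \<partial>lborel)"
    unfolding L_def
  proof (rule integral_dominated_convergence[where w = "\<lambda>\<xi>. (\<integral>x. cmod (g x) \<partial>lborel) * indicator {c..d} \<xi>"])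
    show "integrable lborel (\<lambda>\<xi>. (\<integral>x. cmod (g x) \<partial>lborel) * indicator {c..d} \<xi>)"
      by (intro integrable_mult_right integrable_real_indicator) (auto simp: emeasure_lborel_Icc_eq)
    show "AE \<xi> in lborel. (\<lambda>n. complex_of_real (?N (e n * \<xi>)) * (fourier g \<xi> * cis (2 * pi * x * \<xi>)))
       \<longlonglongrightarrow> complex_of_real (?N 0) * (fourier g \<xi> * cis (2 * pi * x * \<xi>))"
    proof (intro AE_I2 tendsto_intros)
      fix \<xi>
      have "(\<lambda>n. e n * \<xi>) \<longlonglongrightarrow> 0 * \<xi>" by (intro tendsto_intros elim)
      moreover have "isCont ?N 0" unfolding normal_density_def by (intro continuous_intros) auto
      ultimately show "(\<lambda>n. ?N (e n * \<xi>)) \<longlonglongrightarrow> ?N 0"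
        using isCont_tendsto_compose[of 0 ?N "\<lambda>n. e n * \<xi>" sequentially] by simp
    qed
    show "AE \<xi> in lborel. norm (complex_of_real (?N (e n * \<xi>)) * (fourier g \<xi> * cis (2 * pi * x * \<xi>)))
        \<le> (\<integral>x. cmod (g x) \<partial>lborel) * indicator {c..d} \<xi>" for n
    proof (intro AE_I2)
      fix \<xi>
      have "1 / sqrt (2 * pi) \<le> 1" using pi_gt3 by simp
      moreover have "exp (- ((e n * \<xi>)\<^sup>2) / 2) \<le> 1" by simp
      ultimately have "?N (e n * \<xi>) \<le> 1 * 1"
        unfolding normal_density_def by (intro mult_mono) auto
      then have "?N (e n * \<xi>) * cmod (fourier g \<xi>) \<le> 1 * (\<integral>x. cmod (g x) \<partial>lborel)"
        by (intro mult_mono norm_fourier_le g) auto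
      then show "norm (complex_of_real (?N (e n * \<xi>)) * (fourier g \<xi> * cis (2 * pi * x * \<xi>)))
        \<le> (\<integral>x. cmod (g x) \<partial>lborel) * indicator {c..d} \<xi>"
        using supp[of \<xi>] by (cases "\<xi> \<in> {c..d}") (simp_all add: norm_mult)
    qed
  qed measurable
  have "g x * complex_of_real (1 / sqrt (2 * pi))
      = complex_of_real (?N 0) * (\<integral>\<xi>. fourier g \<xi> * cis (2 * pi * x * \<xi>) \<partial>lborel)"
    using LIMSEQ_unique[OF lim1 lim2] by simp
  moreover have "?N 0 = 1 / sqrt (2 * pi)" by (simp add: normal_density_def)
  ultimately show ?thesis by (simp add: field_simps)
qed

section \<open>Frequency supports of products\<close>

text \<open>Inverse Fourier transforms of integrable functions supported in [c, d]. With the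
  frequency function \<open>m\<close> given explicitly, multiplying by \<open>u\<close> amounts to
  Fubini, and no convolution theorem for products is required.\<close>

definition band :: "(real \<Rightarrow> complex) \<Rightarrow> real \<Rightarrow> real \<Rightarrow> bool" where
  "band u c d \<longleftrightarrow> (\<exists>m. integrable lborel m \<and> (\<forall>\<zeta>. \<zeta> \<notin> {c..d} \<longrightarrow> m \<zeta> = 0) \<and>
     (\<forall>x. u x = (\<integral>\<zeta>. m \<zeta> * cis (2 * pi * x * \<zeta>) \<partial>lborel)))"

text \<open>Inversion is applied to the kernel \<open>g\<close> only; \<open>f\<close> is arbitrary
  integrable. Inserting the formula for \<open>g (x - y)\<close> and integrating in \<open>y\<close>
  first leaves the product of the two transforms.\<close>

lemma band_conv:
  fixes f g :: "real \<Rightarrow> complex"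
  assumes f: "integrable lborel f"
    and g: "integrable lborel g" and cont: "continuous_on UNIV g" and B: "\<And>x. cmod (g x) \<le> B"
    and supp: "\<And>\<xi>. \<xi> \<notin> {c..d} \<Longrightarrow> fourier g \<xi> = 0"
  shows "band (conv f g) c d"
  unfolding band_def
proof (intro exI[of _ "\<lambda>\<zeta>. fourier g \<zeta> * fourier f \<zeta>"] conjI allI impI)
  have [measurable]: "f \<in> borel_measurable borel" "g \<in> borel_measurable borel" using f g by auto
  have [measurable]: "fourier f \<in> borel_measurable borel" "fourier g \<in> borel_measurable borel"
    by (auto intro: borel_measurable_fourier)
  let ?G = "\<integral>x. cmod (g x) \<partial>lborel" and ?F = "\<integral>x. cmod (f x) \<partial>lborel"
  have gI: "integrable lborel (fourier g)"
  proof (rule Bochner_Integration.integrable_bound)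
    show "integrable lborel (\<lambda>\<zeta>. ?G * indicator {c..d} \<zeta>)"
      by (intro integrable_mult_right integrable_real_indicator) (auto simp: emeasure_lborel_Icc_eq)
    show "AE \<zeta> in lborel. norm (fourier g \<zeta>) \<le> norm (?G * indicator {c..d} \<zeta>)"
      using supp norm_fourier_le[OF g] by (intro AE_I2) (auto simp: indicator_def abs_mult)
  qed measurable
  show "integrable lborel (\<lambda>\<zeta>. fourier g \<zeta> * fourier f \<zeta>)"
  proof (rule Bochner_Integration.integrable_bound)
    show "integrable lborel (\<lambda>\<zeta>. fourier g \<zeta> * complex_of_real ?F)" using gI by simp
    show "AE \<zeta> in lborel. norm (fourier g \<zeta> * fourier f \<zeta>) \<le> norm (fourier g \<zeta> * complex_of_real ?F)"
    proof (intro AE_I2)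
      fix \<zeta>
      have "cmod (fourier f \<zeta>) \<le> \<bar>?F\<bar>"
        using norm_fourier_le[OF f, of \<zeta>] by linarith
      then show "norm (fourier g \<zeta> * fourier f \<zeta>) \<le> norm (fourier g \<zeta> * complex_of_real ?F)"
        by (simp add: norm_mult mult_left_mono)
    qed
  qed measurable
  show "fourier g \<zeta> * fourier f \<zeta> = 0" if "\<zeta> \<notin> {c..d}" for \<zeta> using supp that by simp
  fix x
  have "conv f g x = (\<integral>y. f y * (\<integral>\<zeta>. fourier g \<zeta> * cis (2 * pi * (x - y) * \<zeta>) \<partial>lborel) \<partial>lborel)"
    using fourier_inversion[OF g cont B supp]
    by (subst conv_lborel) (auto intro!: Bochner_Integration.integral_cong)
  also have "\<dots> = (\<integral>\<zeta>. fourier g \<zeta> * (\<integral>y. f y * cis (2 * pi * (x - y) * \<zeta>) \<partial>lborel) \<partial>lborel)"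
    by (intro integral_swap_bounded(1)[where B = 1] f gI) auto
  also have "\<dots> = (\<integral>\<zeta>. fourier g \<zeta> * (fourier f \<zeta> * cis (2 * pi * x * \<zeta>)) \<partial>lborel)"
  proof (rule Bochner_Integration.integral_cong[OF refl])
    fix \<zeta>
    have "fourier f \<zeta> * cis (2 * pi * x * \<zeta>) = (\<integral>y. f y * cis (- 2 * pi * y * \<zeta>) * cis (2 * pi * x * \<zeta>) \<partial>lborel)"
      by (simp add: fourier_lborel)
    also have "\<dots> = (\<integral>y. f y * cis (2 * pi * (x - y) * \<zeta>) \<partial>lborel)"
      by (rule Bochner_Integration.integral_cong[OF refl]) (simp add: mult.assoc cis_mult algebra_simps)
    finally show "fourier g \<zeta> * (\<integral>y. f y * cis (2 * pi * (x - y) * \<zeta>) \<partial>lborel)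
      = fourier g \<zeta> * (fourier f \<zeta> * cis (2 * pi * x * \<zeta>))" by simp
  qed
  finally show "conv f g x = (\<integral>\<zeta>. fourier g \<zeta> * fourier f \<zeta> * cis (2 * pi * x * \<zeta>) \<partial>lborel)"
    by (simp add: mult.assoc)
qed

text \<open>The transform of the product at \<xi> is the integral of \<open>m \<zeta>\<close> times
  the transform of \<open>v\<close> at \<xi> - \<zeta>, whose supports do not meet for \<xi> outside
  the sum of the intervals. The conclusion has the form of the hypotheses on \<open>v\<close>, so
  any number of band-limited factors can be multiplied on one after another.\<close>

lemma fourier_mult_band:
  assumes v: "integrable lborel v" and vs: "\<And>\<xi>. \<xi> \<notin> {a..b} \<Longrightarrow> fourier v \<xi> = 0"
    and u: "band u c d"
  shows "integrable lborel (\<lambda>x. v x * u x)"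
    and "\<And>\<xi>. \<xi> \<notin> {a + c..b + d} \<Longrightarrow> fourier (\<lambda>x. v x * u x) \<xi> = 0"
proof -
  obtain m where m: "integrable lborel m" "\<And>\<zeta>. \<zeta> \<notin> {c..d} \<Longrightarrow> m \<zeta> = 0"
    and ueq: "\<And>x. u x = (\<integral>\<zeta>. m \<zeta> * cis (2 * pi * x * \<zeta>) \<partial>lborel)"
    using u unfolding band_def by blast
  have [measurable]: "v \<in> borel_measurable borel" using v by auto
  show I: "integrable lborel (\<lambda>x. v x * u x)"
    unfolding ueq by (intro integral_swap_bounded(2)[where B = 1] v m) auto
  have uvm: "(\<lambda>x. v x * u x) \<in> borel_measurable borel" using I by auto
  fix \<xi> assume \<xi>: "\<xi> \<notin> {a + c..b + d}"
  have vI: "integrable lborel (\<lambda>x. v x * cis (- 2 * pi * x * \<xi>))"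
    by (rule Bochner_Integration.integrable_bound[OF v]) (auto simp: norm_mult)
  have "fourier (\<lambda>x. v x * u x) \<xi> = (\<integral>x. v x * cis (- 2 * pi * x * \<xi>) * (\<integral>\<zeta>. m \<zeta> * cis (2 * pi * x * \<zeta>) \<partial>lborel) \<partial>lborel)"
    unfolding ueq[symmetric] fourier_lborel[OF uvm] by (simp add: mult_ac)
  also have "\<dots> = (\<integral>\<zeta>. m \<zeta> * (\<integral>x. v x * cis (- 2 * pi * x * \<xi>) * cis (2 * pi * x * \<zeta>) \<partial>lborel) \<partial>lborel)"
    by (intro integral_swap_bounded(1)[where B = 1] vI m) auto
  also have "\<dots> = (\<integral>\<zeta>. m \<zeta> * fourier v (\<xi> - \<zeta>) \<partial>lborel)"
    by (simp add: fourier_lborel mult.assoc cis_mult algebra_simps)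
  also have "\<dots> = (\<integral>\<zeta>. 0 \<partial>(lborel :: real measure))"
  proof (rule Bochner_Integration.integral_cong[OF refl])
    fix \<zeta> show "m \<zeta> * fourier v (\<xi> - \<zeta>) = 0"
      using \<xi> m(2)[of \<zeta>] vs[of "\<xi> - \<zeta>"] by fastforce
  qed
  finally show "fourier (\<lambda>x. v x * u x) \<xi> = 0" by simp
qed

section \<open>Dilated molecules\<close>

text \<open>The common integrable majorant of all kernels; each dilate \<open>tail_k k\<close> has
  the same integral 2.\<close>

definition tail :: "real \<Rightarrow> real" where
  "tail u = 1 / (1 + \<bar>u\<bar>)\<^sup>2"

definition tail_k :: "int \<Rightarrow> real \<Rightarrow> real" where
  "tail_k k u = 2 powr real_of_int k * tail (2 powr real_of_int k * u)"

lemma tail_measurable [measurable]: "tail \<in> borel_measurable borel"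
  unfolding tail_def[abs_def] by measurable

lemma tail_k_measurable [measurable]: "tail_k k \<in> borel_measurable borel"
  unfolding tail_k_def[abs_def] by measurable

lemma tail_nonneg: "0 \<le> tail u" and tail_k_nonneg: "0 \<le> tail_k k u"
  by (simp_all add: tail_def tail_k_def)

lemma nn_integral_tail: "(\<integral>\<^sup>+u. ennreal (tail u) \<partial>lborel) = 2"
proof -
  define h where "h u = ennreal (1 / (1 + u)\<^sup>2) * indicator {0..} u" for u :: real
  have [measurable]: "h \<in> borel_measurable borel" unfolding h_def[abs_def] by measurable
  have 1: "(\<integral>\<^sup>+u. h u \<partial>lborel) = ennreal (0 - (- 1 / (1 + 0)))"
    unfolding h_def
  proof (rule nn_integral_FTC_atLeast)
    show "((\<lambda>x::real. - 1 / (1 + x)) has_real_derivative 1 / (1 + x)\<^sup>2) (at x)" if "0 \<le> x" for x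
      using that by (auto intro!: derivative_eq_intros simp: power2_eq_square)
    have "LIM x at_top. 1 + x :> (at_top :: real filter)"
      by (rule filterlim_tendsto_add_at_top[OF tendsto_const filterlim_ident])
    then show "((\<lambda>x::real. - 1 / (1 + x)) \<longlongrightarrow> 0) at_top"
      by (rule tendsto_divide_0[OF tendsto_const filterlim_at_top_imp_at_infinity])
  qed auto
  have "(\<integral>\<^sup>+u. ennreal (tail u) \<partial>lborel) = (\<integral>\<^sup>+u. h u + h (0 - u) \<partial>lborel)"
  proof (rule nn_integral_cong_AE)
    \<comment> \<open>The point 0 has to be excluded because \<open>h\<close> and its reflection
      both count it.\<close>
    have "AE u in lborel. u \<noteq> (0::real)" by (rule AE_lborel_singleton)
    then show "AE u in lborel. ennreal (tail u) = h u + h (0 - u)"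
      by (rule AE_mp) (auto simp: h_def tail_def indicator_def intro!: AE_I2)
  qed
  also have "\<dots> = (\<integral>\<^sup>+u. h u \<partial>lborel) + (\<integral>\<^sup>+u. h (0 - u) \<partial>lborel)"
    by (rule nn_integral_add) auto
  also have "\<dots> = 2" by (simp add: nn_integral_lborel_reflect 1 del: diff_0)
  finally show ?thesis .
qed

lemma nn_integral_dilate:
  fixes f :: "real \<Rightarrow> real"
  assumes [measurable]: "f \<in> borel_measurable borel" and c: "0 < c"
  shows "(\<integral>\<^sup>+u. ennreal (c * f (c * u)) \<partial>lborel) = (\<integral>\<^sup>+u. ennreal (f u) \<partial>lborel)"
proof -
  have "(\<integral>\<^sup>+u. ennreal (f u) \<partial>lborel) = ennreal \<bar>c\<bar> * (\<integral>\<^sup>+u. ennreal (f (0 + c * u)) \<partial>lborel)"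
    using c by (intro nn_integral_real_affine) auto
  also have "\<dots> = (\<integral>\<^sup>+u. ennreal c * ennreal (f (c * u)) \<partial>lborel)"
    using c by (subst nn_integral_cmult) auto
  finally show ?thesis using c by (simp add: ennreal_mult')
qed

lemma nn_integral_tail_k: "(\<integral>\<^sup>+u. ennreal (tail_k k u) \<partial>lborel) = 2"
  unfolding tail_k_def using nn_integral_dilate[of tail "2 powr real_of_int k"] nn_integral_tail by simp

lemma nn_integral_tail_k_reflect: "(\<integral>\<^sup>+y. ennreal (tail_k k (x - y)) \<partial>lborel) = 2"
  using nn_integral_lborel_reflect[of "\<lambda>u. ennreal (tail_k k u)" x] by (simp add: nn_integral_tail_k)

lemma nn_integral_tail_k_translate: "(\<integral>\<^sup>+x. ennreal (tail_k k (x - y)) \<partial>lborel) = 2"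
  using nn_integral_lborel_translate[of "\<lambda>u. ennreal (tail_k k u)" y] by (simp add: nn_integral_tail_k)

text \<open>One constant for everything that is used of a kernel. The order 10 is 8 + 2: eight
  powers become the decay of the fourth factor in the weight, two remain as an integrable
  \<open>tail\<close>. The Lipschitz bound is asked only for shifts of size at most 1, with the tail
  taken at one endpoint.\<close>

definition molecule :: "real \<Rightarrow> (real \<Rightarrow> complex) \<Rightarrow> bool" where
  "molecule B g \<longleftrightarrow> continuous_on UNIV g \<and> (\<forall>u. cmod (g u) \<le> B / (1 + \<bar>u\<bar>) ^ 10) \<and>
     (\<forall>u v. \<bar>u - v\<bar> \<le> 1 \<longrightarrow> cmod (g u - g v) \<le> B * \<bar>u - v\<bar> * tail v)"

lemma schwartz_decay:
  assumes "schwartz f"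
  shows "\<exists>B\<ge>0. \<forall>x. cmod (nth_deriv b f x) \<le> B / (1 + \<bar>x\<bar>) ^ 10"
proof -
  have *: "\<exists>B. \<forall>x. cmod ((x ^ a) *\<^sub>R nth_deriv b f x) \<le> B" for a
    using assms unfolding schwartz_def bounded_iff by auto
  obtain B0 where B0: "\<And>x. cmod ((x ^ 0) *\<^sub>R nth_deriv b f x) \<le> B0" using *[of 0] by blast
  obtain B1 where B1: "\<And>x. cmod ((x ^ 10) *\<^sub>R nth_deriv b f x) \<le> B1" using *[of 10] by blast
  define B where "B = 2 ^ 10 * (B0 + B1)"
  have B00: "0 \<le> B0" using B0[of 0] norm_ge_zero order_trans by blast
  have B10: "0 \<le> B1" using B1[of 0] norm_ge_zero order_trans by blast
  have "cmod (nth_deriv b f x) \<le> B / (1 + \<bar>x\<bar>) ^ 10" for x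
  proof -
    let ?n = "cmod (nth_deriv b f x)"
    have "(1 + \<bar>x\<bar>) ^ 10 \<le> (2 * max 1 \<bar>x\<bar>) ^ 10" by (intro power_mono) auto
    also have "\<dots> = 2 ^ 10 * (max 1 \<bar>x\<bar>) ^ 10" by (simp add: power_mult_distrib)
    also have "(max 1 \<bar>x\<bar>) ^ 10 \<le> 1 + \<bar>x\<bar> ^ 10" by (auto simp: max_def)
    finally have "(1 + \<bar>x\<bar>) ^ 10 * ?n \<le> 2 ^ 10 * (1 + \<bar>x\<bar> ^ 10) * ?n"
      by (intro mult_right_mono) auto
    also have "\<dots> = 2 ^ 10 * (?n + \<bar>x\<bar> ^ 10 * ?n)" by (simp add: algebra_simps)
    also have "\<dots> \<le> B" unfolding B_def
      using B0[of x] B1[of x] by (intro mult_left_mono add_mono) (auto simp: power_abs)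
    finally show ?thesis by (simp add: field_simps)
  qed
  moreover have "B \<ge> 0" using B00 B10 by (simp add: B_def)
  ultimately show ?thesis by blast
qed

text \<open>The derivative of the modulation brings down a factor \<open>c\<close>, so the constant
  grows with the frequency. This is harmless because only finitely many frequencies survive.\<close>

lemma molecule_modulate:
  assumes S: "schwartz f"
  shows "\<exists>B\<ge>0. molecule B (\<lambda>u. cis (c * u) * f u)"
proof -
  obtain B0 where B0: "B0 \<ge> 0" "\<And>x. cmod (f x) \<le> B0 / (1 + \<bar>x\<bar>) ^ 10"
    using schwartz_decay[OF S, of 0] by (auto simp: nth_deriv_def)
  obtain B1 where B1: "B1 \<ge> 0" "\<And>x. cmod (vector_derivative f (at x)) \<le> B1 / (1 + \<bar>x\<bar>) ^ 10"
    using schwartz_decay[OF S, of 1] by (auto simp: nth_deriv_def)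
  have diff: "f differentiable (at x)" for x
  proof -
    have "nth_deriv 0 f differentiable (at x)" using S unfolding schwartz_def by blast
    then show ?thesis by (simp add: nth_deriv_def)
  qed
  have fd: "(f has_vector_derivative vector_derivative f (at x)) (at x)" for x
    using diff vector_derivative_works by blast
  have cont: "continuous_on UNIV f"
    using diff by (intro differentiable_imp_continuous_on) (auto simp: differentiable_on_def)
  define g where "g u = cis (c * u) * f u" for u
  define g' where "g' u = cis (c * u) * vector_derivative f (at u) + (\<i> * of_real c * cis (c * u)) * f u" for u
  have cisd: "((\<lambda>u. cis (c * u)) has_vector_derivative (\<i> * of_real c * cis (c * u))) (at u)" for u
  proof -
    have "((\<lambda>z. exp (\<i> * (of_real c * z))) has_field_derivative \<i> * of_real c * cis (c * u)) (at (complex_of_real u))"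
      by (auto intro!: derivative_eq_intros simp: cis_conv_exp)
    from has_vector_derivative_real_field[OF this] show ?thesis
      by (simp add: cis_conv_exp)
  qed
  have gd: "(g has_vector_derivative g' u) (at u)" for u
    unfolding g_def g'_def by (rule has_vector_derivative_mult[OF cisd fd])
  \<comment> \<open>The 4 pays for moving the tail from a point of the segment to its endpoint
    \<open>v\<close>: within distance 1 the quantity 1 + |.| changes by at most a factor 2, and the
    tail is its inverse square.\<close>
  define B where "B = B0 + 4 * (B1 + \<bar>c\<bar> * B0)"
  have g'b: "cmod (g' u) \<le> (B1 + \<bar>c\<bar> * B0) / (1 + \<bar>u\<bar>) ^ 10" for u
  proof -
    have "cmod (g' u) \<le> cmod (vector_derivative f (at u)) + \<bar>c\<bar> * cmod (f u)"
      unfolding g'_def by (rule order_trans[OF norm_triangle_ineq]) (simp add: norm_mult)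
    also have "\<dots> \<le> B1 / (1 + \<bar>u\<bar>) ^ 10 + \<bar>c\<bar> * (B0 / (1 + \<bar>u\<bar>) ^ 10)"
      by (intro add_mono mult_left_mono B0 B1) auto
    finally show ?thesis by (simp add: add_divide_distrib)
  qed
  have "molecule B g"
    unfolding molecule_def
  proof (intro conjI allI impI)
    show "continuous_on UNIV g" unfolding g_def by (intro continuous_intros cont)
    show "cmod (g u) \<le> B / (1 + \<bar>u\<bar>) ^ 10" for u
    proof -
      have "cmod (g u) \<le> B0 / (1 + \<bar>u\<bar>) ^ 10" using B0(2)[of u] by (simp add: g_def norm_mult)
      also have "\<dots> \<le> B / (1 + \<bar>u\<bar>) ^ 10"
        using B0(1) B1(1) by (intro divide_right_mono) (auto simp: B_def)
      finally show ?thesis .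
    qed
    fix u v :: real assume uv: "\<bar>u - v\<bar> \<le> 1"
    have "cmod (g u - g v) \<le> (4 * (B1 + \<bar>c\<bar> * B0) * tail v) * norm (u - v)"
    proof (rule differentiable_bound[where S = "closed_segment v u" and f' = "\<lambda>x h. h *\<^sub>R g' x"])
      show "(g has_derivative (\<lambda>h. h *\<^sub>R g' x)) (at x within closed_segment v u)" for x
        using gd[of x] by (auto simp: has_vector_derivative_def intro: has_derivative_at_withinI)
      fix x assume x: "x \<in> closed_segment v u"
      have "\<bar>x - v\<bar> \<le> \<bar>u - v\<bar>" using dist_in_closed_segment[OF x] by (simp add: dist_real_def abs_minus_commute)
      moreover have "\<bar>v\<bar> \<le> \<bar>x\<bar> + \<bar>x - v\<bar>" "0 \<le> \<bar>x\<bar>" by linarith+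
      ultimately have le: "1 + \<bar>v\<bar> \<le> 2 * (1 + \<bar>x\<bar>)" using uv by argo
      have "onorm (\<lambda>h. h *\<^sub>R g' x) \<le> cmod (g' x)"
        by (rule onorm_le) (simp add: mult.commute)
      also have "\<dots> \<le> (B1 + \<bar>c\<bar> * B0) / (1 + \<bar>x\<bar>) ^ 10" by (rule g'b)
      also have "\<dots> \<le> (B1 + \<bar>c\<bar> * B0) / (1 + \<bar>x\<bar>) ^ 2"
        using B0 B1 by (intro divide_left_mono power_increasing) (auto intro!: mult_pos_pos zero_less_power)
      also have "\<dots> \<le> (B1 + \<bar>c\<bar> * B0) * (4 * tail v)"
      proof -
        have "(2 * (1 + \<bar>x\<bar>))\<^sup>2 = 4 * (1 + \<bar>x\<bar>)\<^sup>2" unfolding power_mult_distrib by simp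
        moreover have "(1 + \<bar>v\<bar>)\<^sup>2 \<le> (2 * (1 + \<bar>x\<bar>))\<^sup>2" by (rule power_mono[OF le]) simp
        ultimately have le4: "(1 + \<bar>v\<bar>)\<^sup>2 \<le> 4 * (1 + \<bar>x\<bar>)\<^sup>2" by (simp only:)
        have aux: "1 / X \<le> 4 * (1 / Y)" if "0 < X" "0 < Y" "Y \<le> 4 * X" for X Y :: real
          using that by (simp add: field_simps)
        have "1 / (1 + \<bar>x\<bar>)\<^sup>2 \<le> 4 * tail v"
          unfolding tail_def by (rule aux[OF _ _ le4]) (auto intro!: zero_less_power)
        moreover have "0 \<le> B1 + \<bar>c\<bar> * B0" using B0(1) B1(1) by simp
        ultimately have "(B1 + \<bar>c\<bar> * B0) * (1 / (1 + \<bar>x\<bar>)\<^sup>2) \<le> (B1 + \<bar>c\<bar> * B0) * (4 * tail v)"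
          by (rule mult_left_mono)
        then show ?thesis by simp
      qed
      finally show "onorm (\<lambda>h. h *\<^sub>R g' x) \<le> 4 * (B1 + \<bar>c\<bar> * B0) * tail v" by (simp add: mult_ac)
    qed auto
    also have "\<dots> \<le> B * \<bar>u - v\<bar> * tail v"
    proof -
      have "4 * (B1 + \<bar>c\<bar> * B0) * (tail v * \<bar>u - v\<bar>) \<le> B * (tail v * \<bar>u - v\<bar>)"
        using B0(1) tail_nonneg[of v] by (intro mult_right_mono) (auto simp: B_def)
      then show ?thesis by (simp only: real_norm_def mult_ac)
    qed
    finally show "cmod (g u - g v) \<le> B * \<bar>u - v\<bar> * tail v" .
  qed
  moreover have "B \<ge> 0" using B0(1) B1(1) by (simp add: B_def)
  ultimately show ?thesis unfolding g_def by blast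
qed

lemma molecule_mono:
  assumes "molecule B g" "B \<le> B'"
  shows "molecule B' g"
  unfolding molecule_def
proof (intro conjI allI impI)
  show "continuous_on UNIV g" using assms by (simp add: molecule_def)
  show "cmod (g u) \<le> B' / (1 + \<bar>u\<bar>) ^ 10" for u
  proof -
    have "cmod (g u) \<le> B / (1 + \<bar>u\<bar>) ^ 10" using assms by (simp add: molecule_def)
    also have "\<dots> \<le> B' / (1 + \<bar>u\<bar>) ^ 10" using assms by (intro divide_right_mono) auto
    finally show ?thesis .
  qed
  fix u v :: real assume "\<bar>u - v\<bar> \<le> 1"
  then have "cmod (g u - g v) \<le> B * (\<bar>u - v\<bar> * tail v)" using assms by (simp add: molecule_def mult.assoc)
  also have "\<dots> \<le> B' * (\<bar>u - v\<bar> * tail v)"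
    using assms tail_nonneg by (intro mult_right_mono) auto
  finally show "cmod (g u - g v) \<le> B' * \<bar>u - v\<bar> * tail v" by (simp add: mult.assoc)
qed

lemma molecule_measurable: "molecule B g \<Longrightarrow> g \<in> borel_measurable borel"
  unfolding molecule_def by (intro borel_measurable_continuous_onI) auto

lemma molecule_nonneg: "molecule B g \<Longrightarrow> 0 \<le> B"
proof -
  assume "molecule B g"
  then have "cmod (g 0) \<le> B / (1 + \<bar>0\<bar>) ^ 10" unfolding molecule_def by blast
  then have "cmod (g 0) \<le> B" by simp
  then show "0 \<le> B" using norm_ge_zero[of "g 0"] by linarith
qed

lemma molecule_decay:
  assumes "molecule B g" and "n \<le> 10"
  shows "cmod (g u) \<le> B / (1 + \<bar>u\<bar>) ^ n"
proof -
  have "cmod (g u) \<le> B / (1 + \<bar>u\<bar>) ^ 10" using assms by (simp add: molecule_def)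
  also have "\<dots> \<le> B / (1 + \<bar>u\<bar>) ^ n"
    using molecule_nonneg[OF assms(1)] assms(2)
    by (intro divide_left_mono power_increasing) (auto intro!: mult_pos_pos zero_less_power)
  finally show ?thesis .
qed

lemma molecule_tail: "molecule B g \<Longrightarrow> cmod (g u) \<le> B * tail u"
  using molecule_decay[of B g 2 u] by (simp add: tail_def)

definition dil :: "int \<Rightarrow> (real \<Rightarrow> complex) \<Rightarrow> real \<Rightarrow> complex" where
  "dil k g x = complex_of_real (2 powr real_of_int k) * g (2 powr real_of_int k * x)"

lemma dil_measurable [measurable (raw)]:
  assumes [measurable]: "g \<in> borel_measurable borel"
  shows "dil k g \<in> borel_measurable borel"
  unfolding dil_def[abs_def] by measurable

lemma dil_continuous:
  assumes "continuous_on UNIV g"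
  shows "continuous_on UNIV (dil k g)"
proof -
  have "continuous_on UNIV (\<lambda>x. g (2 powr real_of_int k * x))"
    by (rule continuous_on_compose2[OF assms]) (auto intro!: continuous_on_mult continuous_on_const continuous_on_id)
  then show ?thesis unfolding dil_def[abs_def] by (intro continuous_on_mult continuous_on_const)
qed

lemma norm_dil: "cmod (dil k g x) = 2 powr real_of_int k * cmod (g (2 powr real_of_int k * x))"
  by (simp add: dil_def norm_mult)

lemma dil_le_tail_k:
  assumes "molecule B g"
  shows "cmod (dil k g x) \<le> B * tail_k k x"
proof -
  have "cmod (dil k g x) \<le> 2 powr real_of_int k * (B * tail (2 powr real_of_int k * x))"
    unfolding norm_dil by (intro mult_left_mono molecule_tail assms) simp
  then show ?thesis by (simp only: tail_k_def mult.left_commute)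
qed

lemma dil_bounded:
  assumes "molecule B g"
  shows "cmod (dil k g x) \<le> 2 powr real_of_int k * B"
proof -
  have "cmod (g u) \<le> B" for u using molecule_decay[OF assms, of 0] by simp
  then show ?thesis unfolding norm_dil by (intro mult_left_mono) auto
qed

lemma dil_integrable:
  assumes m: "molecule B g"
  shows "integrable lborel (dil k g)"
proof (rule integrableI_bounded)
  have [measurable]: "g \<in> borel_measurable borel" by (rule molecule_measurable[OF m])
  show "dil k g \<in> borel_measurable lborel" by simp
  have "(\<integral>\<^sup>+x. ennreal (norm (dil k g x)) \<partial>lborel) \<le> (\<integral>\<^sup>+x. ennreal B * ennreal (tail_k k x) \<partial>lborel)"
    using dil_le_tail_k[OF m] molecule_nonneg[OF m] tail_k_nonneg
    by (intro nn_integral_mono) (auto simp: ennreal_mult[symmetric] intro!: ennreal_leI)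
  also have "\<dots> = ennreal B * 2" by (simp add: nn_integral_cmult nn_integral_tail_k)
  also have "\<dots> < \<infinity>" by (simp add: ennreal_mult_less_top)
  finally show "(\<integral>\<^sup>+x. ennreal (norm (dil k g x)) \<partial>lborel) < \<infinity>" .
qed

text \<open>For fixed \<open>l\<close> all the \<open>psi_kl\<close> are dilates of one modulated
  molecule that does not depend on \<open>k\<close>. Estimates uniform in the scale therefore follow
  from estimates for a single function.\<close>

lemma psi_kl_dil: "psi_kl \<psi> k l = dil k (\<lambda>u. cis (pi * real_of_int l * u) * \<psi> u)"
proof
  fix x
  have "2 * pi * (2 powr (real_of_int k - 1) * real_of_int l) * x = pi * real_of_int l * (2 powr real_of_int k * x)"
    by (simp add: powr_diff)
  then show "psi_kl \<psi> k l x = dil k (\<lambda>u. cis (pi * real_of_int l * u) * \<psi> u) x"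
    unfolding psi_kl_def dil_def by (simp only: mult.assoc)
qed

lemma phi_k_dil: "complex_of_real (phi_k \<phi> k x) = dil k (\<lambda>u. complex_of_real (\<phi> u)) x"
  by (simp add: phi_k_def dil_def)

lemma fourier_dil:
  assumes [measurable]: "g \<in> borel_measurable borel"
  shows "fourier (dil k g) \<xi> = fourier g (\<xi> / 2 powr real_of_int k)"
proof -
  let ?K = "2 powr real_of_int k"
  have "fourier g (\<xi> / ?K) = (\<integral>x. g x * cis (- 2 * pi * x * (\<xi> / ?K)) \<partial>lborel)"
    by (rule fourier_lborel) fact
  also have "\<dots> = \<bar>?K\<bar> *\<^sub>R (\<integral>x. g (0 + ?K * x) * cis (- 2 * pi * (0 + ?K * x) * (\<xi> / ?K)) \<partial>lborel)"
    by (rule lborel_integral_real_affine) simp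
  also have "\<dots> = (\<integral>x. dil k g x * cis (- 2 * pi * x * \<xi>) \<partial>lborel)"
    by (simp add: dil_def scaleR_conv_of_real mult.assoc)
  also have "\<dots> = fourier (dil k g) \<xi>" by (rule fourier_lborel[symmetric]) measurable
  finally show ?thesis by simp
qed

lemma fourier_modulate:
  assumes [measurable]: "f \<in> borel_measurable borel"
  shows "fourier (\<lambda>u. cis (pi * real_of_int l * u) * f u) \<xi> = fourier f (\<xi> - real_of_int l / 2)"
proof -
  have "cis (pi * real_of_int l * x) * f x * cis (- 2 * pi * x * \<xi>)
      = f x * cis (- 2 * pi * x * (\<xi> - real_of_int l / 2))" for x
    by (simp add: mult.assoc mult.left_commute[of _ "f x"] cis_mult) (simp add: algebra_simps)
  moreover have "(\<lambda>u. cis (pi * real_of_int l * u) * f u) \<in> borel_measurable borel" by measurable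
  ultimately show ?thesis by (simp only: fourier_lborel assms)
qed

section \<open>Reduction to finitely many frequencies\<close>

lemma schwartz_molecule: "schwartz \<psi> \<Longrightarrow> \<exists>B\<ge>0. molecule B \<psi>"
  using molecule_modulate[of \<psi> 0] by simp

lemma schwartz_measurable: "schwartz \<psi> \<Longrightarrow> \<psi> \<in> borel_measurable borel"
  using schwartz_molecule molecule_measurable by blast

lemma band_conv_dil:
  assumes f: "integrable lborel f" and m: "molecule B g"
    and supp: "\<And>\<xi>. \<xi> \<notin> {c..d} \<Longrightarrow> fourier g \<xi> = 0"
  shows "band (conv f (dil k g)) (2 powr real_of_int k * c) (2 powr real_of_int k * d)"
proof (rule band_conv[OF f dil_integrable[OF m] dil_continuous dil_bounded[OF m]])
  show "continuous_on UNIV g" using m by (simp add: molecule_def)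
  fix \<xi> assume "\<xi> \<notin> {2 powr real_of_int k * c..2 powr real_of_int k * d}"
  then have "\<xi> / 2 powr real_of_int k \<notin> {c..d}"
    by (auto simp: field_simps)
  then show "fourier (dil k g) \<xi> = 0"
    using supp fourier_dil[OF molecule_measurable[OF m]] by simp
qed

text \<open>Written over the complex numbers, the cutoff is a convolution with a dilated molecule
  like the other factors, and the band-limited calculus covers it too.\<close>

lemma chi_star_complex:
  "complex_of_real (chi_star \<phi> k n x) =
    conv (\<lambda>y. complex_of_real (indicator (dyadic_I k n) y)) (dil k (\<lambda>u. complex_of_real (\<phi> u))) x"
proof -
  have *: "(\<lambda>y. complex_of_real (indicator (dyadic_I k n) y) * dil k (\<lambda>u. complex_of_real (\<phi> u)) (x - y))
     = (\<lambda>y. complex_of_real (indicator (dyadic_I k n) y * phi_k \<phi> k (x - y)))"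
    by (simp flip: phi_k_dil)
  show ?thesis unfolding chi_star_def conv_def * integral_complex_of_real ..
qed

lemma dyadic_I_indicator_integrable: "integrable lborel (\<lambda>y. complex_of_real (indicator (dyadic_I k n) y))"
proof -
  have "emeasure lborel (dyadic_I k n) < \<infinity>"
    unfolding dyadic_I_def by (cases "2 powr - real_of_int k * real_of_int n \<le> 2 powr - real_of_int k * (real_of_int n + 1)") auto
  then have "integrable lborel (indicator (dyadic_I k n) :: real \<Rightarrow> real)"
    by (intro integrable_real_indicator) (auto simp: dyadic_I_def)
  then show ?thesis by (rule integrable_of_real)
qed

text \<open>The integral is the Fourier transform at 0 of a product of eight factors. One of the
  four cutoffs starts the product as the integrable function; the other seven factors are multiplied
  on as band-limited ones. In units of \<open>2^k\<close> the cutoffs contribute [-1, 1] each, and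
  the convolutions [l/2, l/2 + 1] twice, [9, 10] and [l + 9, l + 10].\<close>

lemma wave_packet_integral_eq_0:
  assumes psi_S: "schwartz \<psi>"
    and psi_supp: "\<forall>\<xi>. \<xi> \<notin> {0..1} \<longrightarrow> fourier \<psi> \<xi> = 0"
    and phi_S: "schwartz (\<lambda>x. complex_of_real (\<phi> x))"
    and phi_supp: "\<forall>\<xi>. \<xi> \<notin> {-1..1} \<longrightarrow> fourier (\<lambda>x. complex_of_real (\<phi> x)) \<xi> = 0"
    and f: "integrable lborel f1" "integrable lborel f2" "integrable lborel f3" "integrable lborel f4"
    and l: "l \<notin> {-13..-7}"
  shows "(LINT x|lebesgue. wave_packet \<psi> \<phi> f1 k n l x * wave_packet \<psi> \<phi> f2 k n l x *
        wave_packet \<psi> \<phi> f3 k n 18 x * wave_packet \<psi> \<phi> f4 k n (2 * l + 18) x) = 0"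
proof -
  let ?K = "2 powr real_of_int k"
  define h where "h y = complex_of_real (indicator (dyadic_I k n) y)" for y
  define ph where "ph u = complex_of_real (\<phi> u)" for u
  define X where "X = conv h (dil k ph)"
  define u where "u f i = conv f (psi_kl \<psi> k i)" for f i
  have wp: "wave_packet \<psi> \<phi> f k n i x = X x * u f i x" for f i x
    unfolding wave_packet_def chi_star_complex X_def u_def h_def ph_def ..
  obtain B where B: "molecule B ph" using schwartz_molecule[OF phi_S] unfolding ph_def by blast
  have hI: "integrable lborel h" unfolding h_def by (rule dyadic_I_indicator_integrable)
  have bX: "band X (?K * (-1)) (?K * 1)"
    unfolding X_def using phi_supp by (intro band_conv_dil[OF hI B]) (auto simp: ph_def[abs_def])
  have bu: "band (u f i) (?K * (i / 2)) (?K * (i / 2 + 1))" if "integrable lborel f" for f and i :: int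
  proof -
    obtain B where B: "molecule B (\<lambda>u. cis (pi * real_of_int i * u) * \<psi> u)"
      using molecule_modulate[OF psi_S] by blast
    show ?thesis
      unfolding u_def psi_kl_dil
      using psi_supp by (intro band_conv_dil[OF that B]) (auto simp: fourier_modulate[OF schwartz_measurable[OF psi_S]])
  qed
  have XI: "integrable lborel X" unfolding X_def by (intro integrable_conv hI dil_integrable[OF B])
  have Xs: "fourier X \<xi> = 0" if "\<xi> \<notin> {?K * (-1)..?K * 1}" for \<xi>
  proof -
    have "\<xi> / ?K \<notin> {-1..1}" using that by (auto simp: field_simps)
    then have "fourier (dil k ph) \<xi> = 0"
      using phi_supp fourier_dil[OF molecule_measurable[OF B]] by (simp add: ph_def[abs_def])
    then show ?thesis unfolding X_def fourier_conv[OF hI dil_integrable[OF B]] by simp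
  qed
  note s1 = fourier_mult_band[OF XI Xs bX]
  note s2 = fourier_mult_band[OF s1 bX]
  note s3 = fourier_mult_band[OF s2 bX]
  note s4 = fourier_mult_band[OF s3 bu[OF f(1), of l]]
  note s5 = fourier_mult_band[OF s4 bu[OF f(2), of l]]
  note s6 = fourier_mult_band[OF s5 bu[OF f(3), of 18]]
  note s7 = fourier_mult_band[OF s6 bu[OF f(4), of "2 * l + 18"]]
  define H where "H x = X x * X x * X x * X x * u f1 l x * u f2 l x * u f3 18 x * u f4 (2 * l + 18) x" for x
  have HI: "integrable lborel H" using s7(1) unfolding H_def .
  have "fourier H 0 = 0"
    unfolding H_def
  proof (rule s7(2))
    have K: "?K > 0" by simp
    have "2 * l + 14 > 0 \<or> 2 * l + 26 < 0" using l by auto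
    then have "2 * real_of_int l + 14 > 0 \<or> 2 * real_of_int l + 26 < 0" by linarith
    then have "?K * (2 * real_of_int l + 14) > 0 \<or> ?K * (2 * real_of_int l + 26) < 0"
      using K by (metis mult_pos_pos mult_pos_neg)
    moreover have "?K * - 1 + ?K * - 1 + ?K * - 1 + ?K * - 1 + ?K * (real_of_int l / 2) + ?K * (real_of_int l / 2) +
             ?K * (real_of_int 18 / 2) + ?K * (real_of_int (2 * l + 18) / 2) = ?K * (2 * real_of_int l + 14)"
      by (simp add: field_simps)
    moreover have "?K * 1 + ?K * 1 + ?K * 1 + ?K * 1 + ?K * (real_of_int l / 2 + 1) + ?K * (real_of_int l / 2 + 1) +
             ?K * (real_of_int 18 / 2 + 1) + ?K * (real_of_int (2 * l + 18) / 2 + 1) = ?K * (2 * real_of_int l + 26)"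
      by (simp add: field_simps)
    ultimately show "0 \<notin> {?K * - 1 + ?K * - 1 + ?K * - 1 + ?K * - 1 + ?K * (real_of_int l / 2) + ?K * (real_of_int l / 2) +
             ?K * (real_of_int 18 / 2) + ?K * (real_of_int (2 * l + 18) / 2)..
             ?K * 1 + ?K * 1 + ?K * 1 + ?K * 1 + ?K * (real_of_int l / 2 + 1) + ?K * (real_of_int l / 2 + 1) +
             ?K * (real_of_int 18 / 2 + 1) + ?K * (real_of_int (2 * l + 18) / 2 + 1)}"
      by (simp only: atLeastAtMost_iff) auto
  qed
  moreover have "H \<in> borel_measurable borel" using HI by auto
  ultimately have "(\<integral>x. H x \<partial>lborel) = 0" by (simp add: fourier_lborel)
  moreover have "(LINT x|lebesgue. H x) = (\<integral>x. H x \<partial>lborel)"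
    using HI by (intro integral_completion) auto
  moreover have "wave_packet \<psi> \<phi> f1 k n l x * wave_packet \<psi> \<phi> f2 k n l x *
        wave_packet \<psi> \<phi> f3 k n 18 x * wave_packet \<psi> \<phi> f4 k n (2 * l + 18) x = H x" for x
    unfolding wp H_def by (simp only: mult_ac)
  ultimately show ?thesis by simp
qed

text \<open>The dyadic intervals of one scale are disjoint, so a finite sum of the cutoffs is at
  most the full integral of \<open>phi_k\<close>, which is the transform of \<phi> at 0.\<close>

lemma chi_star_bounds:
  assumes nonneg: "\<forall>x. \<phi> x \<ge> 0" and S: "schwartz (\<lambda>x. complex_of_real (\<phi> x))"
    and phi_0: "fourier (\<lambda>x. complex_of_real (\<phi> x)) 0 = 1"
  shows chi_star_nonneg: "0 \<le> chi_star \<phi> k n x"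
    and sum_chi_star_le: "finite N \<Longrightarrow> (\<Sum>n\<in>N. chi_star \<phi> k n x) \<le> 1"
proof -
  define ph where "ph u = complex_of_real (\<phi> u)" for u
  obtain B where B: "molecule B ph" using schwartz_molecule[OF S] unfolding ph_def by blast
  have phm[measurable]: "ph \<in> borel_measurable borel" by (rule molecule_measurable[OF B])
  have "(\<lambda>u. Re (ph u)) \<in> borel_measurable borel" by measurable
  then have [measurable]: "\<phi> \<in> borel_measurable borel" by (simp add: ph_def)
  have [measurable]: "phi_k \<phi> k \<in> borel_measurable borel" unfolding phi_k_def[abs_def] by measurable
  have [measurable]: "dyadic_I k n \<in> sets borel" for n unfolding dyadic_I_def by simp
  have pk0: "0 \<le> phi_k \<phi> k y" for y using nonneg by (simp add: phi_k_def)
  have I: "integrable lborel (dil k ph)" by (rule dil_integrable[OF B])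
  have Ir: "integrable lborel (phi_k \<phi> k)"
    using integrable_Re[OF I] by (simp add: ph_def dil_def phi_k_def[abs_def])
  have Ir': "integrable lborel (\<lambda>y. phi_k \<phi> k (x - y))"
    using lborel_integrable_real_affine[of "phi_k \<phi> k" "-1" x] Ir by simp
  have "(\<integral>y. dil k ph y \<partial>lborel) = fourier (dil k ph) 0"
    by (simp add: fourier_lborel)
  also have "\<dots> = 1" using phi_0 by (simp add: fourier_dil ph_def[abs_def])
  finally have one: "(\<integral>y. phi_k \<phi> k y \<partial>lborel) = 1"
    unfolding ph_def phi_k_dil[symmetric] by (metis integral_complex_of_real of_real_eq_1_iff)
  have one': "(\<integral>y. phi_k \<phi> k (x - y) \<partial>lborel) = 1"
    using lborel_integral_real_affine[of "-1" "phi_k \<phi> k" x] one by simp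
  have chi: "chi_star \<phi> k n x = (\<integral>y. indicator (dyadic_I k n) y * phi_k \<phi> k (x - y) \<partial>lborel)" for n
    unfolding chi_star_def by (rule conv_lborel) measurable
  show "0 \<le> chi_star \<phi> k n x" unfolding chi using pk0 by (intro Bochner_Integration.integral_nonneg) auto
  have In: "integrable lborel (\<lambda>y. indicator (dyadic_I k n) y * phi_k \<phi> k (x - y))" for n
    by (rule Bochner_Integration.integrable_bound[OF Ir']) (auto simp: indicator_def)
  assume N: "finite N"
  have "(\<Sum>n\<in>N. chi_star \<phi> k n x) = (\<integral>y. (\<Sum>n\<in>N. indicator (dyadic_I k n) y * phi_k \<phi> k (x - y)) \<partial>lborel)"
    unfolding chi using In by (intro Bochner_Integration.integral_sum[symmetric]) auto
  also have "\<dots> \<le> (\<integral>y. phi_k \<phi> k (x - y) \<partial>lborel)"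
  proof (rule integral_mono)
    show "integrable lborel (\<lambda>y. \<Sum>n\<in>N. indicator (dyadic_I k n) y * phi_k \<phi> k (x - y))" using In by auto
    show "integrable lborel (\<lambda>y. phi_k \<phi> k (x - y))" by (rule Ir')
    fix y
    have "n = n'" if "y \<in> dyadic_I k n" "y \<in> dyadic_I k n'" for n n'
    proof -
      have fl: "n = \<lfloor>2 powr real_of_int k * y\<rfloor>" if "y \<in> dyadic_I k n" for n
        using that by (intro floor_unique[symmetric]) (auto simp: dyadic_I_def powr_minus field_simps)
      show ?thesis by (rule trans[OF fl[OF that(1)] fl[OF that(2), symmetric]])
    qed
    then have c: "card {n\<in>N. y \<in> dyadic_I k n} \<le> Suc 0"
      using N by (intro card_le_Suc0_iff_eq[THEN iffD2]) auto
    have "(\<Sum>n\<in>N. indicator (dyadic_I k n) y * phi_k \<phi> k (x - y))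
        = (\<Sum>n\<in>N. indicator (dyadic_I k n) y) * phi_k \<phi> k (x - y)" by (simp add: sum_distrib_right)
    also have "(\<Sum>n\<in>N. indicator (dyadic_I k n) y :: real) = real (card {n\<in>N. y \<in> dyadic_I k n})"
      using N by (simp add: indicator_def sum.If_cases Int_def)
    also have "real (card {n\<in>N. y \<in> dyadic_I k n}) * phi_k \<phi> k (x - y) \<le> 1 * phi_k \<phi> k (x - y)"
      using c pk0 by (intro mult_right_mono) auto
    finally show "(\<Sum>n\<in>N. indicator (dyadic_I k n) y * phi_k \<phi> k (x - y)) \<le> phi_k \<phi> k (x - y)" by simp
  qed
  finally show "(\<Sum>n\<in>N. chi_star \<phi> k n x) \<le> 1" using one' by simp
qed

lemma sum_chi_star_power_le:
  assumes "\<forall>x. \<phi> x \<ge> 0" "schwartz (\<lambda>x. complex_of_real (\<phi> x))"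
    "fourier (\<lambda>x. complex_of_real (\<phi> x)) 0 = 1" and N: "finite N"
  shows "(\<Sum>n\<in>N. chi_star \<phi> k n x ^ 4) \<le> 1"
proof -
  note c = chi_star_bounds[OF assms(1-3)]
  have "chi_star \<phi> k n x ^ 4 \<le> chi_star \<phi> k n x" for n
    using power_decreasing[of 1 4 "chi_star \<phi> k n x"] c(1)[of k n x] c(2)[of "{n}" k x] by simp
  then have "(\<Sum>n\<in>N. chi_star \<phi> k n x ^ 4) \<le> (\<Sum>n\<in>N. chi_star \<phi> k n x)" by (rule sum_mono)
  also have "\<dots> \<le> 1" by (rule c(2)[OF N])
  finally show ?thesis .
qed

section \<open>Almost orthogonality\<close>

lemma sum_half_power_le:
  assumes "finite N"
  shows "(\<Sum>n\<in>N. (1/2::real) ^ n) \<le> 2"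
proof -
  have "(\<Sum>n\<in>N. (1/2::real) ^ n) \<le> (\<Sum>n. (1/2) ^ n)"
    using assms by (intro sum_le_suminf) (auto intro: summable_geometric)
  also have "\<dots> = 2" by (subst suminf_geometric) auto
  finally show ?thesis .
qed

lemma sum_two_powr_dist_le:
  fixes j :: int
  assumes T: "finite T"
  shows "(\<Sum>k\<in>T. 2 powr - \<bar>real_of_int (k - j)\<bar>) \<le> 4"
proof -
  have half: "(\<Sum>k\<in>S. 2 powr - \<bar>real_of_int (k - j)\<bar>) \<le> 2"
    if "finite S" "inj_on (\<lambda>k. nat \<bar>k - j\<bar>) S" for S
  proof -
    have "(\<Sum>k\<in>S. 2 powr - \<bar>real_of_int (k - j)\<bar>) = (\<Sum>k\<in>S. (1/2) ^ nat \<bar>k - j\<bar>)"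
    proof (rule sum.cong[OF refl])
      fix k
      have "\<bar>real_of_int (k - j)\<bar> = real (nat \<bar>k - j\<bar>)" by simp
      then show "2 powr - \<bar>real_of_int (k - j)\<bar> = (1/2) ^ nat \<bar>k - j\<bar>"
        by (simp only: powr_minus powr_realpow zero_less_numeral power_one_over inverse_eq_divide)
    qed
    also have "\<dots> = (\<Sum>n\<in>(\<lambda>k. nat \<bar>k - j\<bar>) ` S. (1/2) ^ n)"
      using that by (simp add: sum.reindex)
    also have "\<dots> \<le> 2" using that by (intro sum_half_power_le) auto
    finally show ?thesis .
  qed
  have "(\<Sum>k\<in>T. 2 powr - \<bar>real_of_int (k - j)\<bar>)
     = (\<Sum>k\<in>{k\<in>T. j \<le> k}. 2 powr - \<bar>real_of_int (k - j)\<bar>) + (\<Sum>k\<in>{k\<in>T. \<not> j \<le> k}. 2 powr - \<bar>real_of_int (k - j)\<bar>)"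
    using T by (subst sum.union_disjoint[symmetric]) (auto intro!: sum.cong)
  also have "\<dots> \<le> 2 + 2"
    using T by (intro add_mono half) (auto simp: inj_on_def)
  finally show ?thesis by simp
qed

text \<open>Small shifts use the Lipschitz bound. For |h| > 1 the triangle inequality gives 4 B,
  which is at most 4 B |h|.\<close>

lemma nn_integral_shift_diff_le:
  assumes m: "molecule B g"
  shows "(\<integral>\<^sup>+s. ennreal (cmod (g (s + h) - g s)) \<partial>lborel) \<le> ennreal (4 * B * \<bar>h\<bar>)"
proof (cases "\<bar>h\<bar> \<le> 1")
  case True
  have B: "0 \<le> B" by (rule molecule_nonneg[OF m])
  have "(\<integral>\<^sup>+s. ennreal (cmod (g (s + h) - g s)) \<partial>lborel) \<le> (\<integral>\<^sup>+s. ennreal (B * \<bar>h\<bar>) * ennreal (tail s) \<partial>lborel)"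
  proof (rule nn_integral_mono)
    fix s
    have "cmod (g (s + h) - g s) \<le> B * \<bar>s + h - s\<bar> * tail s"
      using m True unfolding molecule_def by (metis add_diff_cancel_left')
    then show "ennreal (cmod (g (s + h) - g s)) \<le> ennreal (B * \<bar>h\<bar>) * ennreal (tail s)"
      using B tail_nonneg by (simp add: ennreal_mult[symmetric] ennreal_leI)
  qed
  also have "\<dots> = ennreal (B * \<bar>h\<bar>) * ennreal 2" by (simp add: nn_integral_cmult nn_integral_tail)
  also have "\<dots> = ennreal (B * \<bar>h\<bar> * 2)" using B by (subst ennreal_mult) auto
  also have "\<dots> \<le> ennreal (4 * B * \<bar>h\<bar>)" using B by (intro ennreal_leI) auto
  finally show ?thesis .
next
  case False
  have B: "0 \<le> B" by (rule molecule_nonneg[OF m])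
  have "(\<integral>\<^sup>+s. ennreal (cmod (g (s + h) - g s)) \<partial>lborel)
      \<le> (\<integral>\<^sup>+s. ennreal B * ennreal (tail (s - (-h))) + ennreal B * ennreal (tail s) \<partial>lborel)"
  proof (rule nn_integral_mono)
    fix s
    have "cmod (g (s + h) - g s) \<le> cmod (g (s + h)) + cmod (g s)" by (rule norm_triangle_ineq4)
    also have "\<dots> \<le> B * tail (s + h) + B * tail s" by (intro add_mono molecule_tail m)
    finally show "ennreal (cmod (g (s + h) - g s)) \<le> ennreal B * ennreal (tail (s - (-h))) + ennreal B * ennreal (tail s)"
      using B tail_nonneg by (simp add: ennreal_mult[symmetric] ennreal_plus[symmetric] ennreal_leI del: ennreal_plus)
  qed
  also have "\<dots> = ennreal B * 2 + ennreal B * 2"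
    using nn_integral_lborel_translate[of "\<lambda>u. ennreal (tail u)" "-h"]
    by (subst nn_integral_add) (auto simp: nn_integral_cmult nn_integral_tail)
  also have "\<dots> = ennreal (4 * B)"
    using B ennreal_mult[of B 4] by (simp add: mult.commute flip: distrib_left)
  also have "\<dots> \<le> ennreal (4 * B * \<bar>h\<bar>)" using B False mult_left_mono[of 1 "\<bar>h\<bar>" "4 * B"] by (intro ennreal_leI) auto
  finally show ?thesis .
qed

lemma nn_integral_dil_shift_diff_le:
  assumes m: "molecule B g"
  shows "(\<integral>\<^sup>+s. ennreal (cmod (dil j g (s + u) - dil j g s)) \<partial>lborel) \<le> ennreal (4 * B * (2 powr real_of_int j * \<bar>u\<bar>))"
proof -
  let ?J = "2 powr real_of_int j"
  have [measurable]: "g \<in> borel_measurable borel" by (rule molecule_measurable[OF m])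
  have [measurable]: "dil i g \<in> borel_measurable borel" for i by measurable
  have "cmod (dil j g (s + u) - dil j g s) = ?J * cmod (g (?J * s + ?J * u) - g (?J * s))" for s
    unfolding dil_def by (simp add: norm_mult distrib_left flip: right_diff_distrib)
  then have "(\<integral>\<^sup>+s. ennreal (cmod (dil j g (s + u) - dil j g s)) \<partial>lborel)
      = (\<integral>\<^sup>+s. ennreal (?J * cmod (g (?J * s + ?J * u) - g (?J * s))) \<partial>lborel)" by simp
  also have "\<dots> = (\<integral>\<^sup>+s. ennreal (cmod (g (s + ?J * u) - g s)) \<partial>lborel)"
    using nn_integral_dilate[of "\<lambda>s. cmod (g (s + ?J * u) - g s)" ?J] by simp
  also have "\<dots> \<le> ennreal (4 * B * \<bar>?J * u\<bar>)" by (rule nn_integral_shift_diff_le[OF m])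
  finally show ?thesis by (simp add: abs_mult)
qed

lemma nn_integral_dil_first_moment_le:
  assumes m: "molecule B g"
  shows "(\<integral>\<^sup>+u. ennreal (cmod (dil k g u) * \<bar>u\<bar>) \<partial>lborel) \<le> ennreal (2 * B * 2 powr - real_of_int k)"
proof -
  let ?K = "2 powr real_of_int k"
  have B: "0 \<le> B" by (rule molecule_nonneg[OF m])
  have [measurable]: "g \<in> borel_measurable borel" by (rule molecule_measurable[OF m])
  have [measurable]: "dil i g \<in> borel_measurable borel" for i by measurable
  have "(\<integral>\<^sup>+u. ennreal (cmod (dil k g u) * \<bar>u\<bar>) \<partial>lborel)
     \<le> (\<integral>\<^sup>+u. ennreal (B * 2 powr - real_of_int k) * ennreal (tail_k k u) \<partial>lborel)"
  proof (rule nn_integral_mono)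
    fix u
    let ?t = "?K * u"
    have "cmod (g ?t) * \<bar>?t\<bar> \<le> B / (1 + \<bar>?t\<bar>) ^ 3 * (1 + \<bar>?t\<bar>)"
      using B by (intro mult_mono molecule_decay[OF m]) auto
    also have "\<dots> = B * tail ?t" by (simp add: tail_def power2_eq_square power3_eq_cube)
    finally have "cmod (g ?t) * (?K * \<bar>u\<bar>) \<le> B * tail ?t" by (simp add: abs_mult)
    then have "cmod (dil k g u) * \<bar>u\<bar> \<le> B * 2 powr - real_of_int k * tail_k k u"
      unfolding norm_dil tail_k_def by (simp add: powr_minus field_simps)
    then show "ennreal (cmod (dil k g u) * \<bar>u\<bar>) \<le> ennreal (B * 2 powr - real_of_int k) * ennreal (tail_k k u)"
      using B tail_k_nonneg by (simp add: ennreal_mult[symmetric] ennreal_leI)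
  qed
  also have "\<dots> = ennreal (B * 2 powr - real_of_int k) * ennreal 2" by (simp add: nn_integral_cmult nn_integral_tail_k)
  also have "\<dots> = ennreal (2 * B * 2 powr - real_of_int k)"
    using B by (subst ennreal_mult[symmetric]) (auto simp: mult_ac)
  finally show ?thesis .
qed

lemma cnj_measurable [measurable]: "cnj \<in> borel_measurable borel"
  by (intro borel_measurable_continuous_onI continuous_intros)

text \<open>The kernel coupling the scales \<open>k\<close> and \<open>j\<close> when convolution
  with one dilate is composed with the adjoint of convolution with the other.\<close>

definition corr :: "(real \<Rightarrow> complex) \<Rightarrow> int \<Rightarrow> int \<Rightarrow> real \<Rightarrow> complex" where
  "corr g k j s = (\<integral>u. dil k g u * cnj (dil j g (s + u)) \<partial>lborel)"

lemma integral_dil: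
  assumes m: "molecule B g" and z: "(\<integral>u. g u \<partial>lborel) = 0"
  shows "(\<integral>u. dil k g u \<partial>lborel) = 0"
proof -
  have "(\<integral>u. g u \<partial>lborel) = \<bar>2 powr real_of_int k\<bar> *\<^sub>R (\<integral>u. g (0 + 2 powr real_of_int k * u) \<partial>lborel)"
    by (rule lborel_integral_real_affine) simp
  then show ?thesis using z by (simp add: dil_def scaleR_conv_of_real)
qed

text \<open>Since \<open>dil k g\<close> has mean zero, \<open>dil j g s\<close> may be subtracted
  from the second factor. The difference costs 4 B 2^j |u| in the L1 norm, and the first moment of
  \<open>dil k g\<close> is at most 2 B 2^(-k). This is effective when \<open>k\<close> is the finer
  scale.\<close>

lemma nn_integral_corr_le_aux:
  assumes m: "molecule B g" and z: "(\<integral>u. g u \<partial>lborel) = 0"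
  shows "(\<integral>\<^sup>+s. ennreal (cmod (corr g k j s)) \<partial>lborel) \<le> ennreal (8 * B\<^sup>2 * 2 powr real_of_int (j - k))"
proof -
  have B: "0 \<le> B" by (rule molecule_nonneg[OF m])
  have [measurable]: "g \<in> borel_measurable borel" by (rule molecule_measurable[OF m])
  have [measurable]: "dil i g \<in> borel_measurable borel" for i by measurable
  have I: "integrable lborel (dil k g)" by (rule dil_integrable[OF m])
  have cr: "cmod (corr g k j s) \<le> (\<integral>u. cmod (dil k g u) * cmod (dil j g (s + u) - dil j g s) \<partial>lborel)
     \<and> integrable lborel (\<lambda>u. dil k g u * cnj (dil j g (s + u) - dil j g s))" for s
  proof -
    have I1: "integrable lborel (\<lambda>u. dil k g u * cnj (dil j g (s + u)))"
    proof (rule Bochner_Integration.integrable_bound[OF integrable_mult_left[OF I, of "of_real (2 powr real_of_int j * B)"]])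
      show "AE u in lborel. norm (dil k g u * cnj (dil j g (s + u))) \<le> norm (dil k g u * of_real (2 powr real_of_int j * B))"
        using dil_bounded[OF m, of j] B
        by (intro AE_I2) (auto simp: norm_mult abs_mult intro!: mult_left_mono)
    qed measurable
    have I2: "integrable lborel (\<lambda>u. dil k g u * cnj (dil j g s))" using I by simp
    have "corr g k j s = (\<integral>u. dil k g u * cnj (dil j g (s + u)) \<partial>lborel) - (\<integral>u. dil k g u * cnj (dil j g s) \<partial>lborel)"
      using integral_dil[OF m z] by (simp add: corr_def)
    also have "\<dots> = (\<integral>u. dil k g u * cnj (dil j g (s + u) - dil j g s) \<partial>lborel)"
      unfolding Bochner_Integration.integral_diff[OF I1 I2, symmetric] by (simp add: right_diff_distrib)
    finally have "cmod (corr g k j s) \<le> (\<integral>u. cmod (dil k g u * cnj (dil j g (s + u) - dil j g s)) \<partial>lborel)"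
      by (simp add: integral_norm_bound del: norm_mult)
    moreover have "integrable lborel (\<lambda>u. dil k g u * cnj (dil j g (s + u) - dil j g s))"
      using Bochner_Integration.integrable_diff[OF I1 I2] by (simp add: right_diff_distrib)
    ultimately show ?thesis by (simp add: norm_mult flip: complex_cnj_diff)
  qed
  have b: "ennreal (cmod (corr g k j s)) \<le> (\<integral>\<^sup>+u. ennreal (cmod (dil k g u)) * ennreal (cmod (dil j g (s + u) - dil j g s)) \<partial>lborel)" for s
  proof -
    note * = cr[of s]
    have "(\<integral>\<^sup>+u. ennreal (norm (dil k g u * cnj (dil j g (s + u) - dil j g s))) \<partial>lborel)
       = ennreal (\<integral>u. norm (dil k g u * cnj (dil j g (s + u) - dil j g s)) \<partial>lborel)"
      using * by (intro nn_integral_eq_integral integrable_norm) auto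
    moreover have "norm (dil k g u * cnj (dil j g (s + u) - dil j g s)) = cmod (dil k g u) * cmod (dil j g (s + u) - dil j g s)" for u
      by (simp add: norm_mult flip: complex_cnj_diff)
    ultimately show ?thesis using * by (simp add: ennreal_mult ennreal_leI del: complex_cnj_diff)
  qed
  have "(\<integral>\<^sup>+s. ennreal (cmod (corr g k j s)) \<partial>lborel)
     \<le> (\<integral>\<^sup>+s. \<integral>\<^sup>+u. ennreal (cmod (dil k g u)) * ennreal (cmod (dil j g (s + u) - dil j g s)) \<partial>lborel \<partial>lborel)"
    by (intro nn_integral_mono b)
  also have "\<dots> = (\<integral>\<^sup>+u. \<integral>\<^sup>+s. ennreal (cmod (dil k g u)) * ennreal (cmod (dil j g (s + u) - dil j g s)) \<partial>lborel \<partial>lborel)"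
    by (rule lborel_pair.Fubini') measurable
  also have "\<dots> = (\<integral>\<^sup>+u. ennreal (cmod (dil k g u)) * (\<integral>\<^sup>+s. ennreal (cmod (dil j g (s + u) - dil j g s)) \<partial>lborel) \<partial>lborel)"
    by (intro nn_integral_cong nn_integral_cmult) measurable
  also have "\<dots> \<le> (\<integral>\<^sup>+u. ennreal (cmod (dil k g u)) * ennreal (4 * B * (2 powr real_of_int j * \<bar>u\<bar>)) \<partial>lborel)"
    by (intro nn_integral_mono mult_left_mono nn_integral_dil_shift_diff_le[OF m]) auto
  also have "\<dots> = (\<integral>\<^sup>+u. ennreal (4 * B * 2 powr real_of_int j) * ennreal (cmod (dil k g u) * \<bar>u\<bar>) \<partial>lborel)"
    using B by (intro nn_integral_cong) (simp add: ennreal_mult[symmetric] mult_ac)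
  also have "\<dots> = ennreal (4 * B * 2 powr real_of_int j) * (\<integral>\<^sup>+u. ennreal (cmod (dil k g u) * \<bar>u\<bar>) \<partial>lborel)"
    by (rule nn_integral_cmult) measurable
  also have "\<dots> \<le> ennreal (4 * B * 2 powr real_of_int j) * ennreal (2 * B * 2 powr - real_of_int k)"
    by (intro mult_left_mono nn_integral_dil_first_moment_le[OF m]) auto
  also have "\<dots> = ennreal (8 * B\<^sup>2 * 2 powr real_of_int (j - k))"
    using B by (simp add: ennreal_mult[symmetric] powr_diff powr_minus power2_eq_square field_simps)
  finally show ?thesis .
qed

text \<open>Exchanges the roles of the two scales, so that the finer one can always be the one that
  supplies the cancellation.\<close>

lemma corr_swap: "corr g k j s = cnj (corr g j k (- s))"
proof -
  have "corr g k j s = (\<integral>u. (\<lambda>u. dil k g (u + - s) * cnj (dil j g u)) (u - (- s)) \<partial>lborel)"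
    by (simp add: corr_def add.commute)
  also have "\<dots> = (\<integral>u. dil k g (u + - s) * cnj (dil j g u) \<partial>lborel)"
    by (rule lborel_integral_translate)
  also have "\<dots> = (\<integral>u. cnj (dil j g u * cnj (dil k g (- s + u))) \<partial>lborel)"
    by (simp add: mult.commute add.commute)
  also have "\<dots> = cnj (corr g j k (- s))" unfolding corr_def by (rule Bochner_Integration.integral_cnj)
  finally show ?thesis .
qed

lemma nn_integral_corr_le:
  assumes m: "molecule B g" and z: "(\<integral>u. g u \<partial>lborel) = 0"
  shows "(\<integral>\<^sup>+s. ennreal (cmod (corr g k j s)) \<partial>lborel) \<le> ennreal (8 * B\<^sup>2 * 2 powr - \<bar>real_of_int (j - k)\<bar>)"
proof (cases "j \<le> k")
  case True
  then have "- \<bar>real_of_int (j - k)\<bar> = real_of_int (j - k)" by simp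
  then show ?thesis using nn_integral_corr_le_aux[OF m z] by (simp only:)
next
  case False
  have [measurable]: "g \<in> borel_measurable borel" by (rule molecule_measurable[OF m])
  have [measurable]: "dil i g \<in> borel_measurable borel" for i by measurable
  have cm: "(\<lambda>s. ennreal (cmod (corr g j k s))) \<in> borel_measurable borel"
    unfolding corr_def by measurable
  have "(\<integral>\<^sup>+s. ennreal (cmod (corr g k j s)) \<partial>lborel) = (\<integral>\<^sup>+s. ennreal (cmod (corr g j k (0 - s))) \<partial>lborel)"
    by (simp add: corr_swap[of g k j])
  also have "\<dots> = (\<integral>\<^sup>+s. ennreal (cmod (corr g j k s)) \<partial>lborel)"
    by (rule nn_integral_lborel_reflect[OF cm])
  also have "\<dots> \<le> ennreal (8 * B\<^sup>2 * 2 powr real_of_int (k - j))" by (rule nn_integral_corr_le_aux[OF m z])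
  also have "real_of_int (k - j) = - \<bar>real_of_int (j - k)\<bar>" using False by simp
  finally show ?thesis .
qed

lemma norm_conv_dil_le:
  assumes m: "molecule B g" and f: "integrable lborel f"
  shows "cmod (conv f (dil k g) x) \<le> 2 powr real_of_int k * B * (\<integral>y. cmod (f y) \<partial>lborel)"
proof -
  have [measurable]: "f \<in> borel_measurable borel" "g \<in> borel_measurable borel"
    using f molecule_measurable[OF m] by auto
  have [measurable]: "dil k g \<in> borel_measurable borel" by measurable
  have B: "0 \<le> B" by (rule molecule_nonneg[OF m])
  have "ennreal (cmod (conv f (dil k g) x)) \<le> (\<integral>\<^sup>+y. ennreal (cmod (f y) * cmod (dil k g (x - y))) \<partial>lborel)"
    by (rule nn_integral_norm_conv_le) measurable
  also have "\<dots> \<le> (\<integral>\<^sup>+y. ennreal (2 powr real_of_int k * B * cmod (f y)) \<partial>lborel)"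
    using mult_left_mono[OF dil_bounded[OF m], of "cmod (f _)"]
    by (intro nn_integral_mono ennreal_leI) (simp add: mult.commute)
  also have "\<dots> = ennreal (\<integral>y. 2 powr real_of_int k * B * cmod (f y) \<partial>lborel)"
    using f B by (intro nn_integral_eq_integral) auto
  finally show ?thesis using B by (simp add: ennreal_le_iff)
qed

lemma integrable_norm_square:
  assumes I: "integrable lborel f" and b: "\<And>x::real. cmod (f x) \<le> M"
  shows "integrable lborel (\<lambda>x. (cmod (f x))\<^sup>2)"
proof (rule Bochner_Integration.integrable_bound)
  show "integrable lborel (\<lambda>x. M * cmod (f x))" using I by simp
  show "AE x in lborel. norm ((cmod (f x))\<^sup>2) \<le> norm (M * cmod (f x))"
  proof (intro AE_I2)
    fix x
    have "cmod (f x) * cmod (f x) \<le> M * cmod (f x)" using b[of x] by (intro mult_right_mono) auto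
    then show "norm ((cmod (f x))\<^sup>2) \<le> norm (M * cmod (f x))"
      by (simp add: power2_eq_square)
  qed
qed (use I in measurable)

text \<open>Schur test: the product of the two moduli is at most half the sum of their squares, and
  in each half the kernel is integrated out in the variable that no longer occurs.\<close>

lemma cross_term_le:
  assumes m: "molecule B g" and z: "(\<integral>u. g u \<partial>lborel) = 0"
    and I: "integrable lborel G" "integrable lborel G'"
    and b: "\<And>x. cmod (G x) \<le> M" "\<And>x. cmod (G' x) \<le> M'"
  shows "cmod (\<integral>x. cnj (G x) * (\<integral>x'. G' x' * corr g k j (x' - x) \<partial>lborel) \<partial>lborel)
    \<le> 4 * B\<^sup>2 * 2 powr - \<bar>real_of_int (j - k)\<bar> *
        ((\<integral>x. (cmod (G x))\<^sup>2 \<partial>lborel) + (\<integral>x. (cmod (G' x))\<^sup>2 \<partial>lborel))"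
proof -
  have [measurable]: "g \<in> borel_measurable borel" by (rule molecule_measurable[OF m])
  have [measurable]: "dil i g \<in> borel_measurable borel" for i by measurable
  have [measurable]: "G \<in> borel_measurable borel" "G' \<in> borel_measurable borel" using I by auto
  have [measurable]: "corr g k j \<in> borel_measurable borel" unfolding corr_def by measurable
  define r where "r = 8 * B\<^sup>2 * 2 powr - \<bar>real_of_int (j - k)\<bar>"
  have r0: "0 \<le> r" by (simp add: r_def)
  let ?R = "\<lambda>s. ennreal (cmod (corr g k j s))"
  have r: "(\<integral>\<^sup>+s. ?R s \<partial>lborel) \<le> ennreal r"
    unfolding r_def by (rule nn_integral_corr_le[OF m z])
  note S = integrable_norm_square[OF I(1) b(1)] integrable_norm_square[OF I(2) b(2)]
  define a where "a = (\<integral>x. (cmod (G x))\<^sup>2 \<partial>lborel)"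
  define a' where "a' = (\<integral>x. (cmod (G' x))\<^sup>2 \<partial>lborel)"
  have a0: "0 \<le> a" "0 \<le> a'" by (simp_all add: a_def a'_def)
  have nnG: "(\<integral>\<^sup>+x. ennreal ((cmod (G x))\<^sup>2) \<partial>lborel) = ennreal a"
    unfolding a_def using S(1) by (intro nn_integral_eq_integral) auto
  have nnG': "(\<integral>\<^sup>+x. ennreal ((cmod (G' x))\<^sup>2) \<partial>lborel) = ennreal a'"
    unfolding a'_def using S(2) by (intro nn_integral_eq_integral) auto
  have "ennreal (cmod (\<integral>x. cnj (G x) * (\<integral>x'. G' x' * corr g k j (x' - x) \<partial>lborel) \<partial>lborel))
    \<le> (\<integral>\<^sup>+x. ennreal (cmod (cnj (G x) * (\<integral>x'. G' x' * corr g k j (x' - x) \<partial>lborel))) \<partial>lborel)"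
    by (rule norm_integral_le_nn_integral)
  also have "\<dots> \<le> (\<integral>\<^sup>+x. \<integral>\<^sup>+x'. ennreal (cmod (G x)) * ennreal (cmod (G' x')) * ?R (x' - x) \<partial>lborel \<partial>lborel)"
  proof (rule nn_integral_mono)
    fix x
    have "ennreal (cmod (cnj (G x) * (\<integral>x'. G' x' * corr g k j (x' - x) \<partial>lborel)))
      \<le> ennreal (cmod (G x)) * (\<integral>\<^sup>+x'. ennreal (cmod (G' x' * corr g k j (x' - x))) \<partial>lborel)"
      unfolding norm_mult complex_mod_cnj
      by (subst ennreal_mult) (auto intro!: mult_left_mono norm_integral_le_nn_integral simp flip: norm_mult)
    also have "\<dots> = (\<integral>\<^sup>+x'. ennreal (cmod (G x)) * ennreal (cmod (G' x' * corr g k j (x' - x))) \<partial>lborel)"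
      by (rule nn_integral_cmult[symmetric]) measurable
    finally show "ennreal (cmod (cnj (G x) * (\<integral>x'. G' x' * corr g k j (x' - x) \<partial>lborel)))
      \<le> (\<integral>\<^sup>+x'. ennreal (cmod (G x)) * ennreal (cmod (G' x')) * ?R (x' - x) \<partial>lborel)"
      by (simp add: norm_mult ennreal_mult mult.assoc)
  qed
  also have "\<dots> \<le> (\<integral>\<^sup>+x. \<integral>\<^sup>+x'. ennreal ((cmod (G x))\<^sup>2 / 2) * ?R (x' - x)
       + ennreal ((cmod (G' x'))\<^sup>2 / 2) * ?R (x' - x) \<partial>lborel \<partial>lborel)"
  proof (intro nn_integral_mono)
    fix x x'
    have "cmod (G x) * cmod (G' x') \<le> (cmod (G x))\<^sup>2 / 2 + (cmod (G' x'))\<^sup>2 / 2"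
      using sum_squares_bound[of "cmod (G x)" "cmod (G' x')"] by simp
    then have "ennreal (cmod (G x)) * ennreal (cmod (G' x')) \<le> ennreal ((cmod (G x))\<^sup>2 / 2) + ennreal ((cmod (G' x'))\<^sup>2 / 2)"
      by (simp add: ennreal_mult[symmetric] ennreal_leI flip: ennreal_plus)
    then show "ennreal (cmod (G x)) * ennreal (cmod (G' x')) * ?R (x' - x)
      \<le> ennreal ((cmod (G x))\<^sup>2 / 2) * ?R (x' - x) + ennreal ((cmod (G' x'))\<^sup>2 / 2) * ?R (x' - x)"
      unfolding distrib_right[symmetric] by (rule mult_right_mono) auto
  qed
  also have "\<dots> = (\<integral>\<^sup>+x. \<integral>\<^sup>+x'. ennreal ((cmod (G x))\<^sup>2 / 2) * ?R (x' - x) \<partial>lborel \<partial>lborel)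
      + (\<integral>\<^sup>+x. \<integral>\<^sup>+x'. ennreal ((cmod (G' x'))\<^sup>2 / 2) * ?R (x' - x) \<partial>lborel \<partial>lborel)"
    by (simp add: nn_integral_add)
  also have "(\<integral>\<^sup>+x. \<integral>\<^sup>+x'. ennreal ((cmod (G' x'))\<^sup>2 / 2) * ?R (x' - x) \<partial>lborel \<partial>lborel)
    = (\<integral>\<^sup>+x'. \<integral>\<^sup>+x. ennreal ((cmod (G' x'))\<^sup>2 / 2) * ?R (x' - x) \<partial>lborel \<partial>lborel)"
    by (rule lborel_pair.Fubini') measurable
  also have "(\<integral>\<^sup>+x'. \<integral>\<^sup>+x. ennreal ((cmod (G' x'))\<^sup>2 / 2) * ?R (x' - x) \<partial>lborel \<partial>lborel)
    = (\<integral>\<^sup>+x'. ennreal ((cmod (G' x'))\<^sup>2 / 2) * (\<integral>\<^sup>+s. ?R s \<partial>lborel) \<partial>lborel)"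
    by (simp add: nn_integral_cmult nn_integral_lborel_reflect[of ?R])
  also have "(\<integral>\<^sup>+x. \<integral>\<^sup>+x'. ennreal ((cmod (G x))\<^sup>2 / 2) * ?R (x' - x) \<partial>lborel \<partial>lborel)
    = (\<integral>\<^sup>+x. ennreal ((cmod (G x))\<^sup>2 / 2) * (\<integral>\<^sup>+s. ?R s \<partial>lborel) \<partial>lborel)"
    by (simp add: nn_integral_cmult nn_integral_lborel_translate[of ?R])
  also have "(\<integral>\<^sup>+x. ennreal ((cmod (G x))\<^sup>2 / 2) * (\<integral>\<^sup>+s. ?R s \<partial>lborel) \<partial>lborel) +
     (\<integral>\<^sup>+x'. ennreal ((cmod (G' x'))\<^sup>2 / 2) * (\<integral>\<^sup>+s. ?R s \<partial>lborel) \<partial>lborel)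
     \<le> (\<integral>\<^sup>+x. ennreal (r / 2) * ennreal ((cmod (G x))\<^sup>2) \<partial>lborel) + (\<integral>\<^sup>+x. ennreal (r / 2) * ennreal ((cmod (G' x))\<^sup>2) \<partial>lborel)"
  proof (intro add_mono nn_integral_mono)
    have *: "ennreal (c / 2) * (\<integral>\<^sup>+s. ?R s \<partial>lborel) \<le> ennreal (r / 2) * ennreal c" if "0 \<le> c" for c
    proof -
      have "ennreal (c / 2) * (\<integral>\<^sup>+s. ?R s \<partial>lborel) \<le> ennreal (c / 2) * ennreal r"
        by (intro mult_left_mono r) auto
      also have "\<dots> = ennreal (r / 2) * ennreal c" using that r0 by (simp add: ennreal_mult[symmetric])
      finally show ?thesis .
    qed
    show "ennreal ((cmod (G x))\<^sup>2 / 2) * (\<integral>\<^sup>+s. ?R s \<partial>lborel) \<le> ennreal (r / 2) * ennreal ((cmod (G x))\<^sup>2)" for x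
      by (rule *) simp
    show "ennreal ((cmod (G' x))\<^sup>2 / 2) * (\<integral>\<^sup>+s. ?R s \<partial>lborel) \<le> ennreal (r / 2) * ennreal ((cmod (G' x))\<^sup>2)" for x
      by (rule *) simp
  qed
  also have "\<dots> = ennreal (r / 2) * ennreal a + ennreal (r / 2) * ennreal a'"
    by (simp add: nn_integral_cmult nnG nnG')
  also have "\<dots> = ennreal (r / 2 * (a + a'))"
    using r0 a0 by (simp add: ennreal_mult[symmetric] distrib_left flip: ennreal_plus)
  finally have "cmod (\<integral>x. cnj (G x) * (\<integral>x'. G' x' * corr g k j (x' - x) \<partial>lborel) \<partial>lborel) \<le> r / 2 * (a + a')"
    using r0 a0 by (simp add: ennreal_le_iff)
  then show ?thesis by (simp add: r_def a_def a'_def)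
qed

text \<open>Mean zero makes different scales almost orthogonal: the pairing of the scales
  \<open>k\<close> and \<open>j\<close> decays like 2^(-|j-k|), and the sum of these factors over
  one index is at most 4, whatever \<open>T\<close> is.\<close>

lemma square_function_L2:
  assumes m: "molecule B g" and z: "(\<integral>u. g u \<partial>lborel) = 0"
    and f: "integrable lborel f" and fb: "\<And>x. cmod (f x) \<le> M" and T: "finite T"
  shows "(\<Sum>k\<in>T. \<integral>x. (cmod (conv f (dil k g) x))\<^sup>2 \<partial>lborel) \<le> (32 * B\<^sup>2 + 1) * (\<integral>x. (cmod (f x))\<^sup>2 \<partial>lborel)"
proof -
  have [measurable]: "f \<in> borel_measurable borel" "g \<in> borel_measurable borel"
    using f molecule_measurable[OF m] by auto
  have [measurable]: "dil i g \<in> borel_measurable borel" for i by measurable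
  have B: "0 \<le> B" by (rule molecule_nonneg[OF m])
  define G where "G k = conv f (dil k g)" for k
  define a where "a k = (\<integral>x. (cmod (G k x))\<^sup>2 \<partial>lborel)" for k
  \<comment> \<open>The complex conjugate of the adjoint of convolution with \<open>dil k g\<close>,
    applied to \<open>G k\<close>; pairing it with \<open>f\<close> gives back the squared norm of
    \<open>G k\<close>.\<close>
  define U where "U k y = (\<integral>x. cnj (G k x) * dil k g (x - y) \<partial>lborel)" for k y
  have GI: "integrable lborel (G k)" for k unfolding G_def by (intro integrable_conv f dil_integrable[OF m])
  have [measurable]: "G k \<in> borel_measurable borel" for k using GI[of k] by auto
  define MG where "MG k = 2 powr real_of_int k * B * (\<integral>y. cmod (f y) \<partial>lborel)" for k :: int
  have Gb: "cmod (G k x) \<le> MG k" for k x unfolding G_def MG_def by (rule norm_conv_dil_le[OF m f])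
  have GS: "integrable lborel (\<lambda>x. (cmod (G k x))\<^sup>2)" for k by (rule integrable_norm_square[OF GI Gb])
  have dI: "integrable lborel (\<lambda>z. dil k g (- z))" for k
    using lborel_integrable_real_affine[of "dil k g" "-1" 0] dil_integrable[OF m] by simp
  have U_conv: "U k = conv (\<lambda>x. cnj (G k x)) (\<lambda>z. dil k g (- z))" for k
    by (rule ext) (simp add: U_def conv_lborel)
  have UI: "integrable lborel (U k)" for k unfolding U_conv by (intro integrable_conv integrable_cnj GI dI)
  have [measurable]: "U k \<in> borel_measurable borel" for k using UI[of k] by auto
  have Ub: "\<exists>C. \<forall>y. cmod (U k y) \<le> C" for k
  proof (intro exI allI)
    fix y
    have I: "integrable lborel (\<lambda>x. cnj (G k x) * of_real (2 powr real_of_int k * B))"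
      by (intro integrable_mult_left integrable_cnj GI)
    have "cmod (U k y) \<le> (\<integral>x. cmod (cnj (G k x) * of_real (2 powr real_of_int k * B)) \<partial>lborel)"
      unfolding U_def
      by (rule Bochner_Integration.integral_norm_bound_integral)
         (use I GI dil_bounded[OF m, of k] in \<open>auto simp: norm_mult abs_mult B intro!: mult_left_mono Bochner_Integration.integrable_bound[OF I] AE_I2\<close>)
    then show "cmod (U k y) \<le> (\<integral>x. cmod (cnj (G k x) * of_real (2 powr real_of_int k * B)) \<partial>lborel)" .
  qed
  have UUI: "integrable lborel (\<lambda>y. U k y * cnj (U j y))" for k j
  proof -
    obtain C where C: "\<And>y. cmod (U k y) \<le> C" using Ub by blast
    have C0: "0 \<le> C" using C[of 0] norm_ge_zero order_trans by blast
    show ?thesis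
    proof (rule Bochner_Integration.integrable_bound)
      show "integrable lborel (\<lambda>y. complex_of_real C * U j y)" using UI by simp
      show "AE y in lborel. norm (U k y * cnj (U j y)) \<le> norm (complex_of_real C * U j y)"
        using C C0 by (intro AE_I2) (auto simp: norm_mult intro!: mult_right_mono)
    qed measurable
  qed
  have dualize: "complex_of_real (a k) = (\<integral>y. f y * U k y \<partial>lborel)" for k
  proof -
    have "complex_of_real (a k) = (\<integral>x. complex_of_real ((cmod (G k x))\<^sup>2) \<partial>lborel)"
      unfolding a_def by (rule integral_complex_of_real[symmetric])
    also have "\<dots> = (\<integral>x. cnj (G k x) * (\<integral>y. f y * dil k g (x - y) \<partial>lborel) \<partial>lborel)"
    proof (rule Bochner_Integration.integral_cong[OF refl])
      fix x
      have "G k x = (\<integral>y. f y * dil k g (x - y) \<partial>lborel)" unfolding G_def by (rule conv_lborel) measurable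
      moreover have "complex_of_real ((cmod (G k x))\<^sup>2) = cnj (G k x) * G k x"
        by (simp add: complex_norm_square mult.commute del: of_real_power)
      ultimately show "complex_of_real ((cmod (G k x))\<^sup>2) = cnj (G k x) * (\<integral>y. f y * dil k g (x - y) \<partial>lborel)" by simp
    qed
    also have "\<dots> = (\<integral>y. f y * U k y \<partial>lborel)"
      unfolding U_def
      by (intro integral_swap_bounded(1)[where B = "2 powr real_of_int k * B"] integrable_cnj GI f dil_bounded[OF m]) measurable
    finally show ?thesis .
  qed
  have cross: "cmod (\<integral>y. U k y * cnj (U j y) \<partial>lborel) \<le> 4 * B\<^sup>2 * 2 powr - \<bar>real_of_int (j - k)\<bar> * (a k + a j)" for k j
  proof -
    have "(\<integral>y. U k y * cnj (U j y) \<partial>lborel) = (\<integral>y. cnj (U j y) * (\<integral>x. cnj (G k x) * dil k g (x - y) \<partial>lborel) \<partial>lborel)"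
      by (simp add: U_def[of k] mult.commute)
    also have "\<dots> = (\<integral>x. cnj (G k x) * (\<integral>y. cnj (U j y) * dil k g (x - y) \<partial>lborel) \<partial>lborel)"
      by (intro integral_swap_bounded(1)[where B = "2 powr real_of_int k * B"] integrable_cnj GI UI dil_bounded[OF m]) measurable
    also have "\<dots> = (\<integral>x. cnj (G k x) * (\<integral>x'. G j x' * corr g k j (x' - x) \<partial>lborel) \<partial>lborel)"
    proof (rule Bochner_Integration.integral_cong[OF refl])
      fix x
      have dxI: "integrable lborel (\<lambda>y. dil k g (x - y))"
        using lborel_integrable_real_affine[of "dil k g" "-1" x] dil_integrable[OF m] by simp
      have "(\<integral>y. cnj (U j y) * dil k g (x - y) \<partial>lborel)
          = (\<integral>y. dil k g (x - y) * (\<integral>x'. G j x' * cnj (dil j g (x' - y)) \<partial>lborel) \<partial>lborel)"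
        unfolding U_def Bochner_Integration.integral_cnj[symmetric] by (simp add: mult.commute)
      also have "\<dots> = (\<integral>x'. G j x' * (\<integral>y. dil k g (x - y) * cnj (dil j g (x' - y)) \<partial>lborel) \<partial>lborel)"
        by (intro integral_swap_bounded(1)[where B = "2 powr real_of_int j * B"] dxI GI)
           (auto intro: dil_bounded[OF m])
      also have "\<dots> = (\<integral>x'. G j x' * corr g k j (x' - x) \<partial>lborel)"
      proof (rule Bochner_Integration.integral_cong[OF refl])
        fix x'
        show "G j x' * (\<integral>y. dil k g (x - y) * cnj (dil j g (x' - y)) \<partial>lborel) = G j x' * corr g k j (x' - x)"
          using lborel_integral_reflect[of "\<lambda>u. dil k g u * cnj (dil j g (x' - x + u))" x]
          by (simp add: corr_def)
      qed
      finally show "cnj (G k x) * (\<integral>y. cnj (U j y) * dil k g (x - y) \<partial>lborel)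
          = cnj (G k x) * (\<integral>x'. G j x' * corr g k j (x' - x) \<partial>lborel)" by simp
    qed
    finally show ?thesis
      unfolding a_def using cross_term_le[OF m z GI GI Gb Gb, of k j k j] by simp
  qed
  \<comment> \<open>TT* argument: \<open>A = \<integral> f H\<close> while \<open>\<integral> |H|^2\<close> is bounded by a multiple of \<open>A\<close>.\<close>
  define H where "H y = (\<Sum>k\<in>T. U k y)" for y
  define A where "A = (\<Sum>k\<in>T. a k)"
  have a0: "0 \<le> a k" for k by (simp add: a_def)
  have HI: "integrable lborel H" unfolding H_def[abs_def] using UI by simp
  have HH: "complex_of_real ((cmod (H y))\<^sup>2) = (\<Sum>k\<in>T. \<Sum>j\<in>T. U k y * cnj (U j y))" for y
    unfolding complex_norm_square H_def by (simp add: sum_product)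
  have HHI: "integrable lborel (\<lambda>y. complex_of_real ((cmod (H y))\<^sup>2))"
    unfolding HH using UUI by simp
  then have H2I: "integrable lborel (\<lambda>y. (cmod (H y))\<^sup>2)" by (simp only: complex_of_real_integrable_eq)
  have H2: "(\<integral>y. (cmod (H y))\<^sup>2 \<partial>lborel) \<le> 32 * B\<^sup>2 * A"
  proof -
    have "complex_of_real (\<integral>y. (cmod (H y))\<^sup>2 \<partial>lborel) = (\<Sum>k\<in>T. \<Sum>j\<in>T. \<integral>y. U k y * cnj (U j y) \<partial>lborel)"
      unfolding integral_complex_of_real[symmetric] HH using UUI by simp
    then have "\<bar>\<integral>y. (cmod (H y))\<^sup>2 \<partial>lborel\<bar> = cmod (\<Sum>k\<in>T. \<Sum>j\<in>T. \<integral>y. U k y * cnj (U j y) \<partial>lborel)"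
      by (metis norm_of_real)
    also have "\<dots> \<le> (\<Sum>k\<in>T. \<Sum>j\<in>T. cmod (\<integral>y. U k y * cnj (U j y) \<partial>lborel))"
      by (intro order_trans[OF norm_sum] sum_mono norm_sum)
    also have "\<dots> \<le> (\<Sum>k\<in>T. \<Sum>j\<in>T. 4 * B\<^sup>2 * 2 powr - \<bar>real_of_int (j - k)\<bar> * (a k + a j))"
      by (intro sum_mono cross)
    also have "\<dots> = (\<Sum>k\<in>T. \<Sum>j\<in>T. 4 * B\<^sup>2 * a k * 2 powr - \<bar>real_of_int (j - k)\<bar>)
        + (\<Sum>k\<in>T. \<Sum>j\<in>T. 4 * B\<^sup>2 * a j * 2 powr - \<bar>real_of_int (j - k)\<bar>)"
      by (simp add: sum.distrib[symmetric] algebra_simps)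
    also have "(\<Sum>k\<in>T. \<Sum>j\<in>T. 4 * B\<^sup>2 * a j * 2 powr - \<bar>real_of_int (j - k)\<bar>)
        = (\<Sum>j\<in>T. \<Sum>k\<in>T. 4 * B\<^sup>2 * a j * 2 powr - \<bar>real_of_int (k - j)\<bar>)"
      by (subst sum.swap) (simp add: abs_minus_commute)
    also have "(\<Sum>k\<in>T. \<Sum>j\<in>T. 4 * B\<^sup>2 * a k * 2 powr - \<bar>real_of_int (j - k)\<bar>)
        + (\<Sum>j\<in>T. \<Sum>k\<in>T. 4 * B\<^sup>2 * a j * 2 powr - \<bar>real_of_int (k - j)\<bar>)
        = 2 * (\<Sum>k\<in>T. 4 * B\<^sup>2 * a k * (\<Sum>j\<in>T. 2 powr - \<bar>real_of_int (j - k)\<bar>))"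
      by (simp add: sum_distrib_left)
    also have "\<dots> \<le> 2 * (\<Sum>k\<in>T. 4 * B\<^sup>2 * a k * 4)"
      using a0 by (intro mult_left_mono sum_mono sum_two_powr_dist_le T) auto
    also have "\<dots> = 32 * B\<^sup>2 * A" by (simp add: A_def sum_distrib_left sum_distrib_right mult_ac)
    finally show ?thesis by linarith
  qed
  \<comment> \<open>The summand 1 keeps \<open>C\<close> positive when \<open>B\<close> is 0, so
    that it can also serve as the weight in |f H| \<le> C/2 |f|^2 + |H|^2 / (2 C). With this weight
    the second term is at most A/2 and can be absorbed.\<close>
  define C where "C = 32 * B\<^sup>2 + 1"
  have C: "0 < C" by (simp add: C_def add_nonneg_pos)
  have fUI: "integrable lborel (\<lambda>y. f y * U k y)" for k
  proof -
    have M0: "0 \<le> M" using fb[of 0] norm_ge_zero order_trans by blast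
    show ?thesis
      by (rule Bochner_Integration.integrable_bound[OF integrable_mult_right[OF UI[of k], of "of_real M"]])
         (use fb M0 in \<open>auto simp: norm_mult intro!: mult_right_mono\<close>)
  qed
  have fS: "integrable lborel (\<lambda>x. (cmod (f x))\<^sup>2)" by (rule integrable_norm_square[OF f fb])
  have "complex_of_real A = (\<integral>y. f y * H y \<partial>lborel)"
    unfolding A_def H_def of_real_sum dualize sum_distrib_left
    using fUI by (intro Bochner_Integration.integral_sum[symmetric]) auto
  then have "\<bar>A\<bar> = cmod (\<integral>y. f y * H y \<partial>lborel)" by (metis norm_of_real)
  also have "\<dots> \<le> (\<integral>y. C / 2 * (cmod (f y))\<^sup>2 + 1 / (2 * C) * (cmod (H y))\<^sup>2 \<partial>lborel)"
  proof (rule Bochner_Integration.integral_norm_bound_integral)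
    show "integrable lborel (\<lambda>y. f y * H y)"
      unfolding H_def sum_distrib_left using fUI by simp
    show "integrable lborel (\<lambda>y. C / 2 * (cmod (f y))\<^sup>2 + 1 / (2 * C) * (cmod (H y))\<^sup>2)"
      using fS H2I by simp
    fix y
    have "0 \<le> (C * cmod (f y) - cmod (H y))\<^sup>2 / (2 * C)" using C by simp
    also have "\<dots> = C / 2 * (cmod (f y))\<^sup>2 + 1 / (2 * C) * (cmod (H y))\<^sup>2 - cmod (f y) * cmod (H y)"
      using C by (simp add: power2_eq_square field_simps)
    finally show "norm (f y * H y) \<le> C / 2 * (cmod (f y))\<^sup>2 + 1 / (2 * C) * (cmod (H y))\<^sup>2" by (simp add: norm_mult)
  qed
  also have "\<dots> = C / 2 * (\<integral>y. (cmod (f y))\<^sup>2 \<partial>lborel) + 1 / (2 * C) * (\<integral>y. (cmod (H y))\<^sup>2 \<partial>lborel)"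
    using fS H2I by simp
  also have "\<dots> \<le> C / 2 * (\<integral>y. (cmod (f y))\<^sup>2 \<partial>lborel) + 1 / (2 * C) * (C * A)"
  proof -
    have "A \<ge> 0" using a0 by (simp add: A_def sum_nonneg)
    then have "32 * B\<^sup>2 * A \<le> C * A" by (simp add: C_def distrib_right)
    then show ?thesis using H2 C by (intro add_left_mono mult_left_mono) auto
  qed
  also have "\<dots> = C / 2 * (\<integral>y. (cmod (f y))\<^sup>2 \<partial>lborel) + A / 2" using C by simp
  finally have "A \<le> C * (\<integral>y. (cmod (f y))\<^sup>2 \<partial>lborel)" by linarith
  then show ?thesis unfolding A_def C_def a_def G_def .
qed

section \<open>Heavy dyadic intervals and the exceptional set\<close>

text \<open>The index of the dyadic interval of length 2^(-k) that contains \<open>x\<close>.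
  Passing to an ancestor becomes integer division, which reduces all nesting arguments to
  arithmetic.\<close>

definition dy :: "int \<Rightarrow> real \<Rightarrow> int" where
  "dy k x = \<lfloor>2 powr real_of_int k * x\<rfloor>"

lemma mem_dyadic_I: "x \<in> dyadic_I k n \<longleftrightarrow> dy k x = n"
  unfolding dyadic_I_def dy_def floor_eq_iff by (auto simp: powr_minus field_simps)

lemma dyadic_I_borel [measurable]: "dyadic_I k n \<in> sets borel"
  unfolding dyadic_I_def by simp

lemma dy_measurable [measurable]: "dy k \<in> measurable borel (count_space UNIV)"
  unfolding dy_def[abs_def] by measurable

lemma dy_div: "dy (k - int p) x = dy k x div 2 ^ p"
proof -
  have "2 powr real_of_int (k - int p) * x = 2 powr real_of_int k * x / real_of_int (2 ^ p)"
    by (simp add: powr_diff powr_realpow)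
  then show ?thesis unfolding dy_def by (simp only: floor_divide_real_eq_div zero_le_power zero_le_numeral)
qed

lemma emeasure_dyadic_I: "emeasure lborel (dyadic_I k n) = ennreal (2 powr - real_of_int k)"
proof -
  have "2 powr - real_of_int k * real_of_int n \<le> 2 powr - real_of_int k * (real_of_int n + 1)"
    by (intro mult_left_mono) auto
  then show ?thesis unfolding dyadic_I_def by (simp add: algebra_simps)
qed

definition heavy :: "real set \<Rightarrow> real \<Rightarrow> int \<Rightarrow> int \<Rightarrow> bool" where
  "heavy F \<theta> k n \<longleftrightarrow> \<theta> * 2 powr - real_of_int k < measure lborel (F \<inter> dyadic_I k n)"

text \<open>The two neighbours are included so that every point of a heavy interval is at least the
  length of that interval away from the complement.\<close>

definition exceptional :: "real set \<Rightarrow> real \<Rightarrow> real set" where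
  "exceptional F \<theta> = {x. \<exists>k n. heavy F \<theta> k n \<and> \<bar>dy k x - n\<bar> \<le> 1}"

lemma neighbours_eq: "{x. \<bar>dy k x - n\<bar> \<le> 1} = dyadic_I k (n - 1) \<union> dyadic_I k n \<union> dyadic_I k (n + 1)"
  by (auto simp: mem_dyadic_I)

lemma exceptional_borel [measurable]: "exceptional F \<theta> \<in> sets borel"
proof -
  have "exceptional F \<theta> = (\<Union>k. \<Union>n. if heavy F \<theta> k n then {x. \<bar>dy k x - n\<bar> \<le> 1} else {})"
    by (auto simp: exceptional_def split: if_splits)
  then show ?thesis by (auto simp: neighbours_eq intro!: sets.countable_UN'')
qed

lemma emeasure_neighbours_le: "emeasure lborel {x. \<bar>dy k x - n\<bar> \<le> 1} \<le> ennreal (3 * 2 powr - real_of_int k)"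
proof -
  let ?K = "2 powr - real_of_int k"
  have "emeasure lborel {x. \<bar>dy k x - n\<bar> \<le> 1} \<le> emeasure lborel (dyadic_I k (n - 1)) + emeasure lborel (dyadic_I k n) + emeasure lborel (dyadic_I k (n + 1))"
    unfolding neighbours_eq
    by (intro order_trans[OF emeasure_subadditive] add_mono emeasure_subadditive order_refl) auto
  also have "\<dots> = ennreal (3 * ?K)"
    unfolding emeasure_dyadic_I by (simp flip: ennreal_plus)
  finally show ?thesis .
qed

context
  fixes F :: "real set" and \<theta> :: real
  assumes F[measurable]: "F \<in> sets borel" and Ff: "emeasure lborel F < \<infinity>" and \<theta>: "0 < \<theta>"
begin

lemma fmeasurable_Int_dyadic: "emeasure lborel (F \<inter> dyadic_I k n) = ennreal (measure lborel (F \<inter> dyadic_I k n))"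
proof -
  have "emeasure lborel (F \<inter> dyadic_I k n) \<le> emeasure lborel F" by (intro emeasure_mono) auto
  then show ?thesis using Ff by (intro emeasure_eq_ennreal_measure) auto
qed

lemma measure_Int_mono:
  assumes "A \<subseteq> B" "A \<in> sets borel" "B \<in> sets borel"
  shows "measure lborel (F \<inter> A) \<le> measure lborel (F \<inter> B)"
proof -
  have "emeasure lborel (F \<inter> B) \<le> emeasure lborel F" using assms by (intro emeasure_mono) auto
  then show ?thesis using assms Ff by (intro measure_mono_fmeasurable) (auto simp: fmeasurable_def)
qed

text \<open>A heavy interval is shorter than |F| / \<theta>. The resulting bound on \<open>p\<close>
  is what the existence of a greatest \<open>p\<close>, that is of a largest heavy ancestor, rests
  on.\<close>

lemma heavy_scale_bounded: "\<exists>b. \<forall>p n. heavy F \<theta> (k - int p) n \<longrightarrow> p \<le> b"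
proof (intro exI allI impI)
  let ?m = "measure lborel F"
  fix p n assume "heavy F \<theta> (k - int p) n"
  then have "\<theta> * 2 powr - real_of_int (k - int p) < measure lborel (F \<inter> dyadic_I (k - int p) n)"
    by (simp add: heavy_def)
  also have "\<dots> \<le> ?m" using measure_Int_mono[of "dyadic_I (k - int p) n" UNIV] by simp
  finally have "2 powr - real_of_int (k - int p) < ?m / \<theta>" using \<theta> by (simp add: field_simps)
  then have "2 powr - real_of_int (k - int p) * 2 powr real_of_int k < ?m / \<theta> * 2 powr real_of_int k"
    by (intro mult_strict_right_mono) auto
  moreover have "2 powr - real_of_int (k - int p) * 2 powr real_of_int k = 2 ^ p"
    by (simp add: powr_realpow flip: powr_add)
  ultimately have "2 ^ p < ?m / \<theta> * 2 powr real_of_int k" by (simp only:)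
  moreover have "real p < 2 ^ p" by (rule of_nat_less_two_power)
  ultimately show "p \<le> nat \<lceil>?m / \<theta> * 2 powr real_of_int k\<rceil>" by linarith
qed

text \<open>Covering by maximal heavy intervals. They are pairwise disjoint, and the triple of each
  has measure below 3 / \<theta> times the part of F inside it, so the sum telescopes into the
  measure of F.\<close>

lemma emeasure_exceptional_le: "emeasure lborel (exceptional F \<theta>) \<le> ennreal (3 / \<theta> * measure lborel F)"
proof -
  define mx where "mx k n \<longleftrightarrow> heavy F \<theta> k n \<and> (\<forall>p>0. \<not> heavy F \<theta> (k - int p) (n div 2 ^ p))" for k n
  have ex: "\<exists>p. mx (k - int p) (n div 2 ^ p)" if h: "heavy F \<theta> k n" for k n
  proof -
    obtain b where b: "\<And>p n. heavy F \<theta> (k - int p) n \<Longrightarrow> p \<le> b" using heavy_scale_bounded by blast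
    define P where "P p \<longleftrightarrow> heavy F \<theta> (k - int p) (n div 2 ^ p)" for p
    have P0: "P 0" using h by (simp add: P_def)
    have Pb: "P p \<Longrightarrow> p \<le> b" for p using b by (auto simp: P_def)
    define p where "p = (GREATEST p. P p)"
    have "P p" unfolding p_def by (rule GreatestI_nat[of P 0 b]) (use P0 Pb in auto)
    moreover have "\<not> P (p + q)" if "q > 0" for q
      using Greatest_le_nat[of P "p + q" b] Pb that unfolding p_def by auto
    ultimately have "mx (k - int p) (n div 2 ^ p)"
      unfolding mx_def P_def by (auto simp: zdiv_zmult2_eq[symmetric] power_add diff_diff_eq)
    then show ?thesis ..
  qed
  have inj: "k = k' \<and> n = n'" if "mx k n" "mx k' n'" "dy k x = n" "dy k' x = n'" for k n k' n' x
  proof -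
    have *: False if "mx k n" "mx k' n'" "dy k x = n" "dy k' x = n'" "k < k'" for k n k' n'
    proof -
      define p where "p = nat (k' - k)"
      have p: "p > 0" "k = k' - int p" using that by (auto simp: p_def)
      then have "n = n' div 2 ^ p" using that dy_div[of k' p x] by simp
      then show False using that p unfolding mx_def by metis
    qed
    show ?thesis using *[of k n k' n'] *[of k' n' k n] that by (cases k k' rule: linorder_cases) auto
  qed
  \<comment> \<open>Enumerates the pairs (k, n), so that countable subadditivity and additivity over
    sequences apply.\<close>
  obtain e :: "nat \<Rightarrow> int \<times> int" where e: "bij e"
  proof
    have "infinite (UNIV :: (int \<times> int) set)" by (simp add: finite_prod)
    then show "bij (from_nat_into (UNIV :: (int \<times> int) set))"
      by (intro bij_betw_from_nat_into) auto
  qed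
  define N where "N i = (case e i of (k, n) \<Rightarrow> if mx k n then {x. \<bar>dy k x - n\<bar> \<le> 1} else {})" for i
  define D where "D i = (case e i of (k, n) \<Rightarrow> if mx k n then F \<inter> dyadic_I k n else {})" for i
  have Nm: "N i \<in> sets lborel" for i by (auto simp: N_def neighbours_eq split: prod.splits)
  have Dm: "D i \<in> sets lborel" for i by (auto simp: D_def split: prod.splits)
  have sub: "exceptional F \<theta> \<subseteq> (\<Union>i. N i)"
  proof
    fix x assume "x \<in> exceptional F \<theta>"
    then obtain k n where h: "heavy F \<theta> k n" and x: "\<bar>dy k x - n\<bar> \<le> 1" by (auto simp: exceptional_def)
    obtain p where p: "mx (k - int p) (n div 2 ^ p)" using ex[OF h] by blast
    obtain i where i: "e i = (k - int p, n div 2 ^ p)" using e by (metis bij_pointE)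
    \<comment> \<open>Adjacent or equal intervals have adjacent or equal ancestors: the triple of an
      interval lies in the triple of its maximal ancestor.\<close>
    have "\<bar>dy k x div 2 ^ p - n div 2 ^ p\<bar> \<le> 1"
    proof -
      have *: "b div 2 ^ p \<le> a div 2 ^ p + 1" if "b \<le> a + 1" for a b :: int
      proof -
        have "b div 2 ^ p \<le> (a + 2 ^ p) div 2 ^ p" using that by (intro zdiv_mono1) (auto intro: order_trans)
        then show ?thesis by simp
      qed
      show ?thesis using *[of "dy k x" n] *[of n "dy k x"] x by linarith
    qed
    then have "x \<in> N i" using p i by (simp add: N_def dy_div)
    then show "x \<in> (\<Union>i. N i)" by blast
  qed
  have disj: "disjoint_family D"
    unfolding disjoint_family_on_def
  proof (intro ballI impI)
    fix i j :: nat assume ij: "i \<noteq> j"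
    show "D i \<inter> D j = {}"
    proof (rule ccontr)
      assume "D i \<inter> D j \<noteq> {}"
      then obtain x where x: "x \<in> D i" "x \<in> D j" by blast
      then have "e i = e j" using inj[of "fst (e i)" "snd (e i)" "fst (e j)" "snd (e j)" x]
        by (auto simp: D_def mem_dyadic_I split: prod.splits if_splits)
      then show False using ij e by (auto simp: bij_def inj_def)
    qed
  qed
  have le: "emeasure lborel (N i) \<le> ennreal (3 / \<theta>) * emeasure lborel (D i)" for i
  proof (cases "e i")
    case (Pair k n)
    show ?thesis
    proof (cases "mx k n")
      case True
      have "emeasure lborel (N i) \<le> ennreal (3 * 2 powr - real_of_int k)"
        using emeasure_neighbours_le Pair True by (simp add: N_def)
      also have "\<dots> \<le> ennreal (3 / \<theta> * measure lborel (F \<inter> dyadic_I k n))"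
        using True \<theta> by (intro ennreal_leI) (simp add: mx_def heavy_def field_simps)
      also have "\<dots> = ennreal (3 / \<theta>) * emeasure lborel (D i)"
        using \<theta> Pair True by (simp add: D_def fmeasurable_Int_dyadic ennreal_mult[symmetric])
      finally show ?thesis .
    qed (simp add: N_def Pair)
  qed
  have "emeasure lborel (exceptional F \<theta>) \<le> emeasure lborel (\<Union>i. N i)"
    using Nm by (intro emeasure_mono sub) auto
  also have "\<dots> \<le> (\<Sum>i. emeasure lborel (N i))" using Nm by (intro emeasure_subadditive_countably) auto
  also have "\<dots> \<le> (\<Sum>i. ennreal (3 / \<theta>) * emeasure lborel (D i))" by (intro suminf_le le) auto
  also have "\<dots> = ennreal (3 / \<theta>) * emeasure lborel (\<Union>i. D i)"
    using Dm disj by (subst suminf_emeasure[symmetric]) (auto intro: ennreal_suminf_cmult)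
  also have "\<dots> \<le> ennreal (3 / \<theta>) * emeasure lborel F"
    by (intro mult_left_mono emeasure_mono) (auto simp: D_def split: prod.splits if_splits)
  also have "\<dots> = ennreal (3 / \<theta> * measure lborel F)"
    using \<theta> Ff by (subst emeasure_eq_ennreal_measure) (auto simp: ennreal_mult[symmetric])
  finally show ?thesis .
qed

text \<open>The stopping interval of \<open>y\<close> is the largest heavy dyadic interval of length
  at least 2^(-K) containing \<open>y\<close>, or the interval of length 2^(-K) itself if there is
  none. Cutting off at \<open>K\<close> gives every point a stopping interval, so the decomposition
  has no remainder off the heavy set.\<close>

lemma stopping_scale_exists:
  obtains \<kappa> :: "real \<Rightarrow> int" where
    "\<kappa> \<in> measurable borel (count_space UNIV)"
    "\<And>y z. dy (\<kappa> y) z = dy (\<kappa> y) y \<Longrightarrow> \<kappa> z = \<kappa> y"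
    "\<And>y. \<kappa> y \<le> K"
    "\<And>y. measure lborel (F \<inter> dyadic_I (\<kappa> y) (dy (\<kappa> y) y)) \<le> 2 * \<theta> * 2 powr - real_of_int (\<kappa> y)"
    "\<And>y. \<kappa> y = K \<or> heavy F \<theta> (\<kappa> y) (dy (\<kappa> y) y)"
proof -
  define h where "h p y \<longleftrightarrow> heavy F \<theta> (K - int p) (dy (K - int p) y)" for p y
  obtain b where b: "\<And>p n. heavy F \<theta> (K - int p) n \<Longrightarrow> p \<le> b" using heavy_scale_bounded by blast
  have hb: "h p y \<Longrightarrow> p \<le> b" for p y using b by (auto simp: h_def)
  \<comment> \<open>Counts generations upwards from scale \<open>K\<close>, so the greatest
    \<open>p\<close> is the coarsest heavy ancestor. The alternative p = 0 is the default when no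
    ancestor is heavy.\<close>
  define P where "P y = (GREATEST p. p = 0 \<or> h p y)" for y
  have P1: "P y = 0 \<or> h (P y) y" for y
    unfolding P_def by (rule GreatestI_nat[of "\<lambda>p. p = 0 \<or> h p y" 0 b]) (use hb in auto)
  have P2: "\<not> h q y" if "P y < q" for q y
  proof
    assume "h q y"
    then have "q \<le> P y" unfolding P_def by (intro Greatest_le_nat[of _ _ b]) (use hb in auto)
    then show False using that by simp
  qed
  have Peq: "P y = p \<longleftrightarrow> (p = 0 \<or> h p y) \<and> (\<forall>q>p. \<not> h q y)" for y p
  proof
    assume R: "(p = 0 \<or> h p y) \<and> (\<forall>q>p. \<not> h q y)"
    show "P y = p" unfolding P_def by (rule Greatest_equality) (use R in \<open>auto simp: not_less[symmetric]\<close>)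
  qed (use P1 P2 in auto)
  have hm[measurable]: "Measurable.pred borel (h p)" for p
    unfolding h_def[abs_def] by measurable
  have Pm: "P \<in> measurable borel (count_space UNIV)"
  proof (rule measurable_count_space_eq2_countable[THEN iffD2], intro conjI ballI)
    fix p :: nat
    have "Measurable.pred borel (\<lambda>y. (p = 0 \<or> h p y) \<and> (\<forall>q>p. \<not> h q y))" by measurable
    then show "P -` {p} \<inter> space borel \<in> sets borel" by (simp add: pred_def Peq vimage_def)
  qed auto
  \<comment> \<open>Heaviness at generation \<open>P y\<close> or above depends only on the interval
    of generation \<open>P y\<close>. Points of one stopping interval therefore stop at the same
    scale.\<close>
  have agree: "h q z = h q y" if "dy (K - int (P y)) z = dy (K - int (P y)) y" "P y \<le> q" for q y z
  proof -
    have "dy (K - int q) w = dy (K - int (P y)) w div 2 ^ (q - P y)" for w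
      using dy_div[of "K - int (P y)" "q - P y" w] that(2) by (simp add: of_nat_diff)
    then show ?thesis using that(1) by (simp add: h_def)
  qed
  show ?thesis
  proof
    show "(\<lambda>y. K - int (P y)) \<in> measurable borel (count_space UNIV)" using Pm by measurable
    show "K - int (P z) = K - int (P y)" if "dy (K - int (P y)) z = dy (K - int (P y)) y" for y z
    proof -
      have "P z = P y" unfolding Peq using agree[OF that] P1[of y] P2[of y] by auto
      then show ?thesis by simp
    qed
    show "K - int (P y) \<le> K" for y by simp
    show "K - int (P y) = K \<or> heavy F \<theta> (K - int (P y)) (dy (K - int (P y)) y)" for y
      using P1[of y] by (auto simp: h_def)
    fix y
    let ?k = "K - int (P y)"
    have k1: "K - int (Suc (P y)) = ?k - int 1" by simp
    \<comment> \<open>The parent is not heavy by maximality and is twice as long; hence the density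
      bound with 2 * \<theta>.\<close>
    have "\<not> h (Suc (P y)) y" by (rule P2) simp
    then have "measure lborel (F \<inter> dyadic_I (?k - int 1) (dy (?k - int 1) y)) \<le> \<theta> * 2 powr - real_of_int (?k - int 1)"
      unfolding h_def heavy_def k1 by simp
    moreover have "dyadic_I ?k (dy ?k y) \<subseteq> dyadic_I (?k - int 1) (dy (?k - int 1) y)"
      unfolding subset_iff mem_dyadic_I dy_div by simp
    then have "measure lborel (F \<inter> dyadic_I ?k (dy ?k y)) \<le> measure lborel (F \<inter> dyadic_I (?k - int 1) (dy (?k - int 1) y))"
      by (intro measure_Int_mono) auto
    moreover have "2 powr - real_of_int (?k - int 1) = 2 * 2 powr - real_of_int ?k"
    proof -
      have "- real_of_int (?k - int 1) = 1 + - real_of_int ?k" by simp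
      then show ?thesis by (simp only: powr_add) simp
    qed
    ultimately show "measure lborel (F \<inter> dyadic_I ?k (dy ?k y)) \<le> 2 * \<theta> * 2 powr - real_of_int ?k"
      by simp
  qed
qed

end

text \<open>The neighbours of a heavy interval lie in \<open>E\<close>, so \<open>z\<close> keeps at
  least the interval's length from the complement; the triangle inequality moves this to
  \<open>x\<close>. The complement has to be nonempty since \<open>infdist\<close> to the empty set
  is 0.\<close>

lemma heavy_dist_le:
  assumes h: "heavy F \<theta> k (dy k z)" and sub: "exceptional F \<theta> \<subseteq> E" and ne: "- E \<noteq> {}"
  shows "2 powr - real_of_int k \<le> infdist x (- E) + \<bar>x - z\<bar>"
proof -
  have "2 powr - real_of_int k \<le> dist z w" if "w \<in> - E" for w
  proof -
    have "w \<notin> exceptional F \<theta>" using that sub by auto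
    then have "\<not> \<bar>dy k w - dy k z\<bar> \<le> 1" using h by (auto simp: exceptional_def)
    then have "\<bar>dy k w - dy k z\<bar> \<ge> 2" by linarith
    then have "\<bar>2 powr real_of_int k * w - 2 powr real_of_int k * z\<bar> \<ge> 1" unfolding dy_def by linarith
    then have "1 \<le> 2 powr real_of_int k * \<bar>w - z\<bar>" by (simp add: abs_mult flip: right_diff_distrib)
    then show ?thesis by (simp add: powr_minus field_simps dist_real_def abs_minus_commute)
  qed
  then have "2 powr - real_of_int k \<le> infdist z (- E)"
    using ne by (auto simp: infdist_notempty intro!: cINF_greatest)
  also have "\<dots> \<le> infdist x (- E) + dist z x" by (rule infdist_triangle)
  finally show ?thesis by (simp add: dist_real_def abs_minus_commute)
qed

section \<open>Stopping scales and the weighted square function\<close>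

text \<open>\<delta> stands for the distance to the complement of the exceptional set. Of the
  geometry only \<open>length_le\<close> is kept: a stopping interval that was not cut off at scale
  \<open>K\<close> is no longer than \<delta> at \<open>x\<close> plus the distance from
  \<open>x\<close> to any of its points.\<close>

locale stopping =
  fixes F :: "real set" and \<theta> :: real and K :: int and \<kappa> :: "real \<Rightarrow> int" and \<delta> :: "real \<Rightarrow> real"
  assumes F_borel [measurable]: "F \<in> sets borel" and F_finite: "emeasure lborel F < \<infinity>"
    and theta_pos: "0 < \<theta>"
    and kappa_measurable [measurable]: "\<kappa> \<in> measurable borel (count_space UNIV)"
    and kappa_eq: "\<And>y z. dy (\<kappa> y) z = dy (\<kappa> y) y \<Longrightarrow> \<kappa> z = \<kappa> y"
    and kappa_le: "\<And>y. \<kappa> y \<le> K"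
    and density_le: "\<And>y. measure lborel (F \<inter> dyadic_I (\<kappa> y) (dy (\<kappa> y) y)) \<le> 2 * \<theta> * 2 powr - real_of_int (\<kappa> y)"
    and delta_measurable [measurable]: "\<delta> \<in> borel_measurable borel"
    and delta_nonneg: "\<And>x. 0 \<le> \<delta> x"
    and length_le: "\<And>x y z. \<kappa> y \<noteq> K \<Longrightarrow> dy (\<kappa> y) z = dy (\<kappa> y) y \<Longrightarrow> 2 powr - real_of_int (\<kappa> y) \<le> \<delta> x + \<bar>x - z\<bar>"
begin

text \<open>The kernel of averaging over the stopping interval; its symmetry replaces sums over the intervals.\<close>

definition A :: "real \<Rightarrow> real \<Rightarrow> real" where
  "A y z = (if dy (\<kappa> y) z = dy (\<kappa> y) y then 2 powr real_of_int (\<kappa> y) else 0)"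

definition W :: "int \<Rightarrow> real \<Rightarrow> real" where
  "W k x = 1 + 2 powr real_of_int k * \<delta> x"

lemma W_ge1: "1 \<le> W k x"
  using delta_nonneg by (simp add: W_def)

lemma W_measurable [measurable]: "W k \<in> borel_measurable borel"
  unfolding W_def[abs_def] by measurable

lemma kappa_real [measurable]: "(\<lambda>y. real_of_int (\<kappa> y)) \<in> borel_measurable borel"
  by measurable

lemma A_measurable [measurable]: "(\<lambda>(y, z). A y z) \<in> borel_measurable (borel \<Otimes>\<^sub>M borel)"
  unfolding A_def dy_def by measurable

lemma A_measurable1 [measurable]: "A y \<in> borel_measurable borel"
  unfolding A_def dy_def by measurable

lemma A_sym: "A y z = A z y"
proof -
  have "A y z = A z y" if "dy (\<kappa> y) z = dy (\<kappa> y) y" for y z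
    using kappa_eq[OF that] that by (simp add: A_def)
  then show ?thesis unfolding A_def by metis
qed

lemma A_nonneg: "0 \<le> A y z" and A_le: "A y z \<le> 2 powr real_of_int K"
  using kappa_le by (auto simp: A_def)

lemma A_nz: "A y z \<noteq> 0 \<Longrightarrow> dy (\<kappa> y) z = dy (\<kappa> y) y"
  by (auto simp: A_def split: if_splits)

lemma A_indicator: "ennreal (A y z) = ennreal (2 powr real_of_int (\<kappa> y)) * indicator (dyadic_I (\<kappa> y) (dy (\<kappa> y) y)) z"
  by (auto simp: A_def mem_dyadic_I indicator_def)

lemma nn_integral_A: "(\<integral>\<^sup>+z. ennreal (A y z) \<partial>lborel) = 1"
proof -
  have "(\<integral>\<^sup>+z. ennreal (A y z) \<partial>lborel) = ennreal (2 powr real_of_int (\<kappa> y)) * ennreal (2 powr - real_of_int (\<kappa> y))"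
    unfolding A_indicator by (simp add: nn_integral_cmult emeasure_dyadic_I)
  also have "\<dots> = 1" by (simp add: ennreal_mult[symmetric] powr_minus)
  finally show ?thesis .
qed

lemma integrable_A: "integrable lborel (\<lambda>z. A y z)" and integral_A: "(\<integral>z. A y z \<partial>lborel) = 1"
  using nn_integral_A[of y] A_nonneg[of y]
  by (auto simp: integrable_iff_bounded integral_eq_nn_integral)

lemma nn_integral_density_le: "(\<integral>\<^sup>+y. indicator F y * ennreal (A y z) \<partial>lborel) \<le> ennreal (2 * \<theta>)"
proof -
  have "(\<integral>\<^sup>+y. indicator F y * ennreal (A y z) \<partial>lborel)
      = (\<integral>\<^sup>+y. ennreal (2 powr real_of_int (\<kappa> z)) * indicator (F \<inter> dyadic_I (\<kappa> z) (dy (\<kappa> z) z)) y \<partial>lborel)"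
    unfolding A_sym[of _ z] A_indicator
    by (intro nn_integral_cong) (auto simp: indicator_def)
  also have "\<dots> = ennreal (2 powr real_of_int (\<kappa> z)) * emeasure lborel (F \<inter> dyadic_I (\<kappa> z) (dy (\<kappa> z) z))"
    by (simp add: nn_integral_cmult)
  also have "\<dots> = ennreal (2 powr real_of_int (\<kappa> z) * measure lborel (F \<inter> dyadic_I (\<kappa> z) (dy (\<kappa> z) z)))"
    using fmeasurable_Int_dyadic[OF F_borel F_finite theta_pos] by (simp add: ennreal_mult)
  also have "\<dots> \<le> ennreal (2 powr real_of_int (\<kappa> z) * (2 * \<theta> * 2 powr - real_of_int (\<kappa> z)))"
    by (intro ennreal_leI mult_left_mono density_le) auto
  also have "\<dots> = ennreal (2 * \<theta>)" by (simp add: powr_minus field_simps)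
  finally show ?thesis .
qed

lemma emeasure_F: "emeasure lborel F = ennreal (measure lborel F)"
  using F_finite by (intro emeasure_eq_ennreal_measure) auto

text \<open>Everything is measured in units of 2^(-k): \<open>u\<close> and \<open>v\<close> are the
  positions of two points of one stopping interval relative to \<open>x\<close>, and
  \<open>t\<close> is its length. If the interval is longer than the unit, then \<kappa> y < k \<le>
  K and \<open>length_le\<close> bounds \<open>t\<close> through the weight; otherwise t \<le> 1 and
  the two positions are comparable.\<close>

lemma scaled_dist:
  fixes k x y z
  assumes A: "A y z \<noteq> 0" and k: "k \<le> K"
  defines "u \<equiv> 2 powr real_of_int k * (x - y)" and "v \<equiv> 2 powr real_of_int k * (x - z)"
    and "t \<equiv> 2 powr real_of_int (k - \<kappa> y)"
  shows "\<bar>u - v\<bar> \<le> t"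
    and "\<kappa> y < k \<Longrightarrow> 1 + t \<le> W k x + \<bar>u\<bar>" and "\<kappa> y < k \<Longrightarrow> 1 + t \<le> W k x + \<bar>v\<bar>"
    and "\<kappa> y < k \<Longrightarrow> 1 \<le> t" and "k \<le> \<kappa> y \<Longrightarrow> t \<le> 1"
proof -
  let ?k = "2 powr real_of_int k" and ?q = "2 powr real_of_int (\<kappa> y)"
  have eq: "dy (\<kappa> y) z = dy (\<kappa> y) y" by (rule A_nz[OF A])
  have t: "t = ?k * 2 powr - real_of_int (\<kappa> y)" by (simp add: t_def powr_diff powr_minus field_simps)
  have "\<bar>?q * z - ?q * y\<bar> \<le> 1" using eq unfolding dy_def by linarith
  then have "?q * \<bar>z - y\<bar> \<le> 1" by (simp add: abs_mult flip: right_diff_distrib)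
  then have "\<bar>z - y\<bar> \<le> 2 powr - real_of_int (\<kappa> y)" by (simp add: powr_minus field_simps)
  then have "?k * \<bar>z - y\<bar> \<le> t" unfolding t by (intro mult_left_mono) auto
  moreover have "u - v = ?k * (z - y)" by (simp add: u_def v_def algebra_simps)
  ultimately show "\<bar>u - v\<bar> \<le> t" by (simp add: abs_mult)
  have len: "1 + t \<le> W k x + \<bar>?k * (x - w)\<bar>" if "\<kappa> y < k" "dy (\<kappa> y) w = dy (\<kappa> y) y" for w
  proof -
    have "2 powr - real_of_int (\<kappa> y) \<le> \<delta> x + \<bar>x - w\<bar>" using that k by (intro length_le) auto
    then have "t \<le> ?k * (\<delta> x + \<bar>x - w\<bar>)" unfolding t by (intro mult_left_mono) auto
    then show ?thesis by (simp add: W_def distrib_left abs_mult)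
  qed
  show "1 + t \<le> W k x + \<bar>u\<bar>" if "\<kappa> y < k" unfolding u_def using len[OF that, of y] by simp
  show "1 + t \<le> W k x + \<bar>v\<bar>" if "\<kappa> y < k" unfolding v_def using len[OF that eq] .
  show "1 \<le> t" if "\<kappa> y < k" using that unfolding t_def by (intro ge_one_powr_ge_zero) auto
  show "t \<le> 1" if "k \<le> \<kappa> y" using that powr_mono[of "real_of_int (k - \<kappa> y)" 0 2] unfolding t_def by simp
qed

end

text \<open>Turns the additive bounds of \<open>scaled_dist\<close> into a product of the weight and
  1 + |u|, which can be raised to powers.\<close>

lemma sum_le_prod_ge1: "a + b \<le> 1 + a * b" if "1 \<le> a" "1 \<le> b" for a b :: real
proof -
  have "0 \<le> (a - 1) * (b - 1)" using that by simp
  then show ?thesis by (simp add: algebra_simps)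
qed

lemma tail_compare:
  fixes u v c :: real
  assumes "0 < c" "1 + \<bar>v\<bar> \<le> c * (1 + \<bar>u\<bar>)"
  shows "tail u \<le> c\<^sup>2 * tail v"
proof -
  have "(1 + \<bar>v\<bar>)\<^sup>2 \<le> (c * (1 + \<bar>u\<bar>))\<^sup>2" by (rule power_mono[OF assms(2)]) simp
  then have le: "(1 + \<bar>v\<bar>)\<^sup>2 \<le> c\<^sup>2 * (1 + \<bar>u\<bar>)\<^sup>2" by (simp only: power_mult_distrib)
  have aux: "1 / X \<le> d * (1 / Y)" if "0 < X" "0 < Y" "Y \<le> d * X" for X Y d :: real
    using that by (simp add: field_simps)
  show ?thesis unfolding tail_def by (rule aux[OF _ _ le]) (auto intro!: zero_less_power)
qed

context stopping
begin

text \<open>Within a stopping interval the tail may be evaluated at any point, at the price of the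
  square of the weight, because 1 + |v| \<le> 2 W (1 + |u|) in both regimes of
  \<open>scaled_dist\<close>.\<close>

lemma tail_average_pointwise:
  assumes A: "A y z \<noteq> 0" and k: "k \<le> K"
  shows "tail_k k (x - y) \<le> 4 * (W k x)\<^sup>2 * tail_k k (x - z)"
proof -
  define u where "u = 2 powr real_of_int k * (x - y)"
  define v where "v = 2 powr real_of_int k * (x - z)"
  define t where "t = 2 powr real_of_int (k - \<kappa> y)"
  note s = scaled_dist(1-3)[OF A k, of x, folded u_def v_def t_def] scaled_dist(4,5)[OF A k, folded t_def]
  have W1: "1 \<le> W k x" by (rule W_ge1)
  have vu: "\<bar>v\<bar> \<le> \<bar>u\<bar> + t" using s(1) by linarith
  have "1 + \<bar>v\<bar> \<le> 2 * W k x * (1 + \<bar>u\<bar>)"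
  proof (cases "\<kappa> y < k")
    case True
    have "1 + \<bar>v\<bar> \<le> W k x + 2 * \<bar>u\<bar>" using vu s(2)[OF True] by linarith
    also have "\<dots> \<le> 2 * (W k x + (1 + \<bar>u\<bar>) - 1)" using W1 by simp
    also have "\<dots> \<le> 2 * (W k x * (1 + \<bar>u\<bar>))"
      using sum_le_prod_ge1[OF W1, of "1 + \<bar>u\<bar>"] by simp
    finally show ?thesis by simp
  next
    case False
    then have "t \<le> 1" using s(5) by simp
    then have "1 + \<bar>v\<bar> \<le> 2 * (1 + \<bar>u\<bar>)" using vu by simp
    also have "\<dots> \<le> 2 * (W k x * (1 + \<bar>u\<bar>))" using mult_right_mono[OF W1, of "1 + \<bar>u\<bar>"] by simp
    finally show ?thesis by simp
  qed
  then have "tail u \<le> (2 * W k x)\<^sup>2 * tail v" using W1 by (intro tail_compare) auto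
  then have "2 powr real_of_int k * tail u \<le> 2 powr real_of_int k * ((2 * W k x)\<^sup>2 * tail v)"
    by (rule mult_left_mono) simp
  then show ?thesis unfolding tail_k_def u_def v_def by (simp add: power_mult_distrib mult_ac)
qed

text \<open>Insert 1 as the integral of \<open>A y z\<close> over \<open>z\<close>, move the tail
  from \<open>y\<close> to \<open>z\<close>, and integrate in \<open>y\<close> first to meet the
  density bound. The 16 is 4 for the move, 2 from the density and 2 from the mass of the
  tail.\<close>

lemma nn_integral_tail_le:
  assumes k: "k \<le> K"
  shows "(\<integral>\<^sup>+y. indicator F y * ennreal (tail_k k (x - y)) \<partial>lborel) \<le> ennreal (16 * \<theta> * (W k x)\<^sup>2)"
proof -
  define c where "c = 4 * (W k x)\<^sup>2"
  have c0: "0 \<le> c" by (simp add: c_def)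
  have "(\<integral>\<^sup>+y. indicator F y * ennreal (tail_k k (x - y)) \<partial>lborel)
     = (\<integral>\<^sup>+y. indicator F y * ennreal (tail_k k (x - y)) * (\<integral>\<^sup>+z. ennreal (A y z) \<partial>lborel) \<partial>lborel)"
    by (simp add: nn_integral_A)
  also have "\<dots> = (\<integral>\<^sup>+y. \<integral>\<^sup>+z. indicator F y * ennreal (tail_k k (x - y)) * ennreal (A y z) \<partial>lborel \<partial>lborel)"
    by (intro nn_integral_cong nn_integral_cmult[symmetric]) measurable
  also have "\<dots> \<le> (\<integral>\<^sup>+y. \<integral>\<^sup>+z. ennreal (c * tail_k k (x - z)) * (indicator F y * ennreal (A y z)) \<partial>lborel \<partial>lborel)"
  proof (intro nn_integral_mono)
    fix y z
    show "indicator F y * ennreal (tail_k k (x - y)) * ennreal (A y z) \<le> ennreal (c * tail_k k (x - z)) * (indicator F y * ennreal (A y z))"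
    proof (cases "A y z = 0")
      case False
      then have "ennreal (tail_k k (x - y)) \<le> ennreal (c * tail_k k (x - z))"
        unfolding c_def by (intro ennreal_leI tail_average_pointwise k)
      then have "ennreal (tail_k k (x - y)) * (indicator F y * ennreal (A y z)) \<le> ennreal (c * tail_k k (x - z)) * (indicator F y * ennreal (A y z))"
        by (rule mult_right_mono) simp
      then show ?thesis by (simp add: mult_ac)
    qed simp
  qed
  also have "\<dots> = (\<integral>\<^sup>+z. \<integral>\<^sup>+y. ennreal (c * tail_k k (x - z)) * (indicator F y * ennreal (A y z)) \<partial>lborel \<partial>lborel)"
    by (rule lborel_pair.Fubini'[symmetric]) measurable
  also have "\<dots> = (\<integral>\<^sup>+z. ennreal (c * tail_k k (x - z)) * (\<integral>\<^sup>+y. indicator F y * ennreal (A y z) \<partial>lborel) \<partial>lborel)"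
    by (intro nn_integral_cong nn_integral_cmult) measurable
  also have "\<dots> \<le> (\<integral>\<^sup>+z. ennreal (c * tail_k k (x - z)) * ennreal (2 * \<theta>) \<partial>lborel)"
    by (intro nn_integral_mono mult_left_mono nn_integral_density_le) auto
  also have "\<dots> = (\<integral>\<^sup>+z. ennreal (c * (2 * \<theta>)) * ennreal (tail_k k (x - z)) \<partial>lborel)"
    using c0 theta_pos tail_k_nonneg by (intro nn_integral_cong) (simp add: ennreal_mult[symmetric] mult_ac)
  also have "\<dots> = ennreal (c * (2 * \<theta>)) * ennreal 2"
    by (simp add: nn_integral_cmult nn_integral_tail_k_reflect)
  also have "\<dots> = ennreal (16 * \<theta> * (W k x)\<^sup>2)"
    using c0 theta_pos by (subst ennreal_mult[symmetric]) (auto simp: c_def mult_ac)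
  finally show ?thesis .
qed

text \<open>On stopping intervals of length at most 2^(-k) the Lipschitz bound yields the factor t =
  2^(k - \<kappa> y). On longer ones nothing cancels: both values are estimated separately, and the
  factor 1/t comes from weight and decay together, since the weight times 1 + |u|, or 1 + |v|, is at
  least \<open>t\<close>. The 5 is 1 for \<open>g v\<close> plus 4 for \<open>g u\<close>.\<close>

lemma cancellation_pointwise:
  assumes A: "A y z \<noteq> 0" and k: "k \<le> K" and m: "molecule B g"
  shows "cmod (dil k g (x - y) - dil k g (x - z)) / (W k x) ^ 3
      \<le> 5 * B * 2 powr - \<bar>real_of_int (k - \<kappa> y)\<bar> * tail_k k (x - z)"
proof -
  define u where "u = 2 powr real_of_int k * (x - y)"
  define v where "v = 2 powr real_of_int k * (x - z)"
  define t where "t = 2 powr real_of_int (k - \<kappa> y)"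
  define w where "w = W k x"
  note s = scaled_dist(1-3)[OF A k, of x, folded u_def v_def t_def w_def] scaled_dist(4,5)[OF A k, folded t_def]
  have w1: "1 \<le> w" unfolding w_def by (rule W_ge1)
  have w3: "1 \<le> w ^ 3" using w1 by (rule one_le_power)
  have B: "0 \<le> B" by (rule molecule_nonneg[OF m])
  have "cmod (g u - g v) / w ^ 3 \<le> 5 * B * 2 powr - \<bar>real_of_int (k - \<kappa> y)\<bar> * tail v"
  proof (cases "\<kappa> y < k")
    case False
    then have t1: "t \<le> 1" using s(5) by simp
    have te: "2 powr - \<bar>real_of_int (k - \<kappa> y)\<bar> = t" using False by (simp add: t_def)
    have "cmod (g u - g v) / w ^ 3 \<le> cmod (g u - g v) / 1"
      using w3 w1 by (intro divide_left_mono) auto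
    also have "\<dots> \<le> B * \<bar>u - v\<bar> * tail v" using m s(1) t1 by (simp add: molecule_def)
    also have "\<dots> \<le> B * t * tail v"
      using s(1) B tail_nonneg by (intro mult_right_mono mult_left_mono) auto
    also have "\<dots> \<le> 5 * B * t * tail v"
      using B tail_nonneg by (intro mult_right_mono) (auto simp: t_def)
    finally show ?thesis unfolding te .
  next
    case True
    have t1: "1 \<le> t" by (rule s(4)[OF True])
    have te: "2 powr - \<bar>real_of_int (k - \<kappa> y)\<bar> = 1 / t"
      using True by (simp add: t_def powr_minus inverse_eq_divide powr_diff)
    have key: "t \<le> w * (1 + \<bar>a\<bar>)" if "1 + t \<le> w + \<bar>a\<bar>" for a
      using sum_le_prod_ge1[OF w1, of "1 + \<bar>a\<bar>"] that by simp
    have tv: "t \<le> w * (1 + \<bar>v\<bar>)" and tu: "t \<le> w * (1 + \<bar>u\<bar>)"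
      using key s(2,3)[OF True] by auto
    have gv: "cmod (g v) / w ^ 3 \<le> B * tail v / t"
    proof -
      have "cmod (g v) / w ^ 3 \<le> B / (1 + \<bar>v\<bar>) ^ 3 / w ^ 3"
        using w1 by (intro divide_right_mono molecule_decay[OF m]) auto
      also have "\<dots> \<le> B / (1 + \<bar>v\<bar>) ^ 3 / w ^ 1"
        using w1 B by (intro divide_left_mono power_increasing) (auto intro!: mult_pos_pos)
      also have "\<dots> = B * tail v / (w * (1 + \<bar>v\<bar>))"
        by (simp add: tail_def power2_eq_square power3_eq_cube mult_ac)
      also have "\<dots> \<le> B * tail v / t"
        using tv t1 w1 B tail_nonneg by (intro divide_left_mono) (auto intro!: mult_pos_pos)
      finally show ?thesis .
    qed
    \<comment> \<open>Decay of order 5 is split as 3 + 2: three powers join \<open>w ^ 3\<close> to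
      give \<open>t ^ 3\<close>, the other two form \<open>tail u\<close>. Moving that tail to
      \<open>v\<close> costs \<open>(2 * t) ^ 2\<close>, which leaves one power of \<open>t\<close>.
      This is the origin of the exponent 3 of the weight.\<close>
    have gu: "cmod (g u) / w ^ 3 \<le> 4 * (B * tail v / t)"
    proof -
      have "cmod (g u) / w ^ 3 \<le> B / (1 + \<bar>u\<bar>) ^ 5 / w ^ 3"
        using w1 by (intro divide_right_mono molecule_decay[OF m]) auto
      also have "\<dots> = B * tail u / (w * (1 + \<bar>u\<bar>)) ^ 3"
        by (simp add: tail_def power_mult_distrib mult_ac flip: power_add)
      also have "\<dots> \<le> B * tail u / t ^ 3"
        using tu t1 w1 B tail_nonneg by (intro divide_left_mono power_mono) (auto intro!: mult_pos_pos zero_less_power)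
      also have "\<dots> \<le> B * ((2 * t)\<^sup>2 * tail v) / t ^ 3"
      proof -
        have "t + (1 + \<bar>u\<bar>) \<le> t * (1 + \<bar>u\<bar>) + t * (1 + \<bar>u\<bar>)"
          using mult_right_mono[OF t1, of "1 + \<bar>u\<bar>"] mult_left_mono[of 1 "1 + \<bar>u\<bar>" t] t1 by (intro add_mono) auto
        then have "1 + \<bar>v\<bar> \<le> 2 * t * (1 + \<bar>u\<bar>)" using s(1) by linarith
        then have "tail u \<le> (2 * t)\<^sup>2 * tail v" using t1 by (intro tail_compare) auto
        then show ?thesis using B t1 by (intro divide_right_mono mult_left_mono) auto
      qed
      also have "\<dots> = 4 * (B * tail v / t)" using t1 by (simp add: power2_eq_square power3_eq_cube)
      finally show ?thesis .
    qed
    have "cmod (g u - g v) / w ^ 3 \<le> (cmod (g u) + cmod (g v)) / w ^ 3"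
      using w1 by (intro divide_right_mono norm_triangle_ineq4) auto
    also have "\<dots> \<le> 5 * (B * tail v / t)" using gu gv by (simp add: add_divide_distrib)
    finally show ?thesis unfolding te by (simp add: mult_ac)
  qed
  then have "2 powr real_of_int k * (cmod (g u - g v) / w ^ 3)
     \<le> 2 powr real_of_int k * (5 * B * 2 powr - \<bar>real_of_int (k - \<kappa> y)\<bar> * tail v)"
    by (rule mult_left_mono) simp
  moreover have "cmod (dil k g (x - y) - dil k g (x - z)) = 2 powr real_of_int k * cmod (g u - g v)"
    unfolding dil_def u_def v_def by (simp add: norm_mult flip: right_diff_distrib)
  ultimately show ?thesis unfolding w_def tail_k_def v_def by (simp add: mult_ac)
qed

end

section \<open>The Calderon-Zygmund splitting\<close>

context stopping
begin

text \<open>The good part: since \<open>A\<close> is symmetric, this is the average of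
  \<open>f\<close> over the stopping interval of \<open>z\<close>. The bad part
  \<open>f - avg f\<close> has mean zero on every stopping interval.\<close>

definition avg :: "(real \<Rightarrow> complex) \<Rightarrow> real \<Rightarrow> complex" where
  "avg f z = (\<integral>y. f y * complex_of_real (A y z) \<partial>lborel)"

context
  fixes f :: "real \<Rightarrow> complex"
  assumes f_borel [measurable]: "f \<in> borel_measurable borel" and f_le: "\<And>x. cmod (f x) \<le> indicator F x"
begin

lemma f_ennreal: "ennreal (cmod (f y)) \<le> indicator F y"
  using f_le[of y] by (cases "y \<in> F") auto

lemma f_integrable: "integrable lborel f"
  by (rule integrable_le_indicator[OF f_borel F_borel F_finite f_le])

lemma f_le_1: "cmod (f x) \<le> 1"
  using f_le[of x] by (cases "x \<in> F") auto

lemma avg_measurable [measurable]: "avg f \<in> borel_measurable borel"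
  unfolding avg_def[abs_def] by measurable

lemma nn_norm_avg_le: "ennreal (cmod (avg f z)) \<le> (\<integral>\<^sup>+y. indicator F y * ennreal (A y z) \<partial>lborel)"
proof -
  have "ennreal (cmod (avg f z)) \<le> (\<integral>\<^sup>+y. ennreal (norm (f y * complex_of_real (A y z))) \<partial>lborel)"
    unfolding avg_def by (rule norm_integral_le_nn_integral)
  also have "\<dots> = (\<integral>\<^sup>+y. ennreal (cmod (f y)) * ennreal (A y z) \<partial>lborel)"
    using A_nonneg by (simp add: norm_mult ennreal_mult)
  also have "\<dots> \<le> (\<integral>\<^sup>+y. indicator F y * ennreal (A y z) \<partial>lborel)"
    by (intro nn_integral_mono mult_right_mono f_ennreal) auto
  finally show ?thesis .
qed

lemma avg_le: "cmod (avg f z) \<le> 2 * \<theta>"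
  using order_trans[OF nn_norm_avg_le nn_integral_density_le] theta_pos by (simp add: ennreal_le_iff)

lemma nn_integral_avg_le: "(\<integral>\<^sup>+z. ennreal (cmod (avg f z)) \<partial>lborel) \<le> ennreal (measure lborel F)"
proof -
  have "(\<integral>\<^sup>+z. ennreal (cmod (avg f z)) \<partial>lborel) \<le> (\<integral>\<^sup>+z. \<integral>\<^sup>+y. indicator F y * ennreal (A y z) \<partial>lborel \<partial>lborel)"
    by (intro nn_integral_mono nn_norm_avg_le)
  also have "\<dots> = (\<integral>\<^sup>+y. \<integral>\<^sup>+z. indicator F y * ennreal (A y z) \<partial>lborel \<partial>lborel)"
    by (rule lborel_pair.Fubini') measurable
  also have "\<dots> = (\<integral>\<^sup>+y. indicator F y * (\<integral>\<^sup>+z. ennreal (A y z) \<partial>lborel) \<partial>lborel)"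
    by (intro nn_integral_cong nn_integral_cmult) measurable
  also have "\<dots> = ennreal (measure lborel F)" by (simp add: nn_integral_A emeasure_F)
  finally show ?thesis .
qed

lemma avg_integrable: "integrable lborel (avg f)"
  using nn_integral_avg_le by (intro integrableI_bounded) (auto intro: le_less_trans)

lemma integral_avg_square_le: "(\<integral>z. (cmod (avg f z))\<^sup>2 \<partial>lborel) \<le> 2 * \<theta> * measure lborel F"
proof -
  have "(\<integral>z. (cmod (avg f z))\<^sup>2 \<partial>lborel) \<le> (\<integral>z. 2 * \<theta> * cmod (avg f z) \<partial>lborel)"
  proof (rule integral_mono)
    show "integrable lborel (\<lambda>z. (cmod (avg f z))\<^sup>2)" by (rule integrable_norm_square[OF avg_integrable avg_le])
    show "integrable lborel (\<lambda>z. 2 * \<theta> * cmod (avg f z))" using avg_integrable by simp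
    show "(cmod (avg f z))\<^sup>2 \<le> 2 * \<theta> * cmod (avg f z)" for z
      unfolding power2_eq_square by (intro mult_right_mono avg_le) simp
  qed
  also have "\<dots> = 2 * \<theta> * (\<integral>z. cmod (avg f z) \<partial>lborel)" by simp
  also have "(\<integral>z. cmod (avg f z) \<partial>lborel) \<le> measure lborel F"
  proof -
    have "ennreal (\<integral>z. cmod (avg f z) \<partial>lborel) \<le> ennreal (measure lborel F)"
      using nn_integral_avg_le avg_integrable by (subst nn_integral_eq_integral[symmetric]) auto
    then show ?thesis by (simp add: ennreal_le_iff)
  qed
  finally show ?thesis using theta_pos by simp
qed

text \<open>A majorant for the weighted bad part that depends on \<open>f\<close> only through
  \<open>F\<close>. It takes values in \<open>ennreal\<close>, so the order of integration can be
  changed freely, and its factor 2^(-|k - \<kappa> y|) is summable over the scales.\<close>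

definition err :: "real \<Rightarrow> int \<Rightarrow> real \<Rightarrow> ennreal" where
  "err B k x = (\<integral>\<^sup>+y. \<integral>\<^sup>+z. ennreal (5 * B * 2 powr - \<bar>real_of_int (k - \<kappa> y)\<bar> * tail_k k (x - z))
      * (indicator F y * ennreal (A y z)) \<partial>lborel \<partial>lborel)"

lemma err_measurable [measurable]: "err B k \<in> borel_measurable borel"
  unfolding err_def[abs_def] by measurable

text \<open>Because \<open>A y\<close> has integral 1, the bad part is the integral of
  \<open>f y\<close> times the average over \<open>z\<close> of the difference of the kernel at
  \<open>x - y\<close> and \<open>x - z\<close>; \<open>cancellation_pointwise\<close> applies
  inside.\<close>

lemma bad_part_le:
  assumes m: "molecule B g" and k: "k \<le> K"
  shows "ennreal (cmod (conv f (dil k g) x - conv (avg f) (dil k g) x) / (W k x) ^ 3) \<le> err B k x"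
proof -
  have [measurable]: "g \<in> borel_measurable borel" by (rule molecule_measurable[OF m])
  have [measurable]: "dil k g \<in> borel_measurable borel" by measurable
  have W3: "0 < (W k x) ^ 3" using W_ge1[of k x] by simp
  have dxI: "integrable lborel (\<lambda>y. dil k g (x - y))"
    using lborel_integrable_real_affine[of "dil k g" "-1" x] dil_integrable[OF m] by simp
  define q where "q y = (\<integral>z. dil k g (x - z) * complex_of_real (A y z) \<partial>lborel)" for y
  have Ab: "cmod (complex_of_real (A y z)) \<le> 2 powr real_of_int K" for y z
    using A_le A_nonneg by simp
  have c1: "conv f (dil k g) x = (\<integral>y. f y * dil k g (x - y) \<partial>lborel)" by (rule conv_lborel) measurable
  have c2: "conv (avg f) (dil k g) x = (\<integral>y. f y * q y \<partial>lborel)"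
  proof -
    have "conv (avg f) (dil k g) x = (\<integral>z. dil k g (x - z) * (\<integral>y. f y * complex_of_real (A y z) \<partial>lborel) \<partial>lborel)"
      by (subst conv_lborel) (auto simp: avg_def mult.commute)
    also have "\<dots> = (\<integral>y. f y * q y \<partial>lborel)" unfolding q_def
      by (rule integral_swap_bounded(1)[OF dxI f_integrable _ Ab]) measurable
    finally show ?thesis .
  qed
  have I1: "integrable lborel (\<lambda>y. f y * dil k g (x - y))"
    by (rule Bochner_Integration.integrable_bound[OF dxI])
       (use f_le_1 in \<open>auto simp: norm_mult intro!: AE_I2 mult_left_le_one_le\<close>)
  have I2: "integrable lborel (\<lambda>y. f y * q y)" unfolding q_def
    by (rule integral_swap_bounded(2)[OF f_integrable dxI _ Ab]) measurable
  have qd: "dil k g (x - y) - q y = (\<integral>z. (dil k g (x - y) - dil k g (x - z)) * complex_of_real (A y z) \<partial>lborel)" for y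
  proof -
    have J1: "integrable lborel (\<lambda>z. dil k g (x - y) * complex_of_real (A y z))"
      using integrable_A[of y] by (intro integrable_mult_right integrable_of_real)
    have J2: "integrable lborel (\<lambda>z. dil k g (x - z) * complex_of_real (A y z))"
      by (rule Bochner_Integration.integrable_bound[OF integrable_mult_left[OF dxI, of "of_real (2 powr real_of_int K)"]])
         (use Ab[of y] in \<open>auto simp: norm_mult intro!: AE_I2 mult_left_mono\<close>)
    have "(\<integral>z. dil k g (x - y) * complex_of_real (A y z) \<partial>lborel) = dil k g (x - y)"
      by (simp add: integral_A)
    then have "dil k g (x - y) - q y = (\<integral>z. dil k g (x - y) * complex_of_real (A y z) \<partial>lborel) - q y" by simp
    also have "\<dots> = (\<integral>z. dil k g (x - y) * complex_of_real (A y z) - dil k g (x - z) * complex_of_real (A y z) \<partial>lborel)"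
      unfolding q_def by (rule Bochner_Integration.integral_diff[OF J1 J2, symmetric])
    finally show ?thesis by (simp add: left_diff_distrib)
  qed
  have qm[measurable]: "q \<in> borel_measurable borel" unfolding q_def[abs_def] by measurable
  let ?w = "ennreal (1 / (W k x) ^ 3)"
  have "conv f (dil k g) x - conv (avg f) (dil k g) x = (\<integral>y. f y * (dil k g (x - y) - q y) \<partial>lborel)"
    unfolding c1 c2 Bochner_Integration.integral_diff[OF I1 I2, symmetric] by (simp add: right_diff_distrib)
  then have "ennreal (cmod (conv f (dil k g) x - conv (avg f) (dil k g) x))
      \<le> (\<integral>\<^sup>+y. ennreal (cmod (f y * (dil k g (x - y) - q y))) \<partial>lborel)" by (simp add: norm_integral_le_nn_integral)
  also have "\<dots> = (\<integral>\<^sup>+y. ennreal (cmod (f y)) * ennreal (cmod (dil k g (x - y) - q y)) \<partial>lborel)"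
    by (simp add: norm_mult ennreal_mult)
  also have "\<dots> \<le> (\<integral>\<^sup>+y. indicator F y * (\<integral>\<^sup>+z. ennreal (cmod (dil k g (x - y) - dil k g (x - z)) * A y z) \<partial>lborel) \<partial>lborel)"
  proof (intro nn_integral_mono mult_mono f_ennreal)
    fix y
    show "ennreal (cmod (dil k g (x - y) - q y)) \<le> (\<integral>\<^sup>+z. ennreal (cmod (dil k g (x - y) - dil k g (x - z)) * A y z) \<partial>lborel)"
      unfolding qd by (rule order_trans[OF norm_integral_le_nn_integral]) (simp add: norm_mult A_nonneg)
  qed auto
  finally have 1: "ennreal (cmod (conv f (dil k g) x - conv (avg f) (dil k g) x))
     \<le> (\<integral>\<^sup>+y. indicator F y * (\<integral>\<^sup>+z. ennreal (cmod (dil k g (x - y) - dil k g (x - z)) * A y z) \<partial>lborel) \<partial>lborel)" .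
  have "ennreal (cmod (conv f (dil k g) x - conv (avg f) (dil k g) x) / (W k x) ^ 3)
      = ?w * ennreal (cmod (conv f (dil k g) x - conv (avg f) (dil k g) x))"
    using W3 by (simp add: ennreal_mult[symmetric])
  also have "\<dots> \<le> ?w * (\<integral>\<^sup>+y. indicator F y * (\<integral>\<^sup>+z. ennreal (cmod (dil k g (x - y) - dil k g (x - z)) * A y z) \<partial>lborel) \<partial>lborel)"
    by (rule mult_left_mono[OF 1]) simp
  also have "\<dots> = (\<integral>\<^sup>+y. \<integral>\<^sup>+z. ?w * (indicator F y * ennreal (cmod (dil k g (x - y) - dil k g (x - z)) * A y z)) \<partial>lborel \<partial>lborel)"
    by (simp add: nn_integral_cmult)
  also have "\<dots> \<le> err B k x"
    unfolding err_def
  proof (intro nn_integral_mono)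
    fix y z
    show "?w * (indicator F y * ennreal (cmod (dil k g (x - y) - dil k g (x - z)) * A y z))
      \<le> ennreal (5 * B * 2 powr - \<bar>real_of_int (k - \<kappa> y)\<bar> * tail_k k (x - z)) * (indicator F y * ennreal (A y z))"
    proof (cases "A y z = 0")
      case False
      let ?d = "cmod (dil k g (x - y) - dil k g (x - z))"
      have "?w * (indicator F y * ennreal (?d * A y z)) = (?w * ennreal ?d) * (indicator F y * ennreal (A y z))"
        using A_nonneg by (simp add: ennreal_mult mult_ac)
      also have "?w * ennreal ?d = ennreal (?d / (W k x) ^ 3)"
        using W3 by (simp add: ennreal_mult[symmetric])
      also have "\<dots> * (indicator F y * ennreal (A y z))
        \<le> ennreal (5 * B * 2 powr - \<bar>real_of_int (k - \<kappa> y)\<bar> * tail_k k (x - z)) * (indicator F y * ennreal (A y z))"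
        by (intro mult_right_mono ennreal_leI cancellation_pointwise[OF False k m]) auto
      finally show ?thesis .
    qed simp
  qed
  finally show ?thesis .
qed

text \<open>The supremum half of an L2 estimate: the sum over the scales of the integrals of
  \<open>err\<close> squared is at most this bound times the L1 bound of
  \<open>sum_nn_integral_err_le\<close>, that is of order \<theta> |F|.\<close>

lemma err_le:
  assumes B: "0 \<le> B"
  shows "err B k x \<le> ennreal (20 * B * \<theta>)"
proof -
  have "err B k x \<le> (\<integral>\<^sup>+y. \<integral>\<^sup>+z. ennreal (5 * B * tail_k k (x - z)) * (indicator F y * ennreal (A y z)) \<partial>lborel \<partial>lborel)"
    unfolding err_def
  proof (intro nn_integral_mono)
    fix y z
    have "2 powr - \<bar>real_of_int (k - \<kappa> y)\<bar> \<le> 2 powr 0" by (rule powr_mono) auto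
    then have "5 * B * 2 powr - \<bar>real_of_int (k - \<kappa> y)\<bar> \<le> 5 * B * 1" using B by (intro mult_left_mono) auto
    then have "5 * B * 2 powr - \<bar>real_of_int (k - \<kappa> y)\<bar> * tail_k k (x - z) \<le> 5 * B * 1 * tail_k k (x - z)"
      by (rule mult_right_mono) (rule tail_k_nonneg)
    then show "ennreal (5 * B * 2 powr - \<bar>real_of_int (k - \<kappa> y)\<bar> * tail_k k (x - z)) * (indicator F y * ennreal (A y z))
        \<le> ennreal (5 * B * tail_k k (x - z)) * (indicator F y * ennreal (A y z))"
      by (intro mult_right_mono[OF ennreal_leI]) auto
  qed
  also have "\<dots> = (\<integral>\<^sup>+z. \<integral>\<^sup>+y. ennreal (5 * B * tail_k k (x - z)) * (indicator F y * ennreal (A y z)) \<partial>lborel \<partial>lborel)"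
    by (rule lborel_pair.Fubini'[symmetric]) measurable
  also have "\<dots> = (\<integral>\<^sup>+z. ennreal (5 * B * tail_k k (x - z)) * (\<integral>\<^sup>+y. indicator F y * ennreal (A y z) \<partial>lborel) \<partial>lborel)"
    by (intro nn_integral_cong nn_integral_cmult) measurable
  also have "\<dots> \<le> (\<integral>\<^sup>+z. ennreal (5 * B * tail_k k (x - z)) * ennreal (2 * \<theta>) \<partial>lborel)"
    by (intro nn_integral_mono mult_left_mono nn_integral_density_le) auto
  also have "\<dots> = (\<integral>\<^sup>+z. ennreal (10 * B * \<theta>) * ennreal (tail_k k (x - z)) \<partial>lborel)"
    using B theta_pos tail_k_nonneg by (intro nn_integral_cong) (simp add: ennreal_mult[symmetric] mult_ac)
  also have "\<dots> = ennreal (10 * B * \<theta>) * ennreal 2"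
    by (simp add: nn_integral_cmult nn_integral_tail_k_reflect)
  also have "\<dots> = ennreal (20 * B * \<theta>)"
    using B theta_pos by (subst ennreal_mult[symmetric]) auto
  finally show ?thesis .
qed

text \<open>Integrating in \<open>x\<close> removes the tail and integrating in \<open>z\<close>
  removes \<open>A\<close>. What remains for each \<open>y\<close> in F is a geometric sum over the
  scales around \<kappa> y, and this is the only place where the separation of the scales is used
  for the bad part.\<close>

lemma sum_nn_integral_err_le:
  assumes B: "0 \<le> B" and T: "finite T"
  shows "(\<Sum>k\<in>T. \<integral>\<^sup>+x. err B k x \<partial>lborel) \<le> ennreal (40 * B * measure lborel F)"
proof -
  have e: "(\<integral>\<^sup>+x. err B k x \<partial>lborel) = (\<integral>\<^sup>+y. ennreal (10 * B * 2 powr - \<bar>real_of_int (k - \<kappa> y)\<bar>) * indicator F y \<partial>lborel)" for k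
  proof -
    let ?c = "\<lambda>y. 5 * B * 2 powr - \<bar>real_of_int (k - \<kappa> y)\<bar>"
    have "(\<integral>\<^sup>+x. err B k x \<partial>lborel)
      = (\<integral>\<^sup>+y. \<integral>\<^sup>+x. \<integral>\<^sup>+z. ennreal (?c y * tail_k k (x - z)) * (indicator F y * ennreal (A y z)) \<partial>lborel \<partial>lborel \<partial>lborel)"
      unfolding err_def by (rule lborel_pair.Fubini') measurable
    also have "\<dots> = (\<integral>\<^sup>+y. ennreal (10 * B * 2 powr - \<bar>real_of_int (k - \<kappa> y)\<bar>) * indicator F y \<partial>lborel)"
    proof (rule nn_integral_cong)
      fix y
      have c0: "0 \<le> ?c y" using B by simp
      have "(\<integral>\<^sup>+x. \<integral>\<^sup>+z. ennreal (?c y * tail_k k (x - z)) * (indicator F y * ennreal (A y z)) \<partial>lborel \<partial>lborel)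
        = (\<integral>\<^sup>+z. \<integral>\<^sup>+x. ennreal (?c y * tail_k k (x - z)) * (indicator F y * ennreal (A y z)) \<partial>lborel \<partial>lborel)"
        by (rule lborel_pair.Fubini') measurable
      also have "\<dots> = (\<integral>\<^sup>+z. (ennreal (?c y) * indicator F y * ennreal 2) * ennreal (A y z) \<partial>lborel)"
      proof (rule nn_integral_cong)
        fix z
        have "(\<integral>\<^sup>+x. ennreal (?c y * tail_k k (x - z)) * (indicator F y * ennreal (A y z)) \<partial>lborel)
          = (\<integral>\<^sup>+x. ennreal (?c y) * indicator F y * ennreal (A y z) * ennreal (tail_k k (x - z)) \<partial>lborel)"
          unfolding ennreal_mult[OF c0 tail_k_nonneg] by (intro nn_integral_cong) (simp only: mult_ac)
        also have "\<dots> = ennreal (?c y) * indicator F y * ennreal (A y z) * 2"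
          by (simp add: nn_integral_cmult nn_integral_tail_k_translate)
        finally show "(\<integral>\<^sup>+x. ennreal (?c y * tail_k k (x - z)) * (indicator F y * ennreal (A y z)) \<partial>lborel)
          = (ennreal (?c y) * indicator F y * ennreal 2) * ennreal (A y z)" by (simp add: mult_ac)
      qed
      also have "\<dots> = ennreal (?c y) * indicator F y * ennreal 2"
        by (simp add: nn_integral_cmult nn_integral_A)
      also have "\<dots> = (ennreal (?c y) * ennreal 2) * indicator F y" by (simp only: mult_ac)
      also have "ennreal (?c y) * ennreal 2 = ennreal (10 * B * 2 powr - \<bar>real_of_int (k - \<kappa> y)\<bar>)"
        using c0 by (subst ennreal_mult[symmetric]) auto
      finally show "(\<integral>\<^sup>+x. \<integral>\<^sup>+z. ennreal (?c y * tail_k k (x - z)) * (indicator F y * ennreal (A y z)) \<partial>lborel \<partial>lborel)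
        = ennreal (10 * B * 2 powr - \<bar>real_of_int (k - \<kappa> y)\<bar>) * indicator F y" .
    qed
    finally show ?thesis .
  qed
  have "(\<Sum>k\<in>T. \<integral>\<^sup>+x. err B k x \<partial>lborel)
    = (\<integral>\<^sup>+y. (\<Sum>k\<in>T. ennreal (10 * B * 2 powr - \<bar>real_of_int (k - \<kappa> y)\<bar>) * indicator F y) \<partial>lborel)"
    unfolding e by (rule nn_integral_sum[symmetric]) measurable
  also have "\<dots> \<le> (\<integral>\<^sup>+y. ennreal (40 * B) * indicator F y \<partial>lborel)"
  proof (rule nn_integral_mono)
    fix y
    have "(\<Sum>k\<in>T. ennreal (10 * B * 2 powr - \<bar>real_of_int (k - \<kappa> y)\<bar>)) = ennreal (10 * B * (\<Sum>k\<in>T. 2 powr - \<bar>real_of_int (k - \<kappa> y)\<bar>))"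
      using B by (simp add: sum_distrib_left)
    also have "\<dots> \<le> ennreal (10 * B * 4)"
      using B by (intro ennreal_leI mult_left_mono sum_two_powr_dist_le T) auto
    finally show "(\<Sum>k\<in>T. ennreal (10 * B * 2 powr - \<bar>real_of_int (k - \<kappa> y)\<bar>) * indicator F y) \<le> ennreal (40 * B) * indicator F y"
      unfolding sum_distrib_right[symmetric] by (intro mult_right_mono) auto
  qed
  also have "\<dots> = ennreal (40 * B * measure lborel F)"
    using B by (simp add: nn_integral_cmult emeasure_F ennreal_mult)
  finally show ?thesis .
qed

text \<open>For the good part the weight is dropped and the L2 bound is applied to
  \<open>avg f\<close>, which is at most 2 \<theta> everywhere and |F| in the L1 norm. For the bad
  part the square of \<open>err\<close> is at most its supremum times itself. The constant 1728 is 2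
  * 32 * 2 + 40 * 40.\<close>

theorem weighted_square_function:
  assumes m: "molecule B g" and z: "(\<integral>u. g u \<partial>lborel) = 0" and T: "finite T" and TK: "\<And>k. k \<in> T \<Longrightarrow> k \<le> K"
  shows "(\<Sum>k\<in>T. \<integral>\<^sup>+x. ennreal ((cmod (conv f (dil k g) x) / (W k x) ^ 3)\<^sup>2) \<partial>lborel)
    \<le> ennreal ((1728 * B\<^sup>2 + 4) * \<theta> * measure lborel F)"
proof -
  have B: "0 \<le> B" by (rule molecule_nonneg[OF m])
  have [measurable]: "g \<in> borel_measurable borel" by (rule molecule_measurable[OF m])
  have [measurable]: "dil k g \<in> borel_measurable borel" for k by measurable
  have [measurable]: "conv (avg f) (dil k g) \<in> borel_measurable borel" for k by measurable
  let ?H = "\<lambda>k x. (cmod (conv (avg f) (dil k g) x))\<^sup>2"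
  let ?\<mu> = "measure lborel F"
  have pt: "ennreal ((cmod (conv f (dil k g) x) / (W k x) ^ 3)\<^sup>2)
     \<le> ennreal 2 * ennreal (?H k x) + ennreal (40 * B * \<theta>) * err B k x" if k: "k \<in> T" for k x
  proof -
    let ?a = "cmod (conv f (dil k g) x)" and ?h = "cmod (conv (avg f) (dil k g) x)"
    let ?d = "cmod (conv f (dil k g) x - conv (avg f) (dil k g) x)" and ?w = "(W k x) ^ 3"
    have w1: "1 \<le> ?w" using W_ge1 by (rule one_le_power)
    have W0: "0 < W k x" using W_ge1[of k x] by linarith
    have "?a \<le> ?h + ?d" using norm_triangle_ineq2[of "conv f (dil k g) x" "conv (avg f) (dil k g) x"] by simp
    then have "?a / ?w \<le> ?h / ?w + ?d / ?w"
      unfolding add_divide_distrib[symmetric] by (rule divide_right_mono) (use w1 in linarith)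
    also have "?h / ?w \<le> ?h"
      using W0 w1 divide_left_mono[of 1 ?w ?h] by simp
    finally have "(?a / ?w)\<^sup>2 \<le> (?h + ?d / ?w)\<^sup>2" using W0 by (intro power_mono) auto
    also have "\<dots> \<le> 2 * ?h\<^sup>2 + 2 * (?d / ?w)\<^sup>2"
      using sum_squares_bound[of ?h "?d / ?w"] by (simp add: power2_sum)
    finally have "ennreal ((?a / ?w)\<^sup>2) \<le> ennreal (2 * ?h\<^sup>2 + 2 * (?d / ?w)\<^sup>2)" by (rule ennreal_leI)
    also have "\<dots> = ennreal 2 * ennreal (?h\<^sup>2) + ennreal 2 * (ennreal (?d / ?w) * ennreal (?d / ?w))"
    proof -
      have *: "ennreal (b\<^sup>2) = ennreal b * ennreal b" if "0 \<le> b" for b :: real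
        using that by (simp only: power2_eq_square ennreal_mult)
      show ?thesis using W0 by (subst ennreal_mult_add) (auto simp: *)
    qed
    also have "\<dots> \<le> ennreal 2 * ennreal (?h\<^sup>2) + ennreal 2 * (ennreal (20 * B * \<theta>) * err B k x)"
      using bad_part_le[OF m TK[OF k], of x] err_le[OF B, of k x]
      by (intro add_left_mono mult_left_mono mult_mono) (auto intro: order_trans)
    also have "\<dots> = ennreal 2 * ennreal (?h\<^sup>2) + ennreal (40 * B * \<theta>) * err B k x"
    proof -
      have "ennreal 2 * ennreal (20 * B * \<theta>) = ennreal (40 * B * \<theta>)"
        using B theta_pos by (subst ennreal_mult[symmetric]) auto
      then show ?thesis by (simp only: mult.assoc[symmetric])
    qed
    finally show ?thesis .
  qed
  have HI: "integrable lborel (?H k)" for k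
    by (rule integrable_norm_square[OF integrable_conv[OF avg_integrable dil_integrable[OF m]]
          norm_conv_dil_le[OF m avg_integrable]])
  have "(\<Sum>k\<in>T. \<integral>\<^sup>+x. ennreal ((cmod (conv f (dil k g) x) / (W k x) ^ 3)\<^sup>2) \<partial>lborel)
     \<le> (\<Sum>k\<in>T. \<integral>\<^sup>+x. ennreal 2 * ennreal (?H k x) + ennreal (40 * B * \<theta>) * err B k x \<partial>lborel)"
    by (intro sum_mono nn_integral_mono pt)
  also have "\<dots> = (\<Sum>k\<in>T. ennreal 2 * (\<integral>\<^sup>+x. ennreal (?H k x) \<partial>lborel) + ennreal (40 * B * \<theta>) * (\<integral>\<^sup>+x. err B k x \<partial>lborel))"
    by (intro sum.cong refl) (simp add: nn_integral_add nn_integral_cmult)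
  also have "\<dots> = ennreal 2 * (\<Sum>k\<in>T. \<integral>\<^sup>+x. ennreal (?H k x) \<partial>lborel) + ennreal (40 * B * \<theta>) * (\<Sum>k\<in>T. \<integral>\<^sup>+x. err B k x \<partial>lborel)"
    by (simp add: sum.distrib sum_distrib_left)
  also have "\<dots> \<le> ennreal 2 * ennreal ((32 * B\<^sup>2 + 1) * (2 * \<theta> * ?\<mu>)) + ennreal (40 * B * \<theta>) * ennreal (40 * B * ?\<mu>)"
  proof (intro add_mono mult_left_mono sum_nn_integral_err_le B T)
    have "(\<Sum>k\<in>T. \<integral>\<^sup>+x. ennreal (?H k x) \<partial>lborel) = (\<Sum>k\<in>T. ennreal (\<integral>x. ?H k x \<partial>lborel))"
      using HI by (intro sum.cong refl nn_integral_eq_integral) auto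
    also have "\<dots> = ennreal (\<Sum>k\<in>T. \<integral>x. ?H k x \<partial>lborel)" by (intro sum_ennreal) auto
    also have "\<dots> \<le> ennreal ((32 * B\<^sup>2 + 1) * (\<integral>x. (cmod (avg f x))\<^sup>2 \<partial>lborel))"
      by (intro ennreal_leI square_function_L2[OF m z avg_integrable avg_le T])
    also have "\<dots> \<le> ennreal ((32 * B\<^sup>2 + 1) * (2 * \<theta> * ?\<mu>))"
      by (intro ennreal_leI mult_left_mono integral_avg_square_le) auto
    finally show "(\<Sum>k\<in>T. \<integral>\<^sup>+x. ennreal (?H k x) \<partial>lborel) \<le> ennreal ((32 * B\<^sup>2 + 1) * (2 * \<theta> * ?\<mu>))" .
  qed auto
  also have "\<dots> = ennreal (2 * ((32 * B\<^sup>2 + 1) * (2 * \<theta> * ?\<mu>)) + 40 * B * \<theta> * (40 * B * ?\<mu>))"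
    using B theta_pos by (intro ennreal_mult_add[symmetric]) auto
  also have "2 * ((32 * B\<^sup>2 + 1) * (2 * \<theta> * ?\<mu>)) + 40 * B * \<theta> * (40 * B * ?\<mu>) = (1728 * B\<^sup>2 + 4) * \<theta> * ?\<mu>"
    by (simp add: power2_eq_square algebra_simps)
  finally show ?thesis .
qed

end

end

section \<open>Assembling the estimate\<close>

text \<open>The weight \<open>W\<close> freed from the stopping data, since three different stopping
  constructions have to share one weight.\<close>

definition wt :: "real set \<Rightarrow> int \<Rightarrow> real \<Rightarrow> real" where
  "wt E k x = 1 + 2 powr real_of_int k * infdist x (- E)"

lemma wt_ge1: "1 \<le> wt E k x"
  by (simp add: wt_def infdist_nonneg)

lemma infdist_measurable [measurable]: "(\<lambda>x. infdist x (- E)) \<in> borel_measurable borel" for E :: "real set"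
  by (intro borel_measurable_continuous_onI continuous_on_infdist continuous_on_id)

lemma wt_measurable [measurable]: "wt E k \<in> borel_measurable borel"
  unfolding wt_def[abs_def] by measurable

text \<open>\<open>E\<close> may be larger than the exceptional set of this particular F, so a
  single \<open>E\<close> serves all three functions.\<close>

lemma stopping_interpretation:
  assumes F: "F \<in> sets borel" "emeasure lborel F < \<infinity>" and th: "0 < \<theta>"
    and E: "exceptional F \<theta> \<subseteq> E" "- E \<noteq> {}"
  obtains \<kappa> where "stopping F \<theta> K \<kappa> (\<lambda>x. infdist x (- E))"
proof -
  obtain \<kappa> where k: "\<kappa> \<in> measurable borel (count_space UNIV)"
    "\<And>y z. dy (\<kappa> y) z = dy (\<kappa> y) y \<Longrightarrow> \<kappa> z = \<kappa> y"
    "\<And>y. \<kappa> y \<le> K"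
    "\<And>y. measure lborel (F \<inter> dyadic_I (\<kappa> y) (dy (\<kappa> y) y)) \<le> 2 * \<theta> * 2 powr - real_of_int (\<kappa> y)"
    "\<And>y. \<kappa> y = K \<or> heavy F \<theta> (\<kappa> y) (dy (\<kappa> y) y)"
    using stopping_scale_exists[OF F th, of K] by blast
  have "stopping F \<theta> K \<kappa> (\<lambda>x. infdist x (- E))"
  proof (rule stopping.intro[OF F th k(1-4) infdist_measurable infdist_nonneg])
    fix x y z assume "\<kappa> y \<noteq> K" and eq: "dy (\<kappa> y) z = dy (\<kappa> y) y"
    then have "heavy F \<theta> (\<kappa> y) (dy (\<kappa> y) z)" using k(5)[of y] by simp
    then show "2 powr - real_of_int (\<kappa> y) \<le> infdist x (- E) + \<bar>x - z\<bar>" by (rule heavy_dist_le[OF _ E])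
  qed
  then show ?thesis by (rule that)
qed

text \<open>Interpolates between two endpoint estimates without knowing whether \<open>a\<close> is
  above or below 1.\<close>

lemma powr_between:
  fixes a :: real
  assumes a: "0 < a" and s: "p \<le> s" "s \<le> q"
  shows "min (a powr p) (a powr q) \<le> a powr s"
proof (cases "a \<le> 1")
  case True
  then have "a powr q \<le> a powr s" using a s by (intro powr_mono') auto
  then show ?thesis by simp
next
  case False
  then have "a powr p \<le> a powr s" using a s by (intro powr_mono) auto
  then show ?thesis by simp
qed

lemma weighted_square_function_powr:
  assumes F: "F \<in> sets borel" "emeasure lborel F < \<infinity>" and m0: "0 < measure lborel F" and N: "0 < N"
    and E: "exceptional F (18 * measure lborel F / N) \<subseteq> E" "- E \<noteq> {}"
    and f: "f \<in> borel_measurable borel" "\<And>x. cmod (f x) \<le> indicator F x"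
    and m: "molecule B g" and z: "(\<integral>u. g u \<partial>lborel) = 0" and T: "finite T"
    and \<alpha>: "1 / 2 \<le> \<alpha>" "\<alpha> \<le> 1"
  shows "(\<Sum>k\<in>T. \<integral>\<^sup>+x. ennreal ((cmod (conv f (dil k g) x) / (wt E k x) ^ 3)\<^sup>2) \<partial>lborel)
    \<le> ennreal (18 * (1728 * B\<^sup>2 + 4) * N * (measure lborel F / N) powr (2 * \<alpha>))" (is "?S \<le> _")
proof -
  define \<theta> where "\<theta> = 18 * measure lborel F / N"
  define a where "a = measure lborel F / N"
  define C where "C = 18 * (1728 * B\<^sup>2 + 4)"
  have C0: "0 \<le> C" by (simp add: C_def)
  have a0: "0 < a" using m0 N by (simp add: a_def)
  have th: "0 < \<theta>" using m0 N by (simp add: \<theta>_def)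
  have fm[measurable]: "f \<in> borel_measurable borel" by fact
  have gm[measurable]: "g \<in> borel_measurable borel" by (rule molecule_measurable[OF m])
  have [measurable]: "dil k g \<in> borel_measurable borel" for k by measurable
  \<comment> \<open>Any upper bound for the finitely many scales will do; the estimate does not
    depend on it.\<close>
  obtain K where K: "\<And>k. k \<in> T \<Longrightarrow> k \<le> K"
    using T by (meson Max_ge)
  obtain \<kappa> where st: "stopping F \<theta> K \<kappa> (\<lambda>x. infdist x (- E))"
    using stopping_interpretation[OF F th, of E K] E unfolding \<theta>_def by blast
  interpret stopping F \<theta> K \<kappa> "\<lambda>x. infdist x (- E)" by (rule st)
  have W: "W k x = wt E k x" for k x by (simp add: W_def wt_def)
  have "?S \<le> ennreal ((1728 * B\<^sup>2 + 4) * \<theta> * measure lborel F)"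
    using weighted_square_function[OF f m z T K] by (simp add: W)
  also have "(1728 * B\<^sup>2 + 4) * \<theta> * measure lborel F = C * N * a powr 2"
    using N a0 by (simp add: C_def \<theta>_def a_def power2_eq_square)
  finally have 1: "?S \<le> ennreal (C * N * a powr 2)" .
  have fI: "integrable lborel f" by (rule f_integrable[OF f])
  have f1: "cmod (f x) \<le> 1" for x by (rule f_le_1[OF f])
  have HI: "integrable lborel (\<lambda>x. (cmod (conv f (dil k g) x))\<^sup>2)" for k
    by (rule integrable_norm_square[OF integrable_conv[OF fI dil_integrable[OF m]] norm_conv_dil_le[OF m fI]])
  \<comment> \<open>The second endpoint: the weight is at least 1, and without it almost
    orthogonality applies to \<open>f\<close> itself, whose squared L2 norm is at most |F| = N
    a.\<close>
  have "?S \<le> (\<Sum>k\<in>T. \<integral>\<^sup>+x. ennreal ((cmod (conv f (dil k g) x))\<^sup>2) \<partial>lborel)"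
  proof (intro sum_mono nn_integral_mono ennreal_leI power_mono)
    fix k x
    have w: "1 \<le> (wt E k x) ^ 3" using wt_ge1 by (rule one_le_power)
    have w0: "0 < wt E k x" using wt_ge1[of E k x] by linarith
    show "cmod (conv f (dil k g) x) / (wt E k x) ^ 3 \<le> cmod (conv f (dil k g) x)"
      using w0 w divide_left_mono[of 1 "(wt E k x) ^ 3" "cmod (conv f (dil k g) x)"] by simp
    show "0 \<le> cmod (conv f (dil k g) x) / (wt E k x) ^ 3" using w0 by simp
  qed
  also have "\<dots> = (\<Sum>k\<in>T. ennreal (\<integral>x. (cmod (conv f (dil k g) x))\<^sup>2 \<partial>lborel))"
    using HI by (intro sum.cong refl nn_integral_eq_integral) auto
  also have "\<dots> = ennreal (\<Sum>k\<in>T. \<integral>x. (cmod (conv f (dil k g) x))\<^sup>2 \<partial>lborel)" by (intro sum_ennreal) auto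
  also have "\<dots> \<le> ennreal ((32 * B\<^sup>2 + 1) * (\<integral>x. (cmod (f x))\<^sup>2 \<partial>lborel))"
    by (intro ennreal_leI square_function_L2[OF m z fI f1 T])
  also have "\<dots> \<le> ennreal (C * (N * a))"
  proof (intro ennreal_leI mult_mono)
    have "(\<integral>x. (cmod (f x))\<^sup>2 \<partial>lborel) \<le> (\<integral>x. indicator F x \<partial>lborel)"
    proof (rule integral_mono)
      show "integrable lborel (\<lambda>x. (cmod (f x))\<^sup>2)" by (rule integrable_norm_square[OF fI f1])
      show "integrable lborel (indicator F :: real \<Rightarrow> real)" using F by (intro integrable_real_indicator) auto
      show "(cmod (f x))\<^sup>2 \<le> indicator F x" for x
        using f(2)[of x] by (cases "x \<in> F") (auto simp: power_le_one)
    qed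
    also have "\<dots> = N * a" using N F by (simp add: a_def)
    finally show "(\<integral>x. (cmod (f x))\<^sup>2 \<partial>lborel) \<le> N * a" .
    show "32 * B\<^sup>2 + 1 \<le> C" by (simp add: C_def)
  qed (use C0 in auto)
  finally have 2: "?S \<le> ennreal (C * N * a powr 1)" using a0 by (simp add: mult.assoc)
  have "?S \<le> ennreal (C * N * min (a powr 1) (a powr 2))" using 1 2 by (auto simp: min_def)
  also have "\<dots> \<le> ennreal (C * N * a powr (2 * \<alpha>))"
    using \<alpha> N C0 by (intro ennreal_leI mult_left_mono powr_between a0) auto
  finally show ?thesis by (simp add: C_def a_def)
qed

lemma norm_conv_dil_le_2B:
  assumes f: "f \<in> borel_measurable borel" "\<And>x. cmod (f x) \<le> 1" and m: "molecule B g"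
  shows "cmod (conv f (dil k g) x) \<le> 2 * B"
proof -
  have B: "0 \<le> B" by (rule molecule_nonneg[OF m])
  have [measurable]: "f \<in> borel_measurable borel" "g \<in> borel_measurable borel"
    using f molecule_measurable[OF m] by auto
  have [measurable]: "dil k g \<in> borel_measurable borel" by measurable
  have "ennreal (cmod (conv f (dil k g) x)) \<le> (\<integral>\<^sup>+y. ennreal (cmod (f y) * cmod (dil k g (x - y))) \<partial>lborel)"
    by (rule nn_integral_norm_conv_le) measurable
  also have "\<dots> \<le> (\<integral>\<^sup>+y. ennreal B * ennreal (tail_k k (x - y)) \<partial>lborel)"
  proof (rule nn_integral_mono)
    fix y
    have "cmod (f y) * cmod (dil k g (x - y)) \<le> 1 * (B * tail_k k (x - y))"
      using f by (intro mult_mono dil_le_tail_k[OF m]) auto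
    then show "ennreal (cmod (f y) * cmod (dil k g (x - y))) \<le> ennreal B * ennreal (tail_k k (x - y))"
      using B tail_k_nonneg by (simp add: ennreal_mult[symmetric] ennreal_leI)
  qed
  also have "\<dots> = ennreal B * ennreal 2" by (simp add: nn_integral_cmult nn_integral_tail_k_reflect)
  also have "\<dots> = ennreal (2 * B)" using B by (subst ennreal_mult[symmetric]) (auto simp: mult.commute)
  finally show ?thesis using B by (simp add: ennreal_le_iff)
qed

text \<open>A single scale is estimated here, so the stopping construction is cut off at
  \<open>k\<close> itself. One endpoint is the density bound with \<theta> = 18 a, and 288 is 16 *
  18; the other is the trivial bound 2 B.\<close>

lemma conv_dil_powr_le:
  assumes F: "F \<in> sets borel" "emeasure lborel F < \<infinity>" and m0: "0 < measure lborel F" and N: "0 < N"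
    and E: "exceptional F (18 * measure lborel F / N) \<subseteq> E" "- E \<noteq> {}"
    and f: "f \<in> borel_measurable borel" "\<And>x. cmod (f x) \<le> indicator F x"
    and m: "molecule B g" and \<alpha>: "0 \<le> \<alpha>" "\<alpha> \<le> 1"
  shows "cmod (conv f (dil k g) x) \<le> 288 * B * (measure lborel F / N) powr \<alpha> * (wt E k x)\<^sup>2"
proof -
  define \<theta> where "\<theta> = 18 * measure lborel F / N"
  define a where "a = measure lborel F / N"
  have B: "0 \<le> B" by (rule molecule_nonneg[OF m])
  have a0: "0 < a" using m0 N by (simp add: a_def)
  have th: "0 < \<theta>" using m0 N by (simp add: \<theta>_def)
  have fm[measurable]: "f \<in> borel_measurable borel" by fact
  have gm[measurable]: "g \<in> borel_measurable borel" by (rule molecule_measurable[OF m])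
  have [measurable]: "dil k g \<in> borel_measurable borel" by measurable
  obtain \<kappa> where st: "stopping F \<theta> k \<kappa> (\<lambda>x. infdist x (- E))"
    using stopping_interpretation[OF F th, of E k] E unfolding \<theta>_def by blast
  interpret stopping F \<theta> k \<kappa> "\<lambda>x. infdist x (- E)" by (rule st)
  have W: "W k x = wt E k x" for k x by (simp add: W_def wt_def)
  have "ennreal (cmod (conv f (dil k g) x)) \<le> (\<integral>\<^sup>+y. ennreal (cmod (f y) * cmod (dil k g (x - y))) \<partial>lborel)"
    by (rule nn_integral_norm_conv_le) measurable
  also have "\<dots> \<le> (\<integral>\<^sup>+y. ennreal B * (indicator F y * ennreal (tail_k k (x - y))) \<partial>lborel)"
  proof (rule nn_integral_mono)
    fix y
    have "ennreal (cmod (f y) * cmod (dil k g (x - y))) = ennreal (cmod (f y)) * ennreal (cmod (dil k g (x - y)))"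
      by (simp add: ennreal_mult)
    also have "\<dots> \<le> indicator F y * ennreal (B * tail_k k (x - y))"
      by (intro mult_mono ennreal_leI dil_le_tail_k[OF m] f_ennreal[OF f]) auto
    finally show "ennreal (cmod (f y) * cmod (dil k g (x - y))) \<le> ennreal B * (indicator F y * ennreal (tail_k k (x - y)))"
      using B tail_k_nonneg by (simp add: ennreal_mult mult_ac)
  qed
  also have "\<dots> = ennreal B * (\<integral>\<^sup>+y. indicator F y * ennreal (tail_k k (x - y)) \<partial>lborel)"
    by (rule nn_integral_cmult) measurable
  also have "\<dots> \<le> ennreal B * ennreal (16 * \<theta> * (W k x)\<^sup>2)"
    by (intro mult_left_mono nn_integral_tail_le) auto
  also have "\<dots> = ennreal (B * (16 * \<theta> * (W k x)\<^sup>2))" using B th by (intro ennreal_mult[symmetric]) auto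
  finally have "cmod (conv f (dil k g) x) \<le> B * (16 * \<theta> * (W k x)\<^sup>2)"
    using B th by (simp add: ennreal_le_iff)
  then have 1: "cmod (conv f (dil k g) x) \<le> 288 * B * (wt E k x)\<^sup>2 * a powr 1"
    using a0 N by (simp add: W \<theta>_def a_def mult_ac)
  have f1: "cmod (f x) \<le> 1" for x by (rule f_le_1[OF f])
  have w: "1 \<le> (wt E k x)\<^sup>2" using wt_ge1 by (rule one_le_power)
  have "cmod (conv f (dil k g) x) \<le> 2 * B" by (rule norm_conv_dil_le_2B[OF fm f1 m])
  also have "\<dots> \<le> 288 * B * (wt E k x)\<^sup>2 * a powr 0"
    using mult_left_mono[OF w, of "288 * B"] B a0 by simp
  finally have 2: "cmod (conv f (dil k g) x) \<le> 288 * B * (wt E k x)\<^sup>2 * a powr 0" .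
  have "cmod (conv f (dil k g) x) \<le> 288 * B * (wt E k x)\<^sup>2 * min (a powr 0) (a powr 1)"
    using 1 2 by (auto simp: min_def)
  also have "\<dots> \<le> 288 * B * (wt E k x)\<^sup>2 * a powr \<alpha>"
    using B \<alpha> by (intro mult_left_mono powr_between a0) auto
  finally show ?thesis by (simp add: a_def mult_ac)
qed

text \<open>A point \<open>y\<close> off \<open>E\<close> is at least as far from \<open>x\<close>
  as the complement of \<open>E\<close> is, so 1 + 2^k |x - y| dominates the weight. Eight of the
  ten powers of decay are traded for the weight.\<close>

lemma conv_dil_decay:
  assumes f: "f \<in> borel_measurable borel" "\<And>x. cmod (f x) \<le> indicator (- E) x" and m: "molecule B g"
  shows "cmod (conv f (dil k g) x) \<le> 2 * B / (wt E k x) ^ 8"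
proof -
  have B: "0 \<le> B" by (rule molecule_nonneg[OF m])
  have [measurable]: "f \<in> borel_measurable borel" "g \<in> borel_measurable borel"
    using f molecule_measurable[OF m] by auto
  have [measurable]: "dil k g \<in> borel_measurable borel" by measurable
  define w where "w = wt E k x"
  have w0: "0 < w" using wt_ge1[of E k x] unfolding w_def by linarith
  have "ennreal (cmod (conv f (dil k g) x)) \<le> (\<integral>\<^sup>+y. ennreal (cmod (f y) * cmod (dil k g (x - y))) \<partial>lborel)"
    by (rule nn_integral_norm_conv_le) measurable
  also have "\<dots> \<le> (\<integral>\<^sup>+y. ennreal (B / w ^ 8) * ennreal (tail_k k (x - y)) \<partial>lborel)"
  proof (rule nn_integral_mono)
    fix y
    let ?u = "2 powr real_of_int k * (x - y)"
    have "cmod (f y) * cmod (dil k g (x - y)) \<le> B / w ^ 8 * tail_k k (x - y)"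
    proof (cases "y \<in> E")
      case True
      then have "cmod (f y) = 0" using f(2)[of y] by simp
      then show ?thesis using B w0 tail_k_nonneg by simp
    next
      case False
      have "infdist x (- E) \<le> dist x y" using False by (intro infdist_le) auto
      then have "2 powr real_of_int k * infdist x (- E) \<le> 2 powr real_of_int k * \<bar>x - y\<bar>"
        by (intro mult_left_mono) (auto simp: dist_real_def)
      then have wu: "w \<le> 1 + \<bar>?u\<bar>" by (simp add: w_def wt_def abs_mult)
      have "cmod (g ?u) \<le> B / (1 + \<bar>?u\<bar>) ^ 10" by (rule molecule_decay[OF m]) simp
      also have "\<dots> = B * tail ?u / (1 + \<bar>?u\<bar>) ^ 8" by (simp add: tail_def flip: power_add)
      also have "\<dots> \<le> B * tail ?u / w ^ 8"
        using wu w0 B tail_nonneg by (intro divide_left_mono power_mono) (auto intro!: mult_pos_pos zero_less_power)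
      finally have "2 powr real_of_int k * cmod (g ?u) \<le> 2 powr real_of_int k * (B * tail ?u / w ^ 8)"
        by (rule mult_left_mono) simp
      then have "cmod (dil k g (x - y)) \<le> B / w ^ 8 * tail_k k (x - y)"
        unfolding norm_dil tail_k_def by (simp add: mult_ac)
      moreover have "cmod (f y) \<le> 1" using f(2)[of y] False by simp
      ultimately show ?thesis by (meson mult_left_le_one_le norm_ge_zero order_trans)
    qed
    then show "ennreal (cmod (f y) * cmod (dil k g (x - y))) \<le> ennreal (B / w ^ 8) * ennreal (tail_k k (x - y))"
      using B w0 tail_k_nonneg by (subst ennreal_mult[symmetric]) (auto intro!: ennreal_leI)
  qed
  also have "\<dots> = ennreal (B / w ^ 8) * ennreal 2" by (simp add: nn_integral_cmult nn_integral_tail_k_reflect)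
  also have "\<dots> = ennreal (2 * B / w ^ 8)" using B w0 by (subst ennreal_mult[symmetric]) (auto simp: mult.commute)
  finally show ?thesis using B w0 by (simp add: ennreal_le_iff w_def)
qed

text \<open>The bounds for the last two factors multiply to w^(-6), which is shared equally by the
  first two. The parameter \<open>lam\<close> is left open so that square functions of different
  sizes can be balanced later.\<close>

lemma four_fold_pointwise:
  fixes A B C D w b p r lam :: real
  assumes "1 \<le> w" "0 \<le> A" "0 \<le> B" "0 \<le> C" "0 \<le> D" "0 < lam" "0 \<le> b" "0 \<le> r"
    and C: "C \<le> 288 * b * r * w\<^sup>2" and D: "D \<le> 2 * b / w ^ 8"
  shows "A * B * C * D \<le> 288 * b\<^sup>2 * r * lam * (A / w ^ 3)\<^sup>2 + 288 * b\<^sup>2 * r / lam * (B / w ^ 3)\<^sup>2"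
proof -
  have w0: "0 < w" using assms(1) by linarith
  have "A * B * C * D = A * B * (C * D)" by (simp add: mult.assoc)
  also have "\<dots> \<le> A * B * ((288 * b * r * w\<^sup>2) * (2 * b / w ^ 8))"
    using assms w0 by (intro mult_left_mono mult_mono) auto
  also have "\<dots> = 576 * b\<^sup>2 * r * ((A / w ^ 3) * (B / w ^ 3))"
    using w0 by (simp add: field_simps flip: power_add) (simp add: power2_eq_square eval_nat_numeral field_simps)
  also have "\<dots> \<le> 576 * b\<^sup>2 * r * ((lam * (A / w ^ 3)\<^sup>2 + (B / w ^ 3)\<^sup>2 / lam) / 2)"
  proof (intro mult_left_mono)
    let ?s = "A / w ^ 3" and ?t = "B / w ^ 3"
    have "0 \<le> (lam * ?s - ?t)\<^sup>2 / (2 * lam)" using assms(6) by simp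
    also have "\<dots> = (lam * ?s\<^sup>2 + ?t\<^sup>2 / lam) / 2 - ?s * ?t"
    proof -
      have *: "(lam * s - t)\<^sup>2 / (2 * lam) = (lam * s\<^sup>2 + t\<^sup>2 / lam) / 2 - s * t" for s t
        using assms(6) by (simp add: power2_eq_square field_simps)
      show ?thesis by (rule *)
    qed
    finally show "?s * ?t \<le> (lam * ?s\<^sup>2 + ?t\<^sup>2 / lam) / 2" by simp
  qed (use assms in auto)
  also have "\<dots> = 288 * b\<^sup>2 * r * lam * (A / w ^ 3)\<^sup>2 + 288 * b\<^sup>2 * r / lam * (B / w ^ 3)\<^sup>2"
  proof -
    have *: "576 * b\<^sup>2 * r * ((lam * p + q / lam) / 2) = 288 * b\<^sup>2 * r * lam * p + 288 * b\<^sup>2 * r / lam * q" for p q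
      using assms(6) by (simp add: field_simps)
    show ?thesis by (rule *)
  qed
  finally show ?thesis .
qed

lemma paraproduct_estimate:
  assumes F1: "F1 \<in> sets borel" "emeasure lborel F1 < \<infinity>" "0 < measure lborel F1"
    and F2: "F2 \<in> sets borel" "emeasure lborel F2 < \<infinity>" "0 < measure lborel F2"
    and F3: "F3 \<in> sets borel" "emeasure lborel F3 < \<infinity>" "0 < measure lborel F3"
    and N: "0 < N"
    and E: "exceptional F1 (18 * measure lborel F1 / N) \<subseteq> E" "exceptional F2 (18 * measure lborel F2 / N) \<subseteq> E"
      "exceptional F3 (18 * measure lborel F3 / N) \<subseteq> E" "- E \<noteq> {}"
    and f1: "f1 \<in> borel_measurable borel" "\<And>x. cmod (f1 x) \<le> indicator F1 x"
    and f2: "f2 \<in> borel_measurable borel" "\<And>x. cmod (f2 x) \<le> indicator F2 x"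
    and f3: "f3 \<in> borel_measurable borel" "\<And>x. cmod (f3 x) \<le> indicator F3 x"
    and f4: "f4 \<in> borel_measurable borel" "\<And>x. cmod (f4 x) \<le> indicator (- E) x"
    and m: "molecule B g" "molecule B g3" "molecule B g4" and z: "(\<integral>u. g u \<partial>lborel) = 0" and T: "finite T"
    and \<alpha>: "1 / 2 \<le> \<alpha>1" "\<alpha>1 \<le> 1" "1 / 2 \<le> \<alpha>2" "\<alpha>2 \<le> 1" "0 \<le> \<alpha>3" "\<alpha>3 \<le> 1"
  shows "(\<Sum>k\<in>T. \<integral>\<^sup>+x. ennreal (cmod (conv f1 (dil k g) x) * cmod (conv f2 (dil k g) x) *
      cmod (conv f3 (dil k g3) x) * cmod (conv f4 (dil k g4) x)) \<partial>lborel)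
    \<le> ennreal (10368 * B\<^sup>2 * (1728 * B\<^sup>2 + 4) * (N * (measure lborel F1 / N) powr \<alpha>1 *
        (measure lborel F2 / N) powr \<alpha>2 * (measure lborel F3 / N) powr \<alpha>3))"
proof -
  have B: "0 \<le> B" by (rule molecule_nonneg[OF m(1)])
  note [measurable] = f1(1) f2(1) f3(1) f4(1) molecule_measurable[OF m(1)] molecule_measurable[OF m(2)] molecule_measurable[OF m(3)]
  have [measurable]: "dil k g \<in> borel_measurable borel" "dil k g3 \<in> borel_measurable borel" "dil k g4 \<in> borel_measurable borel" for k
    by measurable
  have [measurable]: "conv f1 (dil k g) \<in> borel_measurable borel" "conv f2 (dil k g) \<in> borel_measurable borel" for k
    by measurable
  define a1 where "a1 = (measure lborel F1 / N) powr \<alpha>1"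
  define a2 where "a2 = (measure lborel F2 / N) powr \<alpha>2"
  define a3 where "a3 = (measure lborel F3 / N) powr \<alpha>3"
  have a: "0 < a1" "0 < a2" "0 < a3" using F1 F2 F3 N by (auto simp: a1_def a2_def a3_def)
  \<comment> \<open>The balancing choice: lam * a1^2 and a2^2 / lam are both equal to a1 *
    a2.\<close>
  define lam where "lam = a2 / a1"
  have lam: "0 < lam" using a by (simp add: lam_def)
  define c where "c = 288 * B\<^sup>2 * a3"
  have c: "0 \<le> c" using a by (simp add: c_def)
  define C where "C = 18 * (1728 * B\<^sup>2 + 4) * N"
  have C: "0 \<le> C" using N by (simp add: C_def)
  let ?S1 = "\<lambda>k x. (cmod (conv f1 (dil k g) x) / (wt E k x) ^ 3)\<^sup>2"
  let ?S2 = "\<lambda>k x. (cmod (conv f2 (dil k g) x) / (wt E k x) ^ 3)\<^sup>2"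
  have s1: "(\<Sum>k\<in>T. \<integral>\<^sup>+x. ennreal (?S1 k x) \<partial>lborel) \<le> ennreal (C * (a1 * a1))"
    using weighted_square_function_powr[OF F1(1,2,3) N E(1,4) f1 m(1) z T \<alpha>(1,2)]
    by (simp add: C_def a1_def flip: powr_add)
  have s2: "(\<Sum>k\<in>T. \<integral>\<^sup>+x. ennreal (?S2 k x) \<partial>lborel) \<le> ennreal (C * (a2 * a2))"
    using weighted_square_function_powr[OF F2(1,2,3) N E(2,4) f2 m(1) z T \<alpha>(3,4)]
    by (simp add: C_def a2_def flip: powr_add)
  have "(\<Sum>k\<in>T. \<integral>\<^sup>+x. ennreal (cmod (conv f1 (dil k g) x) * cmod (conv f2 (dil k g) x) *
      cmod (conv f3 (dil k g3) x) * cmod (conv f4 (dil k g4) x)) \<partial>lborel)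
    \<le> (\<Sum>k\<in>T. \<integral>\<^sup>+x. ennreal (c * lam) * ennreal (?S1 k x) + ennreal (c / lam) * ennreal (?S2 k x) \<partial>lborel)"
  proof (intro sum_mono nn_integral_mono)
    fix k x
    have "cmod (conv f1 (dil k g) x) * cmod (conv f2 (dil k g) x) * cmod (conv f3 (dil k g3) x) * cmod (conv f4 (dil k g4) x)
      \<le> c * lam * ?S1 k x + c / lam * ?S2 k x"
      unfolding c_def
    proof (rule four_fold_pointwise)
      show "cmod (conv f3 (dil k g3) x) \<le> 288 * B * a3 * (wt E k x)\<^sup>2"
        unfolding a3_def by (rule conv_dil_powr_le[OF F3(1,2,3) N E(3,4) f3 m(2) \<alpha>(5,6)])
      show "cmod (conv f4 (dil k g4) x) \<le> 2 * B / (wt E k x) ^ 8" by (rule conv_dil_decay[OF f4 m(3)])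
    qed (use lam B a wt_ge1 in auto)
    then have "ennreal (cmod (conv f1 (dil k g) x) * cmod (conv f2 (dil k g) x) * cmod (conv f3 (dil k g3) x) * cmod (conv f4 (dil k g4) x))
      \<le> ennreal (c * lam * ?S1 k x + c / lam * ?S2 k x)" by (rule ennreal_leI)
    also have "\<dots> = ennreal (c * lam) * ennreal (?S1 k x) + ennreal (c / lam) * ennreal (?S2 k x)"
      using c lam by (intro ennreal_mult_add) auto
    finally show "ennreal (cmod (conv f1 (dil k g) x) * cmod (conv f2 (dil k g) x) * cmod (conv f3 (dil k g3) x) * cmod (conv f4 (dil k g4) x))
      \<le> ennreal (c * lam) * ennreal (?S1 k x) + ennreal (c / lam) * ennreal (?S2 k x)" .
  qed
  also have "\<dots> = (\<Sum>k\<in>T. ennreal (c * lam) * (\<integral>\<^sup>+x. ennreal (?S1 k x) \<partial>lborel) + ennreal (c / lam) * (\<integral>\<^sup>+x. ennreal (?S2 k x) \<partial>lborel))"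
    by (intro sum.cong refl) (subst nn_integral_add, auto simp: nn_integral_cmult)
  also have "\<dots> = ennreal (c * lam) * (\<Sum>k\<in>T. \<integral>\<^sup>+x. ennreal (?S1 k x) \<partial>lborel) + ennreal (c / lam) * (\<Sum>k\<in>T. \<integral>\<^sup>+x. ennreal (?S2 k x) \<partial>lborel)"
    by (simp add: sum.distrib sum_distrib_left)
  also have "\<dots> \<le> ennreal (c * lam) * ennreal (C * (a1 * a1)) + ennreal (c / lam) * ennreal (C * (a2 * a2))"
    by (intro add_mono mult_left_mono s1 s2) auto
  also have "\<dots> = ennreal (c * lam * (C * (a1 * a1)) + c / lam * (C * (a2 * a2)))"
    using c lam C a by (intro ennreal_mult_add[symmetric]) auto
  also have "c * lam * (C * (a1 * a1)) + c / lam * (C * (a2 * a2)) = 10368 * B\<^sup>2 * (1728 * B\<^sup>2 + 4) * (N * a1 * a2 * a3)"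
    using a by (simp add: c_def C_def lam_def field_simps)
  finally show ?thesis unfolding a1_def a2_def a3_def .
qed

section \<open>From the form to seven paraproducts\<close>

text \<open>Absolute values may be taken inside the integrals only after the terms with other
  \<open>l\<close> have been discarded, since those vanish by oscillation and not by size.\<close>

lemma Lambda_S_le:
  assumes psi_S: "schwartz \<psi>"
    and psi_supp: "\<forall>\<xi>. \<xi> \<notin> {0..1} \<longrightarrow> fourier \<psi> \<xi> = 0"
    and phi_nonneg: "\<forall>x. \<phi> x \<ge> 0"
    and phi_S: "schwartz (\<lambda>x. complex_of_real (\<phi> x))"
    and phi_supp: "\<forall>\<xi>. \<xi> \<notin> {-1..1} \<longrightarrow> fourier (\<lambda>x. complex_of_real (\<phi> x)) \<xi> = 0"
    and phi_0: "fourier (\<lambda>x. complex_of_real (\<phi> x)) 0 = 1"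
    and f: "integrable lborel f1" "integrable lborel f2" "integrable lborel f3" "integrable lborel f4"
    and S: "finite S"
  shows "ennreal (cmod (Lambda_S \<psi> \<phi> S f1 f2 f3 f4)) \<le>
    (\<Sum>l\<in>{-13..-7}. \<Sum>k\<in>fst ` S. \<integral>\<^sup>+x. ennreal (cmod (conv f1 (psi_kl \<psi> k l) x) * cmod (conv f2 (psi_kl \<psi> k l) x) *
      cmod (conv f3 (psi_kl \<psi> k 18) x) * cmod (conv f4 (psi_kl \<psi> k (2 * l + 18)) x)) \<partial>lborel)"
proof -
  define P where "P k n l x = wave_packet \<psi> \<phi> f1 k n l x * wave_packet \<psi> \<phi> f2 k n l x *
        wave_packet \<psi> \<phi> f3 k n 18 x * wave_packet \<psi> \<phi> f4 k n (2 * l + 18) x" for k n l x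
  define G where "G k l x = cmod (conv f1 (psi_kl \<psi> k l) x) * cmod (conv f2 (psi_kl \<psi> k l) x) *
      cmod (conv f3 (psi_kl \<psi> k 18) x) * cmod (conv f4 (psi_kl \<psi> k (2 * l + 18)) x)" for k l x
  have G0: "0 \<le> G k l x" for k l x by (simp add: G_def)
  note chi = chi_star_bounds(1)[OF phi_nonneg phi_S phi_0]
  have nP: "cmod (P k n l x) = chi_star \<phi> k n x ^ 4 * G k l x" for k n l x
    using chi[of k n x] by (simp add: P_def G_def wave_packet_def norm_mult power4_eq_xxxx mult_ac)
  have psm[measurable]: "\<psi> \<in> borel_measurable borel" by (rule schwartz_measurable[OF psi_S])
  have [measurable]: "(\<lambda>u. cis (pi * real_of_int l * u) * \<psi> u) \<in> borel_measurable borel" for l by measurable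
  have [measurable]: "psi_kl \<psi> k l \<in> borel_measurable borel" for k l unfolding psi_kl_dil by measurable
  have [measurable]: "f1 \<in> borel_measurable borel" "f2 \<in> borel_measurable borel" "f3 \<in> borel_measurable borel" "f4 \<in> borel_measurable borel"
    using f by auto
  have [measurable]: "conv f1 (psi_kl \<psi> k l) \<in> borel_measurable borel" "conv f2 (psi_kl \<psi> k l) \<in> borel_measurable borel"
    "conv f3 (psi_kl \<psi> k l) \<in> borel_measurable borel" "conv f4 (psi_kl \<psi> k l) \<in> borel_measurable borel" for k l
    by measurable
  have Gm[measurable]: "G k l \<in> borel_measurable borel" for k l unfolding G_def[abs_def] by measurable
  have [measurable]: "chi_star \<phi> k n \<in> borel_measurable borel" for k n
  proof -
    have "(\<lambda>x. Re (complex_of_real (\<phi> x))) \<in> borel_measurable borel"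
      by (rule measurable_compose[OF schwartz_measurable[OF phi_S]]) measurable
    then have [measurable]: "\<phi> \<in> borel_measurable borel" by simp
    have [measurable]: "phi_k \<phi> k \<in> borel_measurable borel" unfolding phi_k_def[abs_def] by measurable
    show ?thesis unfolding chi_star_def by (intro borel_measurable_conv) measurable
  qed
  define L where "L = {-13..-7::int}"
  define T where "T = fst ` S"
  define M where "M = (\<lambda>(k, n, l). n) ` S"
  have fin: "finite L" "finite T" "finite M" using S by (auto simp: L_def T_def M_def)
  have nb: "ennreal (norm (LINT x|lebesgue. h x)) \<le> (\<integral>\<^sup>+x. ennreal (norm (h x)) \<partial>lborel)" for h :: "real \<Rightarrow> complex"
  proof -
    have "ennreal (norm (LINT x|lebesgue. h x)) \<le> (\<integral>\<^sup>+x. ennreal (norm (h x)) \<partial>lebesgue)"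
      by (rule norm_integral_le_nn_integral)
    then show ?thesis by (simp only: nn_integral_completion)
  qed
  have "Lambda_S \<psi> \<phi> S f1 f2 f3 f4 = (\<Sum>(k,n,l)\<in>S. LINT x|lebesgue. P k n l x)"
    unfolding Lambda_S_def P_def ..
  also have "\<dots> = (\<Sum>(k,n,l)\<in>{(k,n,l)\<in>S. l \<in> L}. LINT x|lebesgue. P k n l x)"
  proof (rule sum.mono_neutral_right[OF S])
    show "\<forall>i\<in>S - {(k,n,l)\<in>S. l \<in> L}. (case i of (k, n, l) \<Rightarrow> LINT x|lebesgue. P k n l x) = 0"
      unfolding P_def using wave_packet_integral_eq_0[OF psi_S psi_supp phi_S phi_supp f] by (auto simp: L_def)
  qed auto
  finally have "ennreal (cmod (Lambda_S \<psi> \<phi> S f1 f2 f3 f4)) \<le> ennreal (\<Sum>(k,n,l)\<in>{(k,n,l)\<in>S. l \<in> L}. cmod (LINT x|lebesgue. P k n l x))"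
    by (auto intro!: ennreal_leI order_trans[OF norm_sum] simp: case_prod_beta)
  also have "\<dots> = (\<Sum>(k,n,l)\<in>{(k,n,l)\<in>S. l \<in> L}. ennreal (cmod (LINT x|lebesgue. P k n l x)))"
    by (subst sum_ennreal[symmetric]) (auto simp: case_prod_beta)
  also have "\<dots> \<le> (\<Sum>(k,n,l)\<in>{(k,n,l)\<in>S. l \<in> L}. \<integral>\<^sup>+x. ennreal (chi_star \<phi> k n x ^ 4 * G k l x) \<partial>lborel)"
    using nb[of "P _ _ _"] by (intro sum_mono) (auto simp: nP)
  \<comment> \<open>All terms are now nonnegative, so the index set may be enlarged to a box. There
    the sum over \<open>n\<close> can be carried out for fixed \<open>k\<close> and
    \<open>l\<close>, where the cutoffs add up to at most 1.\<close>
  also have "\<dots> \<le> (\<Sum>(k,n,l)\<in>T \<times> M \<times> L. \<integral>\<^sup>+x. ennreal (chi_star \<phi> k n x ^ 4 * G k l x) \<partial>lborel)"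
  proof (rule sum_mono2)
    show "{(k,n,l)\<in>S. l \<in> L} \<subseteq> T \<times> M \<times> L" unfolding T_def M_def by force
  qed (use fin in auto)
  also have "\<dots> = (\<Sum>k\<in>T. \<Sum>n\<in>M. \<Sum>l\<in>L. \<integral>\<^sup>+x. ennreal (chi_star \<phi> k n x ^ 4 * G k l x) \<partial>lborel)"
    by (simp add: sum.cartesian_product[symmetric])
  also have "\<dots> = (\<Sum>k\<in>T. \<Sum>l\<in>L. \<Sum>n\<in>M. \<integral>\<^sup>+x. ennreal (chi_star \<phi> k n x ^ 4 * G k l x) \<partial>lborel)"
    by (intro sum.cong refl sum.swap)
  also have "\<dots> = (\<Sum>l\<in>L. \<Sum>k\<in>T. \<Sum>n\<in>M. \<integral>\<^sup>+x. ennreal (chi_star \<phi> k n x ^ 4 * G k l x) \<partial>lborel)"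
    by (rule sum.swap)
  also have "\<dots> \<le> (\<Sum>l\<in>L. \<Sum>k\<in>T. \<integral>\<^sup>+x. ennreal (G k l x) \<partial>lborel)"
  proof (intro sum_mono)
    fix l k
    have "(\<Sum>n\<in>M. \<integral>\<^sup>+x. ennreal (chi_star \<phi> k n x ^ 4 * G k l x) \<partial>lborel)
        = (\<integral>\<^sup>+x. (\<Sum>n\<in>M. ennreal (chi_star \<phi> k n x ^ 4 * G k l x)) \<partial>lborel)"
      by (rule nn_integral_sum[symmetric]) measurable
    also have "\<dots> \<le> (\<integral>\<^sup>+x. ennreal (G k l x) \<partial>lborel)"
    proof (rule nn_integral_mono)
      fix x
      have "(\<Sum>n\<in>M. ennreal (chi_star \<phi> k n x ^ 4 * G k l x)) = ennreal (\<Sum>n\<in>M. chi_star \<phi> k n x ^ 4 * G k l x)"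
        using chi G0 by (intro sum_ennreal) auto
      also have "(\<Sum>n\<in>M. chi_star \<phi> k n x ^ 4 * G k l x) = (\<Sum>n\<in>M. chi_star \<phi> k n x ^ 4) * G k l x"
        by (simp add: sum_distrib_right)
      also have "\<dots> \<le> 1 * G k l x"
        by (intro mult_right_mono sum_chi_star_power_le phi_nonneg phi_S phi_0 fin G0)
      finally show "(\<Sum>n\<in>M. ennreal (chi_star \<phi> k n x ^ 4 * G k l x)) \<le> ennreal (G k l x)"
        by (simp add: ennreal_leI)
    qed
    finally show "(\<Sum>n\<in>M. \<integral>\<^sup>+x. ennreal (chi_star \<phi> k n x ^ 4 * G k l x) \<partial>lborel) \<le> (\<integral>\<^sup>+x. ennreal (G k l x) \<partial>lborel)" .
  qed
  finally show ?thesis unfolding L_def T_def G_def .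
qed

section \<open>From Lebesgue measurable to Borel data\<close>

lemma borel_version:
  fixes f :: "real \<Rightarrow> complex"
  assumes f: "f \<in> borel_measurable lebesgue" and S: "S \<in> sets borel"
    and le: "AE x in lebesgue. cmod (f x) \<le> indicator S x"
  obtains f' where "f' \<in> borel_measurable borel" "\<And>x. cmod (f' x) \<le> indicator S x" "AE x in lebesgue. f x = f' x"
proof -
  have "(\<lambda>x. Re (f x)) \<in> borel_measurable lebesgue" "(\<lambda>x. Im (f x)) \<in> borel_measurable lebesgue"
    using f by measurable
  then obtain r i where r: "r \<in> borel_measurable lborel" "AE x in lborel. Re (f x) = r x"
    and i: "i \<in> borel_measurable lborel" "AE x in lborel. Im (f x) = i x"
    using completion_ex_borel_measurable_real by metis
  have [measurable]: "r \<in> borel_measurable borel" "i \<in> borel_measurable borel" using r i by auto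
  define h where "h x = complex_of_real (r x) + \<i> * complex_of_real (i x)" for x
  have [measurable]: "h \<in> borel_measurable borel" unfolding h_def[abs_def] by measurable
  \<comment> \<open>Resetting \<open>h\<close> to 0 where the bound fails changes it only on a null
    set and makes the bound hold at every point.\<close>
  define f' where "f' x = (if cmod (h x) \<le> indicator S x then h x else 0)" for x
  note S[measurable]
  show ?thesis
  proof
    show "f' \<in> borel_measurable borel" unfolding f'_def[abs_def] by measurable
    show "cmod (f' x) \<le> indicator S x" for x by (simp add: f'_def)
    have "AE x in lebesgue. f x = h x"
      using AE_completion[OF r(2)] AE_completion[OF i(2)]
      by eventually_elim (simp add: h_def complex_eq_iff)
    with le show "AE x in lebesgue. f x = f' x" by eventually_elim (simp add: f'_def)
  qed
qed

lemma conv_cong_AE: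
  fixes f f' g :: "real \<Rightarrow> complex"
  assumes f: "f \<in> borel_measurable lebesgue" and f': "f' \<in> borel_measurable borel" and ae: "AE x in lebesgue. f x = f' x"
    and g: "g \<in> borel_measurable borel"
  shows "conv f g = conv f' g"
proof
  fix x
  have g': "(\<lambda>y. g (x - y)) \<in> borel_measurable lebesgue"
    by (rule measurable_completion) (use g in measurable)
  have f'l: "f' \<in> borel_measurable lebesgue" by (rule measurable_completion) (use f' in simp)
  show "conv f g x = conv f' g x"
    unfolding conv_def
    by (rule integral_cong_AE) (use f f'l g' ae in auto)
qed

lemma measurable_psi_kl: "schwartz \<psi> \<Longrightarrow> psi_kl \<psi> k l \<in> borel_measurable borel"
  unfolding psi_kl_dil
  by (rule dil_measurable) (use schwartz_measurable[of \<psi>] in measurable)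

lemma Lambda_S_cong_AE:
  assumes psi: "schwartz \<psi>"
    and f: "f1 \<in> borel_measurable lebesgue" "f2 \<in> borel_measurable lebesgue" "f3 \<in> borel_measurable lebesgue" "f4 \<in> borel_measurable lebesgue"
    and h: "h1 \<in> borel_measurable borel" "h2 \<in> borel_measurable borel" "h3 \<in> borel_measurable borel" "h4 \<in> borel_measurable borel"
    and ae: "AE x in lebesgue. f1 x = h1 x" "AE x in lebesgue. f2 x = h2 x" "AE x in lebesgue. f3 x = h3 x" "AE x in lebesgue. f4 x = h4 x"
  shows "Lambda_S \<psi> \<phi> S f1 f2 f3 f4 = Lambda_S \<psi> \<phi> S h1 h2 h3 h4"
proof -
  note c = conv_cong_AE[OF _ _ _ measurable_psi_kl[OF psi]]
  have "wave_packet \<psi> \<phi> f1 = wave_packet \<psi> \<phi> h1" "wave_packet \<psi> \<phi> f2 = wave_packet \<psi> \<phi> h2"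
    "wave_packet \<psi> \<phi> f3 = wave_packet \<psi> \<phi> h3" "wave_packet \<psi> \<phi> f4 = wave_packet \<psi> \<phi> h4"
    unfolding wave_packet_def[abs_def] c[OF f(1) h(1) ae(1)] c[OF f(2) h(2) ae(2)] c[OF f(3) h(3) ae(3)] c[OF f(4) h(4) ae(4)]
    by simp_all
  then show ?thesis unfolding Lambda_S_def by simp
qed

lemma wave_packet_null:
  assumes psi: "schwartz \<psi>" and f: "f \<in> borel_measurable lebesgue" "AE x in lebesgue. f x = 0"
  shows "wave_packet \<psi> \<phi> f k n l x = 0"
proof -
  have "conv f (psi_kl \<psi> k l) = conv (\<lambda>_. 0) (psi_kl \<psi> k l)"
    using f by (intro conv_cong_AE measurable_psi_kl psi) auto
  then show ?thesis by (simp add: wave_packet_def conv_def)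
qed

lemma AE_zero_of_null_set:
  fixes f :: "real \<Rightarrow> complex"
  assumes F: "F \<in> sets lebesgue" "emeasure lebesgue F < \<infinity>" "measure lebesgue F = 0" and le: "\<forall>x. cmod (f x) \<le> indicator F x"
  shows "AE x in lebesgue. f x = 0"
proof -
  have "F \<in> null_sets lebesgue"
    using F by (auto simp: null_sets_def measure_def enn2real_eq_0_iff)
  then have "AE x in lebesgue. x \<notin> F" by (rule AE_not_in)
  then show ?thesis
  proof eventually_elim
    fix x assume "x \<notin> F"
    then show "f x = 0" using le[rule_format, of x] by simp
  qed
qed

lemma measure_main_part:
  assumes "F \<in> sets lebesgue" "emeasure lebesgue F < \<infinity>"
  shows "main_part lborel F \<in> sets borel" "emeasure lborel (main_part lborel F) < \<infinity>"
    "measure lborel (main_part lborel F) = measure lebesgue F" "AE x in lebesgue. x \<in> F \<longleftrightarrow> x \<in> main_part lborel F"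
proof -
  show "main_part lborel F \<in> sets borel" using main_part_sets[OF assms(1)] by simp
  have e: "emeasure lebesgue F = emeasure lborel (main_part lborel F)" using assms(1) by simp
  then show "emeasure lborel (main_part lborel F) < \<infinity>" using assms(2) by simp
  show "measure lborel (main_part lborel F) = measure lebesgue F" by (simp add: measure_def e)
  have "AE x in lebesgue. x \<notin> null_part lborel F" by (intro AE_completion AE_notin_null_part assms(1))
  then show "AE x in lebesgue. x \<in> F \<longleftrightarrow> x \<in> main_part lborel F"
    by eventually_elim (use main_part_null_part_Un[OF assms(1)] in blast)
qed

lemma borel_version_main_part:
  fixes f :: "real \<Rightarrow> complex"
  assumes f: "f \<in> borel_measurable lebesgue" and F: "F \<in> sets lebesgue" "emeasure lebesgue F < \<infinity>"
    and le: "\<forall>x. cmod (f x) \<le> indicator F x"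
  obtains f' where "f' \<in> borel_measurable borel" "\<And>x. cmod (f' x) \<le> indicator (main_part lborel F) x"
    "AE x in lebesgue. f x = f' x" "integrable lborel f'"
proof -
  note mp = measure_main_part[OF F]
  have "AE x in lebesgue. cmod (f x) \<le> indicator (main_part lborel F) x"
    using mp(4)
  proof eventually_elim
    case (elim x)
    then show ?case using le[rule_format, of x] by (simp add: indicator_def)
  qed
  then obtain f' where f': "f' \<in> borel_measurable borel" "\<And>x. cmod (f' x) \<le> indicator (main_part lborel F) x"
    "AE x in lebesgue. f x = f' x"
    using borel_version[OF f mp(1)] by blast
  moreover have "integrable lborel f'" by (rule integrable_le_indicator[OF f'(1) mp(1,2) f'(2)])
  ultimately show ?thesis by (rule that)
qed

text \<open>The range contains every frequency that occurs: \<open>l\<close> from -13 to -7, the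
  fixed 18, and 2 l + 18, which runs from -8 to 4. Summing the individual constants gives a common
  one.\<close>

lemma modulated_molecules:
  assumes "schwartz \<psi>"
  obtains B where "\<And>i::int. i \<in> {-13..18} \<Longrightarrow> molecule B (\<lambda>u. cis (pi * real_of_int i * u) * \<psi> u)"
proof -
  have "\<forall>i::int. \<exists>b\<ge>0. molecule b (\<lambda>u. cis (pi * real_of_int i * u) * \<psi> u)"
    using molecule_modulate[OF assms] by blast
  then obtain b where b: "\<And>i::int. 0 \<le> b i" "\<And>i. molecule (b i) (\<lambda>u. cis (pi * real_of_int i * u) * \<psi> u)"
    by metis
  show ?thesis
  proof (rule that[of "\<Sum>i\<in>{-13..18}. b i"])
    fix i :: int assume "i \<in> {-13..18}"
    then have "b i \<le> (\<Sum>i\<in>{-13..18}. b i)" using b(1) by (intro member_le_sum) auto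
    then show "molecule (\<Sum>i\<in>{-13..18}. b i) (\<lambda>u. cis (pi * real_of_int i * u) * \<psi> u)" by (rule molecule_mono[OF b(2)])
  qed
qed

text \<open>Trades |F| for |F'| in the final estimate. The exponent may be negative, and then the
  larger base has the smaller power; for exponents between 0 and 1 halving the base costs at most a
  factor 2.\<close>

lemma powr_comparable:
  fixes e :: real
  assumes "0 < N" "N / 2 \<le> M" "M \<le> N" "e \<le> 1"
  shows "N powr e \<le> 2 * M powr e"
proof (cases "0 \<le> e")
  case True
  have "N powr e \<le> (2 * M) powr e" using assms True by (intro powr_mono2) auto
  also have "\<dots> = 2 powr e * M powr e" using assms by (intro powr_mult)
  also have "\<dots> \<le> 2 powr 1 * M powr e" using assms by (intro mult_right_mono powr_mono) auto
  finally show ?thesis by simp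
next
  case False
  then have "N powr e \<le> M powr e" using assms by (intro powr_mono2') auto
  also have "\<dots> \<le> 2 * M powr e" by simp
  finally show ?thesis .
qed

text \<open>The infinite sum is encoded by one constant for all finite index sets \<open>S\<close>,
  with \<open>F'\<close> chosen before the functions and \<open>S\<close>. Such a uniform bound on
  finite partial sums also forces the full series to converge absolutely, with the same bound for
  its sum.\<close>

theorem theorem2p1:
  fixes \<psi> :: "real \<Rightarrow> complex" and \<phi> :: "real \<Rightarrow> real" and p1 p2 p3 :: real
  assumes psi_S: "schwartz \<psi>"
    and psi_supp: "\<forall>\<xi>. \<xi> \<notin> {0..1} \<longrightarrow> fourier \<psi> \<xi> = 0"
    and psi_sum: "\<forall>\<xi>. ((\<lambda>l::int. fourier \<psi> (\<xi> - real_of_int l / 2)) has_sum 1) UNIV"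
    and phi_nonneg: "\<forall>x. \<phi> x \<ge> 0"
    and phi_S: "schwartz (\<lambda>x. complex_of_real (\<phi> x))"
    and phi_supp: "\<forall>\<xi>. \<xi> \<notin> {-1..1} \<longrightarrow> fourier (\<lambda>x. complex_of_real (\<phi> x)) \<xi> = 0"
    and phi_0: "fourier (\<lambda>x. complex_of_real (\<phi> x)) 0 = 1"
    and p1: "1 < p1" "p1 < 2" and p2: "1 < p2" "p2 < 2"
    and p12: "1 / p1 + 1 / p2 < 3 / 2"
    and p3: "1 < p3"
  shows "\<exists>C. \<forall>F1 F2 F3 F.
     F1 \<in> sets lebesgue \<and> emeasure lebesgue F1 < \<infinity> \<and>
     F2 \<in> sets lebesgue \<and> emeasure lebesgue F2 < \<infinity> \<and>
     F3 \<in> sets lebesgue \<and> emeasure lebesgue F3 < \<infinity> \<and>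
     F \<in> sets lebesgue \<and> emeasure lebesgue F < \<infinity> \<longrightarrow>
     (\<exists>F'. F' \<in> sets lebesgue \<and> F' \<subseteq> F \<and> measure lebesgue F' \<ge> measure lebesgue F / 2 \<and>
        (\<forall>f1 f2 f3 f4 S.
           f1 \<in> borel_measurable lebesgue \<and> f2 \<in> borel_measurable lebesgue \<and>
           f3 \<in> borel_measurable lebesgue \<and> f4 \<in> borel_measurable lebesgue \<and>
           (\<forall>x. cmod (f1 x) \<le> indicator F1 x) \<and> (\<forall>x. cmod (f2 x) \<le> indicator F2 x) \<and>
           (\<forall>x. cmod (f3 x) \<le> indicator F3 x) \<and> (\<forall>x. cmod (f4 x) \<le> indicator F' x) \<and>
           finite S \<longrightarrow>
           cmod (Lambda_S \<psi> \<phi> S f1 f2 f3 f4) \<le>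
             C * measure lebesgue F1 powr (1 / p1) * measure lebesgue F2 powr (1 / p2)
               * measure lebesgue F3 powr (1 / p3)
               * measure lebesgue F' powr (1 - (1 / p1 + 1 / p2 + 1 / p3))))"
proof -
  define md where "md i u = cis (pi * real_of_int i * u) * \<psi> u" for i :: int and u
  obtain B where "\<And>i::int. i \<in> {-13..18} \<Longrightarrow> molecule B (\<lambda>u. cis (pi * real_of_int i * u) * \<psi> u)"
    using modulated_molecules[OF psi_S] by blast
  then have B: "molecule B (md i)" if "i \<in> {-13..18}" for i using that unfolding md_def[abs_def] by blast
  have psm: "\<psi> \<in> borel_measurable borel" by (rule schwartz_measurable[OF psi_S])
  \<comment> \<open>The mean is the transform of \<psi> at -l/2, which is at least 7/2 and so lies
    outside [0, 1].\<close>
  have mean: "(\<integral>u. md l u \<partial>lborel) = 0" if "l \<in> {-13..-7}" for l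
  proof -
    have "(\<integral>u. md l u \<partial>lborel) = fourier (md l) 0"
      using fourier_lborel[OF molecule_measurable[OF B[of l]], of 0] that by simp
    also have "\<dots> = fourier \<psi> (0 - real_of_int l / 2)"
      unfolding md_def[abs_def] by (rule fourier_modulate[OF psm])
    also have "\<dots> = 0" using that psi_supp by auto
    finally show ?thesis .
  qed
  define \<alpha>1 where "\<alpha>1 = 1 / p1"
  define \<alpha>2 where "\<alpha>2 = 1 / p2"
  define \<alpha>3 where "\<alpha>3 = 1 / p3"
  have \<alpha>: "1 / 2 \<le> \<alpha>1" "\<alpha>1 \<le> 1" "1 / 2 \<le> \<alpha>2" "\<alpha>2 \<le> 1" "0 \<le> \<alpha>3" "\<alpha>3 \<le> 1"
    using p1 p2 p3 by (auto simp: \<alpha>1_def \<alpha>2_def \<alpha>3_def field_simps)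
  define e where "e = 1 - (\<alpha>1 + \<alpha>2 + \<alpha>3)"
  have e1: "e \<le> 1" using \<alpha> by (simp add: e_def)
  define C0 where "C0 = 10368 * B\<^sup>2 * (1728 * B\<^sup>2 + 4)"
  have C0: "0 \<le> C0" by (simp add: C0_def)
  show ?thesis
    unfolding \<alpha>1_def[symmetric] \<alpha>2_def[symmetric] \<alpha>3_def[symmetric] e_def[symmetric]
  \<comment> \<open>Seven values of \<open>l\<close>, times the factor 2 for replacing |F| by
    |F'|.\<close>
  proof (rule exI[of _ "14 * C0"], intro allI impI, elim conjE)
    fix F1 F2 F3 F :: "real set"
    assume F1: "F1 \<in> sets lebesgue" "emeasure lebesgue F1 < \<infinity>" and F2: "F2 \<in> sets lebesgue" "emeasure lebesgue F2 < \<infinity>"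
      and F3: "F3 \<in> sets lebesgue" "emeasure lebesgue F3 < \<infinity>" and F: "F \<in> sets lebesgue" "emeasure lebesgue F < \<infinity>"
    let ?\<mu> = "measure lebesgue"
    show "\<exists>F'. F' \<in> sets lebesgue \<and> F' \<subseteq> F \<and> ?\<mu> F' \<ge> ?\<mu> F / 2 \<and>
        (\<forall>f1 f2 f3 f4 S.
           f1 \<in> borel_measurable lebesgue \<and> f2 \<in> borel_measurable lebesgue \<and>
           f3 \<in> borel_measurable lebesgue \<and> f4 \<in> borel_measurable lebesgue \<and>
           (\<forall>x. cmod (f1 x) \<le> indicator F1 x) \<and> (\<forall>x. cmod (f2 x) \<le> indicator F2 x) \<and>
           (\<forall>x. cmod (f3 x) \<le> indicator F3 x) \<and> (\<forall>x. cmod (f4 x) \<le> indicator F' x) \<and>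
           finite S \<longrightarrow>
           cmod (Lambda_S \<psi> \<phi> S f1 f2 f3 f4) \<le>
             14 * C0 * ?\<mu> F1 powr \<alpha>1 * ?\<mu> F2 powr \<alpha>2 * ?\<mu> F3 powr \<alpha>3 * ?\<mu> F' powr e)"
    proof (cases "?\<mu> F1 = 0 \<or> ?\<mu> F2 = 0 \<or> ?\<mu> F3 = 0 \<or> ?\<mu> F = 0")
      \<comment> \<open>In this case the right-hand side is 0, as \<open>0 powr x\<close> is 0 even
        for negative \<open>x\<close>. The form vanishes too, because one of the four functions is
        zero almost everywhere.\<close>
      case True
      show ?thesis
      proof (rule exI[of _ F], intro conjI allI impI F order_refl, simp, elim conjE)
        fix f1 f2 f3 f4 :: "real \<Rightarrow> complex" and S :: "(int \<times> int \<times> int) set"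
        assume f: "f1 \<in> borel_measurable lebesgue" "f2 \<in> borel_measurable lebesgue"
           "f3 \<in> borel_measurable lebesgue" "f4 \<in> borel_measurable lebesgue"
          and le: "\<forall>x. cmod (f1 x) \<le> indicator F1 x" "\<forall>x. cmod (f2 x) \<le> indicator F2 x"
           "\<forall>x. cmod (f3 x) \<le> indicator F3 x" "\<forall>x. cmod (f4 x) \<le> indicator F x"
        have "Lambda_S \<psi> \<phi> S f1 f2 f3 f4 = 0"
          using True
            wave_packet_null[OF psi_S f(1) AE_zero_of_null_set[OF F1 _ le(1)]]
            wave_packet_null[OF psi_S f(2) AE_zero_of_null_set[OF F2 _ le(2)]]
            wave_packet_null[OF psi_S f(3) AE_zero_of_null_set[OF F3 _ le(3)]]
            wave_packet_null[OF psi_S f(4) AE_zero_of_null_set[OF F _ le(4)]]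
          unfolding Lambda_S_def by (elim disjE) simp_all
        then show "cmod (Lambda_S \<psi> \<phi> S f1 f2 f3 f4) \<le>
             14 * C0 * ?\<mu> F1 powr \<alpha>1 * ?\<mu> F2 powr \<alpha>2 * ?\<mu> F3 powr \<alpha>3 * ?\<mu> F powr e"
          using C0 by simp
      qed
    next
      case False
      define N where "N = ?\<mu> F"
      define G1 where "G1 = main_part lborel F1"
      define G2 where "G2 = main_part lborel F2"
      define G3 where "G3 = main_part lborel F3"
      note G1 = measure_main_part[OF F1, folded G1_def] and G2 = measure_main_part[OF F2, folded G2_def]
        and G3 = measure_main_part[OF F3, folded G3_def]
      have pos: "0 < ?\<mu> F1" "0 < ?\<mu> F2" "0 < ?\<mu> F3" "0 < N"
        using False by (auto simp: N_def zero_less_measure_iff)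
      have mpos: "0 < measure lborel G1" "0 < measure lborel G2" "0 < measure lborel G3"
        using pos by (simp_all add: G1(3) G2(3) G3(3))
      \<comment> \<open>With threshold 18 |G| / N each exceptional set has measure at most 3 |G|
        divided by it, which is N/6. Three of them remove at most half of F.\<close>
      define ex where "ex G = exceptional G (18 * measure lborel G / N)" for G
      have exm: "ex G \<in> sets lborel" for G by (simp add: ex_def)
      have ex_le: "emeasure lborel (ex G) \<le> ennreal (N / 6)"
        if "G \<in> sets borel" "emeasure lborel G < \<infinity>" "0 < measure lborel G" for G
      proof -
        have "emeasure lborel (ex G) \<le> ennreal (3 / (18 * measure lborel G / N) * measure lborel G)"
          unfolding ex_def using that pos by (intro emeasure_exceptional_le) auto
        also have "3 / (18 * measure lborel G / N) * measure lborel G = N / 6" using that pos by (simp add: field_simps)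
        finally show ?thesis .
      qed
      define E where "E = ex G1 \<union> ex G2 \<union> ex G3"
      have Em: "E \<in> sets lborel" unfolding E_def by (intro sets.Un exm)
      have E_le: "emeasure lborel E \<le> ennreal (N / 2)"
      proof -
        have "emeasure lborel E \<le> emeasure lborel (ex G1) + emeasure lborel (ex G2) + emeasure lborel (ex G3)"
          unfolding E_def by (intro order_trans[OF emeasure_subadditive] add_mono emeasure_subadditive order_refl sets.Un exm)
        also have "\<dots> \<le> ennreal (N / 6) + ennreal (N / 6) + ennreal (N / 6)"
          by (intro add_mono ex_le G1 G2 G3 mpos)
        also have "\<dots> = ennreal (N / 2)" using pos by (simp flip: ennreal_plus)
        finally show ?thesis .
      qed
      \<comment> \<open>\<open>E\<close> has finite measure, so its complement is nonempty and the
        distance to it is meaningful.\<close>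
      have Ene: "- E \<noteq> {}"
      proof
        assume "- E = {}"
        then have "E = UNIV" by auto
        then show False using E_le by (simp add: top_unique)
      qed
      define F' where "F' = F - E"
      have El: "E \<in> sets lebesgue" using Em by (rule sets_completionI_sets)
      have F'm: "F' \<in> sets lebesgue" unfolding F'_def using F(1) El by (rule sets.Diff)
      have F'f: "emeasure lebesgue F' < \<infinity>"
        using emeasure_mono[of F' F lebesgue] F by (auto simp: F'_def intro: le_less_trans)
      have F'le: "?\<mu> F' \<le> N"
        unfolding N_def F'_def using F F'm by (intro measure_mono_fmeasurable) (auto simp: fmeasurable_def F'_def)
      have F'ge: "N / 2 \<le> ?\<mu> F'"
      proof -
        have "emeasure lebesgue F \<le> emeasure lebesgue F' + emeasure lebesgue E"
        proof -
          have "emeasure lebesgue F \<le> emeasure lebesgue (F' \<union> E)"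
            by (rule emeasure_mono[OF _ sets.Un[OF F'm El]]) (auto simp: F'_def)
          also have "\<dots> \<le> emeasure lebesgue F' + emeasure lebesgue E" by (rule emeasure_subadditive[OF F'm El])
          finally show ?thesis .
        qed
        also have "\<dots> \<le> ennreal (?\<mu> F') + ennreal (N / 2)"
          using E_le Em F'f by (intro add_mono) (auto simp: emeasure_eq_ennreal_measure)
        also have "\<dots> = ennreal (?\<mu> F' + N / 2)" using pos by (simp flip: ennreal_plus)
        finally have "ennreal N \<le> ennreal (?\<mu> F' + N / 2)"
          unfolding N_def using F(2) by (subst (asm) emeasure_eq_ennreal_measure) auto
        then have "N \<le> ?\<mu> F' + N / 2" by (subst (asm) ennreal_le_iff) (use pos in auto)
        then show ?thesis by simp
      qed
      show ?thesis
      proof (rule exI[of _ F'], intro conjI allI impI F'm, simp add: F'_def, use F'ge in \<open>simp add: N_def\<close>, elim conjE)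
        fix f1 f2 f3 f4 :: "real \<Rightarrow> complex" and S :: "(int \<times> int \<times> int) set"
        assume f: "f1 \<in> borel_measurable lebesgue" "f2 \<in> borel_measurable lebesgue"
           "f3 \<in> borel_measurable lebesgue" "f4 \<in> borel_measurable lebesgue"
          and le: "\<forall>x. cmod (f1 x) \<le> indicator F1 x" "\<forall>x. cmod (f2 x) \<le> indicator F2 x"
           "\<forall>x. cmod (f3 x) \<le> indicator F3 x" "\<forall>x. cmod (f4 x) \<le> indicator F' x"
          and S: "finite S"
        obtain h1 where h1: "h1 \<in> borel_measurable borel" "\<And>x. cmod (h1 x) \<le> indicator G1 x"
          "AE x in lebesgue. f1 x = h1 x" "integrable lborel h1"
          using borel_version_main_part[OF f(1) F1 le(1)] unfolding G1_def by blast
        obtain h2 where h2: "h2 \<in> borel_measurable borel" "\<And>x. cmod (h2 x) \<le> indicator G2 x"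
          "AE x in lebesgue. f2 x = h2 x" "integrable lborel h2"
          using borel_version_main_part[OF f(2) F2 le(2)] unfolding G2_def by blast
        obtain h3 where h3: "h3 \<in> borel_measurable borel" "\<And>x. cmod (h3 x) \<le> indicator G3 x"
          "AE x in lebesgue. f3 x = h3 x" "integrable lborel h3"
          using borel_version_main_part[OF f(3) F3 le(3)] unfolding G3_def by blast
        obtain h4 where h4: "h4 \<in> borel_measurable borel" "\<And>x. cmod (h4 x) \<le> indicator (main_part lborel F') x"
          "AE x in lebesgue. f4 x = h4 x" "integrable lborel h4"
          using borel_version_main_part[OF f(4) F'm F'f le(4)] by blast
        \<comment> \<open>The Borel core only loses points of \<open>F'\<close>, so
          \<open>h4\<close> still vanishes on all of \<open>E\<close>, not merely almost everywhere;
          the decay estimate for the fourth factor is applied in this form.\<close>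
        have "main_part lborel F' \<subseteq> - E"
          using main_part_null_part_Un[OF F'm] by (auto simp: F'_def)
        then have h4E: "cmod (h4 x) \<le> indicator (- E) x" for x
          by (intro order_trans[OF h4(2)]) (auto simp: indicator_def)
        define X where "X = N * (?\<mu> F1 / N) powr \<alpha>1 * (?\<mu> F2 / N) powr \<alpha>2 * (?\<mu> F3 / N) powr \<alpha>3"
        have X0: "0 \<le> X" using pos by (simp add: X_def)
        have "Lambda_S \<psi> \<phi> S f1 f2 f3 f4 = Lambda_S \<psi> \<phi> S h1 h2 h3 h4"
          by (rule Lambda_S_cong_AE[OF psi_S f h1(1) h2(1) h3(1) h4(1) h1(3) h2(3) h3(3) h4(3)])
        then have "ennreal (cmod (Lambda_S \<psi> \<phi> S f1 f2 f3 f4)) = ennreal (cmod (Lambda_S \<psi> \<phi> S h1 h2 h3 h4))" by simp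
        also have "\<dots> \<le> (\<Sum>l\<in>{-13..-7}. \<Sum>k\<in>fst ` S. \<integral>\<^sup>+x. ennreal (cmod (conv h1 (psi_kl \<psi> k l) x) * cmod (conv h2 (psi_kl \<psi> k l) x) *
            cmod (conv h3 (psi_kl \<psi> k 18) x) * cmod (conv h4 (psi_kl \<psi> k (2 * l + 18)) x)) \<partial>lborel)"
          by (rule Lambda_S_le[OF psi_S psi_supp phi_nonneg phi_S phi_supp phi_0 h1(4) h2(4) h3(4) h4(4) S])
        also have "\<dots> \<le> (\<Sum>l\<in>{-13..-7::int}. ennreal (C0 * X))"
        proof (rule sum_mono)
          fix l :: int assume l: "l \<in> {-13..-7}"
          have ml: "molecule B (md l)" "molecule B (md 18)" "molecule B (md (2 * l + 18))" using l by (auto intro!: B)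
          have pk: "psi_kl \<psi> k i = dil k (md i)" for k i unfolding psi_kl_dil md_def[abs_def] ..
          have E3: "exceptional G1 (18 * measure lborel G1 / N) \<subseteq> E" "exceptional G2 (18 * measure lborel G2 / N) \<subseteq> E"
            "exceptional G3 (18 * measure lborel G3 / N) \<subseteq> E" by (auto simp: E_def ex_def)
          show "(\<Sum>k\<in>fst ` S. \<integral>\<^sup>+x. ennreal (cmod (conv h1 (psi_kl \<psi> k l) x) * cmod (conv h2 (psi_kl \<psi> k l) x) *
            cmod (conv h3 (psi_kl \<psi> k 18) x) * cmod (conv h4 (psi_kl \<psi> k (2 * l + 18)) x)) \<partial>lborel) \<le> ennreal (C0 * X)"
            unfolding pk C0_def X_def G1(3)[symmetric] G2(3)[symmetric] G3(3)[symmetric]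
            by (rule paraproduct_estimate[OF G1(1,2) mpos(1) G2(1,2) mpos(2) G3(1,2) mpos(3) pos(4) E3 Ene
                  h1(1,2) h2(1,2) h3(1,2) h4(1) h4E ml mean[OF l] finite_imageI[OF S] \<alpha>])
        qed
        also have "\<dots> = ennreal (7 * (C0 * X))" using C0 X0 by (simp add: ennreal_mult)
        finally have "cmod (Lambda_S \<psi> \<phi> S f1 f2 f3 f4) \<le> 7 * (C0 * X)" using C0 X0 by (simp add: ennreal_le_iff)
        also have "X = ?\<mu> F1 powr \<alpha>1 * ?\<mu> F2 powr \<alpha>2 * ?\<mu> F3 powr \<alpha>3 * N powr e"
        proof -
          have "N powr e = N / (N powr \<alpha>1 * N powr \<alpha>2 * N powr \<alpha>3)"
            using pos by (simp add: e_def powr_diff powr_add)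
          then show ?thesis using pos by (simp add: X_def powr_divide field_simps)
        qed
        also have "7 * (C0 * (?\<mu> F1 powr \<alpha>1 * ?\<mu> F2 powr \<alpha>2 * ?\<mu> F3 powr \<alpha>3 * N powr e))
          \<le> 7 * (C0 * (?\<mu> F1 powr \<alpha>1 * ?\<mu> F2 powr \<alpha>2 * ?\<mu> F3 powr \<alpha>3 * (2 * ?\<mu> F' powr e)))"
          using C0 by (intro mult_left_mono powr_comparable pos F'ge F'le e1) auto
        finally show "cmod (Lambda_S \<psi> \<phi> S f1 f2 f3 f4) \<le>
             14 * C0 * ?\<mu> F1 powr \<alpha>1 * ?\<mu> F2 powr \<alpha>2 * ?\<mu> F3 powr \<alpha>3 * ?\<mu> F' powr e"
          by (simp add: mult_ac)
      qed
    qed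
  qed
qed

end
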